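(* Let $(G,\sigma)$ be a flow-admissible signed graph with $m$ edges and let $\epsilon_N$ be the number of negative edges in a minimum signature of $(G,\sigma)$. Then there is a signed circuit cover of $(G,\sigma)$ of length at most $\frac{11}{3}\cdot m-\frac{5}{3}\cdot\epsilon_N$.
   Context: Graphs are finite and may have parallel edges and loops. A signed graph $(G,\sigma)$ is a graph $G$ with a signature $\sigma:E(G)\to\{1,-1\}$; edges of value $1$ are positive, edges of value $-1$ are negative. A circuit is a connected 2-regular graph (a loop is a circuit, and so is a pair of parallel edges). A circuit is balanced if it has an even number of negative edges, and unbalanced otherwise. Two signed graphs $(G,\sigma_1)$, $(G,\sigma_2)$ on the same graph are equivalent if they have the same balanced circuits. A signature $\sigma$ is a minimum signature of $(G,\sigma)$ if no signed graph equivalent to $(G,\sigma)$ has fewer negative edges; "a minimum signature of $(G,\sigma)$" means a signature with fewest negative edges among all signatures equivalent to $\sigma$. A signed circuit is a signed graph of one of the following forms: (1) a balanced circuit; (2) the union of two unbalanced circuits which meet at a single vertex (a short barbell); (3) the union of two disjoint unbalanced circuits with a path which meets the circuits only at its ends, one end on each circuit (a long barbell). A signed graph is flow-admissible if it admits a signed nowhere-zero (integer) flow; equivalently (a known result of Bouchet), if every edge of it belongs to a signed circuit of it. A signed circuit cover of $(G,\sigma)$ is a collection $\mathcal C$ of subgraphs of $(G,\sigma)$, each a signed circuit, such that each edge of $G$ is contained in at least one member of $\mathcal C$. Its length is $\sum_{F\in\mathcal C}|E(F)|$. *)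

theory Defs
  imports Complex_Main "Graph_Theory.Digraph_Component"
begin

text \<open>
  A finite graph, with loops and parallel edges allowed, is represented by a finite digraph
  (locale \<^locale>\<open>fin_digraph\<close>) in which each edge is exactly one arc. The direction of the arc
  carries no meaning: it only gives names (tail and head) to the two ends of the edge,
  so that the two half-edges of a loop can be told apart.
\<close>

text \<open>In the sum of in-degree and out-degree a loop counts twice.\<close>

definition circuit :: "('v, 'e) pre_digraph \<Rightarrow> bool" where
  "circuit C \<longleftrightarrow> fin_digraph C \<and> Digraph_Component.connected C \<and>
     (\<forall>v \<in> verts C. in_degree C v + out_degree C v = 2)"

definition path_between :: "('v, 'e) pre_digraph \<Rightarrow> 'v \<Rightarrow> 'v \<Rightarrow> bool" where
  "path_between P u w \<longleftrightarrow> (\<exists>vs es.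
     distinct vs \<and> distinct es \<and> length vs = Suc (length es) \<and>
     hd vs = u \<and> last vs = w \<and> verts P = set vs \<and> arcs P = set es \<and>
     (\<forall>i < length es. {tail P (es ! i), head P (es ! i)} = {vs ! i, vs ! Suc i}))"


definition signature :: "('v, 'e) pre_digraph \<Rightarrow> ('e \<Rightarrow> int) \<Rightarrow> bool" where
  "signature G \<sigma> \<longleftrightarrow> (\<forall>e \<in> arcs G. \<sigma> e \<in> {1, -1})"

definition negative_edges :: "('v, 'e) pre_digraph \<Rightarrow> ('e \<Rightarrow> int) \<Rightarrow> 'e set" where
  "negative_edges G \<sigma> = {e \<in> arcs G. \<sigma> e = -1}"

definition balanced_circuit :: "('e \<Rightarrow> int) \<Rightarrow> ('v, 'e) pre_digraph \<Rightarrow> bool" where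
  "balanced_circuit \<sigma> C \<longleftrightarrow> circuit C \<and> even (card (negative_edges C \<sigma>))"

definition unbalanced_circuit :: "('e \<Rightarrow> int) \<Rightarrow> ('v, 'e) pre_digraph \<Rightarrow> bool" where
  "unbalanced_circuit \<sigma> C \<longleftrightarrow> circuit C \<and> odd (card (negative_edges C \<sigma>))"

definition equivalent_signatures ::
  "('v, 'e) pre_digraph \<Rightarrow> ('e \<Rightarrow> int) \<Rightarrow> ('e \<Rightarrow> int) \<Rightarrow> bool" where
  "equivalent_signatures G \<sigma>\<^sub>1 \<sigma>\<^sub>2 \<longleftrightarrow> signature G \<sigma>\<^sub>1 \<and> signature G \<sigma>\<^sub>2 \<and>
     {C. subgraph C G \<and> balanced_circuit \<sigma>\<^sub>1 C} = {C. subgraph C G \<and> balanced_circuit \<sigma>\<^sub>2 C}"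

text \<open>The signature \<open>\<tau>\<close> has fewest negative edges among all signatures equivalent to \<open>\<sigma>\<close>.\<close>

definition minimum_signature ::
  "('v, 'e) pre_digraph \<Rightarrow> ('e \<Rightarrow> int) \<Rightarrow> ('e \<Rightarrow> int) \<Rightarrow> bool" where
  "minimum_signature G \<sigma> \<tau> \<longleftrightarrow> equivalent_signatures G \<sigma> \<tau> \<and>
     (\<forall>\<tau>'. equivalent_signatures G \<sigma> \<tau>' \<longrightarrow>
        card (negative_edges G \<tau>) \<le> card (negative_edges G \<tau>'))"


text \<open>
  The disjointness of the arc sets below is not redundant: without it, an unbalanced loop taken
  twice would qualify, since it shares exactly one vertex with itself.
\<close>

definition short_barbell :: "('e \<Rightarrow> int) \<Rightarrow> ('v, 'e) pre_digraph \<Rightarrow> bool" where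
  "short_barbell \<sigma> B \<longleftrightarrow> (\<exists>C\<^sub>1 C\<^sub>2 v.
     subgraph C\<^sub>1 B \<and> subgraph C\<^sub>2 B \<and>
     unbalanced_circuit \<sigma> C\<^sub>1 \<and> unbalanced_circuit \<sigma> C\<^sub>2 \<and>
     verts C\<^sub>1 \<inter> verts C\<^sub>2 = {v} \<and> arcs C\<^sub>1 \<inter> arcs C\<^sub>2 = {} \<and>
     B = union C\<^sub>1 C\<^sub>2)"

definition long_barbell :: "('e \<Rightarrow> int) \<Rightarrow> ('v, 'e) pre_digraph \<Rightarrow> bool" where
  "long_barbell \<sigma> B \<longleftrightarrow> (\<exists>C\<^sub>1 C\<^sub>2 P u w.
     subgraph C\<^sub>1 B \<and> subgraph C\<^sub>2 B \<and> subgraph P B \<and>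
     unbalanced_circuit \<sigma> C\<^sub>1 \<and> unbalanced_circuit \<sigma> C\<^sub>2 \<and> path_between P u w \<and>
     verts C\<^sub>1 \<inter> verts C\<^sub>2 = {} \<and>
     verts P \<inter> verts C\<^sub>1 = {u} \<and> verts P \<inter> verts C\<^sub>2 = {w} \<and>
     B = union (union C\<^sub>1 C\<^sub>2) P)"

definition signed_circuit :: "('e \<Rightarrow> int) \<Rightarrow> ('v, 'e) pre_digraph \<Rightarrow> bool" where
  "signed_circuit \<sigma> F \<longleftrightarrow> balanced_circuit \<sigma> F \<or> short_barbell \<sigma> F \<or> long_barbell \<sigma> F"


text \<open>
  An orientation of a signed graph gives each half-edge a direction; the half-edges of \<open>e\<close> at
  its tail and at its head have values \<open>ot e\<close> and \<open>oh e\<close>, with 1 for pointing away from the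
  incident vertex and -1 for pointing towards it. On a positive edge exactly one of the two
  half-edges points away from its vertex; on a negative edge both or neither do.
\<close>

definition orientation ::
  "('v, 'e) pre_digraph \<Rightarrow> ('e \<Rightarrow> int) \<Rightarrow> ('e \<Rightarrow> int) \<Rightarrow> ('e \<Rightarrow> int) \<Rightarrow> bool" where
  "orientation G \<sigma> ot oh \<longleftrightarrow>
     (\<forall>e \<in> arcs G. ot e \<in> {1, -1} \<and> oh e \<in> {1, -1} \<and> ot e * oh e = - \<sigma> e)"

definition nowhere_zero_flow ::
  "('v, 'e) pre_digraph \<Rightarrow> ('e \<Rightarrow> int) \<Rightarrow> ('e \<Rightarrow> int) \<Rightarrow> ('e \<Rightarrow> int) \<Rightarrow> bool" where
  "nowhere_zero_flow G ot oh f \<longleftrightarrow>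
     (\<forall>e \<in> arcs G. f e \<noteq> 0) \<and>
     (\<forall>v \<in> verts G. (\<Sum>e \<in> out_arcs G v. ot e * f e) + (\<Sum>e \<in> in_arcs G v. oh e * f e) = 0)"

definition flow_admissible :: "('v, 'e) pre_digraph \<Rightarrow> ('e \<Rightarrow> int) \<Rightarrow> bool" where
  "flow_admissible G \<sigma> \<longleftrightarrow> (\<exists>ot oh f. orientation G \<sigma> ot oh \<and> nowhere_zero_flow G ot oh f)"


definition signed_circuit_cover ::
  "('v, 'e) pre_digraph \<Rightarrow> ('e \<Rightarrow> int) \<Rightarrow> ('v, 'e) pre_digraph set \<Rightarrow> bool" where
  "signed_circuit_cover G \<sigma> \<C> \<longleftrightarrow> finite \<C> \<and>
     (\<forall>F \<in> \<C>. subgraph F G \<and> signed_circuit \<sigma> F) \<and>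
     (\<forall>e \<in> arcs G. \<exists>F \<in> \<C>. e \<in> arcs F)"

definition cover_length :: "('v, 'e) pre_digraph set \<Rightarrow> nat" where
  "cover_length \<C> = (\<Sum>F \<in> \<C>. card (arcs F))"

end

theory Submission
  imports Defs
begin

text \<open>
  Let \<open>N\<close> be the set of negative edges of a minimum signature and \<open>P\<close> the set of positive edges
  that are not bridges of the positive subgraph. The graph \<open>P\<close> is bridgeless, so Seymour's 6-flow
  theorem yields three Eulerian sets of total size at most \<open>5/3 |P|\<close> covering it; they split into
  positive circuits.

  It remains to cover \<open>N\<close> and the positive bridges. Minimality means that at most half of the edges
  of any cut are negative. Every \<open>N' \<subseteq> N\<close> is the negative part of an Eulerian set \<open>D\<close>, and \<open>D\<close> can
  be chosen with at most \<open>|P|/2\<close> edges in \<open>P\<close> by averaging over the cycle space. If each component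
  contains evenly many edges of \<open>N'\<close>, the unbalanced circuits of \<open>D\<close> can be paired up by disjoint
  positive paths, again with at most \<open>|P|/2\<close> edges in \<open>P\<close>, and every bridge that has oddly many edges
  of \<open>N'\<close> on one side is covered by a barbell. By flow-admissibility one can assign nonzero elements
  of \<open>\<int>\<^sub>2 \<times> \<int>\<^sub>2\<close> to the negative edges such that the sum over each component is zero and the sum
  over each side of a bridge is nonzero. Any two of the three nonzero functionals on \<open>\<int>\<^sub>2 \<times> \<int>\<^sub>2\<close> then
  give sets \<open>N'\<close> for which all edges of \<open>N\<close> and all bridges are covered, and the best two of the
  three sets \<open>D\<close> contain together at most \<open>4/3\<close> times the number of positive bridges.
\<close>

text \<open>Connectivity, joins and Eulerian sets are expressed by the edges that cross vertex sets,
  so parity replaces walks, and loops, which cross nothing, need little care. Paths appear only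
  where circuits and barbells must be exhibited. The obstacle is the positive bridges. By minimality
  the cut of such an edge contains at most one negative edge. If it contains one, an Eulerian set
  contains both edges or neither, so the bridge is covered along with its partner. Otherwise it is a
  bridge of the whole graph, lies in no circuit, and must be on the path of a barbell. One bit per
  negative edge is not enough for this: three bridges meeting at a vertex without other edges cannot
  all have odd sides if the component is to be even. Let c, b, n count the positive non-bridges, the
  positive bridges and the negative edges. Each of the two parts costs at most n + b + c plus the
  bridges in its \<open>D\<close>; the latter are at most 4b/3 for both parts together. With 5c/3
  for the positive circuits this gives 11c/3 + 10b/3 + 2n, which is at most 11m/3 - 5n/3 because m =
  c + b + n.\<close>

section \<open>Cuts, Eulerian edge sets and connectivity\<close>

lemma odd_card_sym_diff:
  assumes "finite A" "finite B"
  shows "odd (card (sym_diff A B)) \<longleftrightarrow> odd (card A) \<noteq> odd (card B)"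
proof -
  have "card A = card (A - B) + card (A \<inter> B)" "card B = card (B - A) + card (A \<inter> B)"
    using card_Int_Diff[OF assms(1), of B] card_Int_Diff[OF assms(2), of A]
    by (simp_all add: Int_commute)
  moreover have "card (sym_diff A B) = card (A - B) + card (B - A)"
    using assms by (intro card_Un_disjoint) auto
  ultimately show ?thesis by (simp, argo)
qed

locale ends =
  fixes t h :: "'e \<Rightarrow> 'v"
begin

definition cut :: "'v set \<Rightarrow> 'e set" where
  "cut S = {e. (t e \<in> S) \<noteq> (h e \<in> S)}"

definition inside :: "'v set \<Rightarrow> 'e set" where
  "inside S = {e. t e \<in> S \<and> h e \<in> S}"

definition par :: "'e set \<Rightarrow> 'v set \<Rightarrow> bool" where
  "par F S \<longleftrightarrow> odd (card (F \<inter> cut S))"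

text \<open>For finite \<open>F\<close> this amounts to even degrees, see
  \<open>eulerian_if_even_dg\<close>; quantifying over all vertex sets makes every cut directly
  available.\<close>

definition eulerian :: "'e set \<Rightarrow> bool" where
  "eulerian F \<longleftrightarrow> (\<forall>S. \<not> par F S)"

text \<open>For finite \<open>F\<close> this is a \<open>{u, w}\<close>-join: the odd degrees are
  exactly those of \<open>u\<close> and \<open>w\<close>, and \<open>u = w\<close> leaves an
  Eulerian set.\<close>

definition joins :: "'e set \<Rightarrow> 'v \<Rightarrow> 'v \<Rightarrow> bool" where
  "joins F u w \<longleftrightarrow> (\<forall>S. par F S \<longleftrightarrow> (u \<in> S) \<noteq> (w \<in> S))"

text \<open>Reachability along \<open>F\<close> in dual form: if \<open>w\<close> were not reachable
  from \<open>u\<close>, the set of reachable vertices would be an uncrossed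
  \<open>S\<close>.\<close>

definition con :: "'e set \<Rightarrow> 'v \<Rightarrow> 'v \<Rightarrow> bool" where
  "con F u w \<longleftrightarrow> (\<forall>S. u \<in> S \<longrightarrow> w \<notin> S \<longrightarrow> F \<inter> cut S \<noteq> {})"

definition component :: "'e set \<Rightarrow> 'v \<Rightarrow> 'v set" where
  "component F u = {w. con F u w}"

lemma cut_Compl [simp]: "cut (- S) = cut S"
  by (auto simp: cut_def)

lemma par_empty [simp]: "\<not> par {} S"
  by (simp add: par_def)

lemma eulerian_empty [simp]: "eulerian {}"
  by (simp add: eulerian_def)

lemma joins_refl_iff: "joins F u u \<longleftrightarrow> eulerian F"
  by (simp add: joins_def eulerian_def)

lemma joins_sym: "joins F u w \<Longrightarrow> joins F w u"
  by (auto simp: joins_def)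

lemma par_sym_diff:
  assumes "finite A" "finite B"
  shows "par (sym_diff A B) S \<longleftrightarrow> par A S \<noteq> par B S"
proof -
  have "sym_diff A B \<inter> cut S = sym_diff (A \<inter> cut S) (B \<inter> cut S)" by auto
  then show ?thesis
    using odd_card_sym_diff[of "A \<inter> cut S" "B \<inter> cut S"] assms by (simp add: par_def)
qed

lemma par_Diff:
  assumes "finite A" "B \<subseteq> A"
  shows "par (A - B) S \<longleftrightarrow> par A S \<noteq> par B S"
proof -
  have "sym_diff A B = A - B" using assms(2) by blast
  then show ?thesis using par_sym_diff[of A B S] assms finite_subset[OF assms(2)] by simp
qed

lemma par_Un:
  assumes "finite A" "finite B" "A \<inter> B = {}"
  shows "par (A \<union> B) S \<longleftrightarrow> par A S \<noteq> par B S"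
proof -
  have "sym_diff A B = A \<union> B" using assms by auto
  then show ?thesis using par_sym_diff[of A B S] assms by simp
qed

lemma par_singleton: "par {e} S \<longleftrightarrow> (t e \<in> S) \<noteq> (h e \<in> S)"
  by (cases "e \<in> cut S") (auto simp: par_def cut_def)

lemma joins_singleton: "joins {e} (t e) (h e)"
  by (simp add: joins_def par_singleton)

lemma par_cut_sym_diff: "finite F \<Longrightarrow> par F (sym_diff S T) \<longleftrightarrow> par F S \<noteq> par F T"
proof -
  assume "finite F"
  have "F \<inter> cut (sym_diff S T) = sym_diff (F \<inter> cut S) (F \<inter> cut T)"
    by (auto simp: cut_def)
  then show ?thesis
    using odd_card_sym_diff[of "F \<inter> cut S" "F \<inter> cut T"] \<open>finite F\<close> by (simp add: par_def)
qed

lemma eulerian_sym_diff: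
  "finite A \<Longrightarrow> finite B \<Longrightarrow> eulerian A \<Longrightarrow> eulerian B \<Longrightarrow> eulerian (sym_diff A B)"
  by (simp add: eulerian_def par_sym_diff)

lemma eulerian_Diff: "finite A \<Longrightarrow> B \<subseteq> A \<Longrightarrow> eulerian A \<Longrightarrow> eulerian B \<Longrightarrow> eulerian (A - B)"
  by (simp add: eulerian_def par_Diff)

lemma eulerian_Un:
  "finite A \<Longrightarrow> finite B \<Longrightarrow> A \<inter> B = {} \<Longrightarrow> eulerian A \<Longrightarrow> eulerian B \<Longrightarrow> eulerian (A \<union> B)"
  by (simp add: eulerian_def par_Un)

lemma eulerian_even_cut: "eulerian F \<Longrightarrow> even (card (F \<inter> cut S))"
  by (simp add: eulerian_def par_def)

lemma eulerian_cut_other: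
  assumes "eulerian F" "e \<in> F" "e \<in> cut S"
  obtains e' where "e' \<in> F" "e' \<in> cut S" "e' \<noteq> e"
proof -
  have "F \<inter> cut S \<noteq> {e}" using eulerian_even_cut[OF assms(1), of S] by auto
  then show thesis using assms that by blast
qed

lemma par_inside:
  assumes "F \<inter> cut S = {}"
  shows "par (F \<inter> inside S) T \<longleftrightarrow> par F (T \<inter> S)"
proof -
  have "F \<inter> inside S \<inter> cut T = F \<inter> cut (T \<inter> S)"
    using assms by (auto simp: inside_def cut_def)
  then show ?thesis by (simp add: par_def)
qed

lemma eulerian_inside: "eulerian F \<Longrightarrow> F \<inter> cut S = {} \<Longrightarrow> eulerian (F \<inter> inside S)"
  by (simp add: eulerian_def par_inside)

lemma eulerian_join_insert:
  assumes "finite R" "joins R (t e) (h e)" "e \<notin> R"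
  shows "eulerian (insert e R)"
  using assms par_Un[of "{e}" R] by (simp add: eulerian_def joins_def par_singleton)

lemma join_sym_diff:
  assumes "finite R" "finite R'" "joins R u v" "joins R' v w"
  shows "joins (sym_diff R R') u w"
  using assms(3,4) par_sym_diff[OF assms(1,2)] unfolding joins_def by metis

section \<open>Connectedness, components and bridges\<close>

lemma con_refl [simp]: "con F u u"
  by (simp add: con_def)

lemma con_sym: "con F u w \<Longrightarrow> con F w u"
proof (unfold con_def, intro allI impI)
  fix S assume con: "\<forall>S. u \<in> S \<longrightarrow> w \<notin> S \<longrightarrow> F \<inter> cut S \<noteq> {}" and "w \<in> S" "u \<notin> S"
  then show "F \<inter> cut S \<noteq> {}" using con[rule_format, of "- S"] by simp
qed

lemma con_trans: "con F u v \<Longrightarrow> con F v w \<Longrightarrow> con F u w"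
  unfolding con_def by blast

lemma con_mono: "con F u w \<Longrightarrow> F \<subseteq> F' \<Longrightarrow> con F' u w"
  unfolding con_def by blast

lemma con_edge: "e \<in> F \<Longrightarrow> con F (t e) (h e)"
  unfolding con_def cut_def by blast

lemma cut_component [simp]: "F \<inter> cut (component F u) = {}"
proof (rule equals0I)
  fix e assume "e \<in> F \<inter> cut (component F u)"
  then have "con F (t e) (h e)" "con F (h e) (t e)" "con F u (t e) \<noteq> con F u (h e)"
    using con_edge con_sym by (auto simp: cut_def component_def)
  then show False using con_trans by metis
qed

lemma self_in_component [simp]: "u \<in> component F u"
  by (simp add: component_def)

lemma component_least: "u \<in> S \<Longrightarrow> F \<inter> cut S = {} \<Longrightarrow> component F u \<subseteq> S"
  unfolding component_def con_def by blast

lemma component_eq: "con F u w \<Longrightarrow> component F u = component F w"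
  unfolding component_def using con_sym[of F u w] con_trans[of F] by (intro Collect_cong) metis

lemma con_component: "u \<in> component F x \<Longrightarrow> w \<in> component F x \<Longrightarrow> con F u w"
  unfolding component_def mem_Collect_eq by (rule con_trans[OF con_sym])

lemma joins_con: "joins R u w \<Longrightarrow> R \<subseteq> F \<Longrightarrow> con F u w"
proof (unfold con_def, intro allI impI)
  fix S assume R: "joins R u w" "R \<subseteq> F" and S: "u \<in> S" "w \<notin> S"
  then have "par R S" by (simp add: joins_def)
  then have "R \<inter> cut S \<noteq> {}" by (auto simp: par_def)
  then show "F \<inter> cut S \<noteq> {}" using R(2) by blast
qed

lemma con_inside:
  assumes "con F u w" "F \<inter> cut S = {}" "u \<in> S"
  shows "con (F \<inter> inside S) u w"
  unfolding con_def
proof (intro allI impI)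
  fix T assume T: "u \<in> T" "w \<notin> T"
  then obtain e where "e \<in> F" "e \<in> cut (T \<inter> S)"
    using assms unfolding con_def by (metis disjoint_iff IntD1 IntI)
  then show "F \<inter> inside S \<inter> cut T \<noteq> {}" using assms(2) by (auto simp: cut_def inside_def)
qed

text \<open>The vertices to which \<open>F\<close> contains a join from \<open>u\<close> form a set
  that no edge of \<open>F\<close> leaves, since adding an edge modulo 2 carries a join one step
  further.\<close>

lemma con_joins:
  assumes "con F u w" "finite F"
  obtains R where "R \<subseteq> F" "joins R u w"
proof -
  define S where "S = {w. \<exists>R\<subseteq>F. joins R u w}"
  have "u \<in> S" unfolding S_def using joins_refl_iff by auto
  have "w \<in> S"
  proof (rule ccontr)
    assume "w \<notin> S"
    then obtain e where e: "e \<in> F" "e \<in> cut S" using assms \<open>u \<in> S\<close> unfolding con_def by blast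
    then obtain x y where xy: "x \<in> S" "y \<notin> S" "joins {e} x y"
    proof (cases "t e \<in> S")
      case True
      then show ?thesis using that[of "t e" "h e"] e(2) joins_singleton[of e] by (auto simp: cut_def)
    next
      case False
      then show ?thesis using that[of "h e" "t e"] e(2) joins_sym[OF joins_singleton[of e]]
        by (auto simp: cut_def)
    qed
    then obtain R where "R \<subseteq> F" "joins R u x" unfolding S_def by auto
    then have "joins (sym_diff R {e}) u y"
      using join_sym_diff[of R "{e}" u x y] xy(3) finite_subset[OF _ assms(2)] by simp
    moreover have "sym_diff R {e} \<subseteq> F" using e(1) \<open>R \<subseteq> F\<close> by auto
    ultimately show False using xy(2) unfolding S_def by auto
  qed
  then show thesis unfolding S_def using that by blast
qed

text \<open>With \<open>not_bridge_eulerian\<close> this characterises bridges as the edges that lie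
  in no Eulerian subset.\<close>

lemma eulerian_not_bridge:
  assumes "eulerian Z" "e \<in> Z"
  shows "con (Z - {e}) (t e) (h e)"
  unfolding con_def
proof (intro allI impI)
  fix S assume "t e \<in> S" "h e \<notin> S"
  then have "e \<in> cut S" by (auto simp: cut_def)
  then show "(Z - {e}) \<inter> cut S \<noteq> {}" using eulerian_cut_other[OF assms] by blast
qed

lemma not_bridge_eulerian:
  assumes "con (F - {e}) (t e) (h e)" "e \<in> F" "finite F"
  obtains Z where "Z \<subseteq> F" "eulerian Z" "e \<in> Z"
proof -
  obtain R where R: "R \<subseteq> F - {e}" "joins R (t e) (h e)"
    using con_joins[OF assms(1)] assms(3) by auto
  have "eulerian (insert e R)"
    using eulerian_join_insert[OF _ R(2)] R(1) assms(3) finite_subset[OF R(1)] by auto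
  then show thesis using that[of "insert e R"] R(1) assms(2) by auto
qed

end

section \<open>Integer flows and rounding\<close>

context ends
begin

text \<open>Net flow out of \<open>S\<close>, each edge being directed from tail to head. An
  \<open>f\<close> with all these values zero is a flow; divisibility by 3 describes a flow modulo
  3. Loops cancel.\<close>

definition net :: "'e set \<Rightarrow> ('e \<Rightarrow> int) \<Rightarrow> 'v set \<Rightarrow> int" where
  "net F f S = (\<Sum>e\<in>F. f e * (of_bool (t e \<in> S) - of_bool (h e \<in> S)))"

lemma net_add: "net F (\<lambda>e. f e + g e) S = net F f S + net F g S"
  by (simp add: net_def sum.distrib distrib_right)

lemma net_cmult: "net F (\<lambda>e. c * f e) S = c * net F f S"
  by (simp add: net_def sum_distrib_left mult.assoc)

lemma net_minus: "net F (\<lambda>e. - f e) S = - net F f S"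
  using net_cmult[of F "-1" f S] by simp

lemma net_zero [simp]: "net F (\<lambda>e. 0) S = 0"
  by (simp add: net_def)

lemma net_sum: "net F (\<lambda>e. \<Sum>i\<in>I. f i e) S = (\<Sum>i\<in>I. net F (f i) S)"
  by (induction I rule: infinite_finite_induct) (simp_all add: net_add)

lemma net_cong: "(\<And>e. e \<in> F \<Longrightarrow> f e = g e) \<Longrightarrow> net F f S = net F g S"
  by (simp add: net_def)

lemma net_mono_neutral:
  assumes "finite F" "F' \<subseteq> F" "\<And>e. e \<in> F - F' \<Longrightarrow> f e = 0"
  shows "net F f S = net F' f S"
  unfolding net_def using assms by (intro sum.mono_neutral_right) auto

lemma net_insert:
  "finite F \<Longrightarrow> e \<notin> F \<Longrightarrow>
    net (insert e F) f S = f e * (of_bool (t e \<in> S) - of_bool (h e \<in> S)) + net F f S"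
  by (simp add: net_def)

lemma net_Un:
  "finite A \<Longrightarrow> finite B \<Longrightarrow> A \<inter> B = {} \<Longrightarrow> net (A \<union> B) f S = net A f S + net B f S"
  by (simp add: net_def sum.union_disjoint)

lemma net_Diff: "finite A \<Longrightarrow> B \<subseteq> A \<Longrightarrow> net (A - B) f S = net A f S - net B f S"
  by (simp add: net_def sum_diff)

lemma net_cut: "finite F \<Longrightarrow> net F f S = net (F \<inter> cut S) f S"
  unfolding net_def by (intro sum.mono_neutral_right) (auto simp: cut_def)

lemma net_disjoint_Un: "S \<inter> T = {} \<Longrightarrow> net F f (S \<union> T) = net F f S + net F f T"
  unfolding net_def sum.distrib[symmetric] by (intro sum.cong) auto

lemma net_empty [simp]: "net F f {} = 0"
  by (simp add: net_def)

lemma net_vertices: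
  assumes "finite V" "t ` F \<union> h ` F \<subseteq> V"
  shows "net F f S = (\<Sum>v\<in>S \<inter> V. net F f {v})"
proof -
  have sum_net: "(\<Sum>v\<in>A. net F f {v}) = net F f A" if "finite A" for A
    using that
  proof (induction A rule: finite_induct)
    case (insert v A)
    then show ?case using net_disjoint_Un[of "{v}" A F f] by simp
  qed simp
  have "net F f S = net F f (S \<inter> V)"
    unfolding net_def using assms(2) by (intro sum.cong) auto
  then show ?thesis using sum_net assms by simp
qed

text \<open>Modulo 2 an odd value is 1 and the direction of a crossing edge is irrelevant. This is
  how Eulerian sets are read off from integer flows.\<close>

lemma par_net:
  assumes "finite F" "\<And>e. e \<in> F \<Longrightarrow> odd (f e)"
  shows "par F S \<longleftrightarrow> odd (net F f S)"
  using assms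
proof (induction F rule: finite_induct)
  case empty
  then show ?case by (simp add: net_def)
next
  case (insert e F)
  have "par (insert e F) S \<longleftrightarrow> par {e} S \<noteq> par F S"
    using par_Un[of "{e}" F S] insert.hyps by simp
  moreover have "odd (f e)" using insert.prems by simp
  ultimately show ?case
    using insert by (auto simp: net_insert par_singleton)
qed

text \<open>The argument of \<open>con_joins\<close> over the integers: a signed unit on the next
  edge takes the place of the symmetric difference.\<close>

lemma con_unit_flow:
  assumes "con F u w" "finite F"
  obtains g where "\<And>e. e \<notin> F \<Longrightarrow> g e = 0"
    "\<And>S. net F g S = of_bool (u \<in> S) - of_bool (w \<in> S)"
proof -
  define P where "P = (\<lambda>w g. (\<forall>e. e \<notin> F \<longrightarrow> g e = 0) \<and>
    (\<forall>S. net F g S = of_bool (u \<in> S) - of_bool (w \<in> S)))"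
  define A where "A = {w. \<exists>g. P w g}"
  have "P u (\<lambda>e. 0)" by (simp add: P_def)
  then have uA: "u \<in> A" unfolding A_def by blast
  have "w \<in> A"
  proof (rule ccontr)
    assume "w \<notin> A"
    then obtain e where e: "e \<in> F" "e \<in> cut A" using assms uA unfolding con_def by blast
    define d where "d = (\<lambda>x. if x = e then (if t e \<in> A then 1 else -1) else (0::int))"
    define x where "x = (if t e \<in> A then t e else h e)"
    define y where "y = (if t e \<in> A then h e else t e)"
    have "x \<in> A" "y \<notin> A" using e by (auto simp: x_def y_def cut_def)
    then obtain g where g: "P x g" unfolding A_def by blast
    have "net F d S = of_bool (x \<in> S) - of_bool (y \<in> S)" for S
    proof -
      have "net F d S = net {e} d S"
        using assms(2) e(1) by (intro net_mono_neutral) (auto simp: d_def)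
      then show ?thesis by (simp add: net_def d_def x_def y_def)
    qed
    then have "P y (\<lambda>e. g e + d e)"
      using g e(1) by (auto simp: P_def net_add d_def)
    then show False using \<open>y \<notin> A\<close> unfolding A_def by blast
  qed
  then show thesis using that unfolding A_def P_def by blast
qed

text \<open>An augmenting path from \<open>v\<close> for a subset \<open>H\<close> of
  \<open>F\<close>: edges outside \<open>H\<close> are used forwards, edges of \<open>H\<close>
  backwards. \<open>K\<close> is the set of edges to be flipped and \<open>X\<close> the set of
  vertices visited, so no vertex is repeated.\<close>

inductive augment :: "'e set \<Rightarrow> 'e set \<Rightarrow> 'v \<Rightarrow> 'v \<Rightarrow> 'e set \<Rightarrow> 'v set \<Rightarrow> bool"
  for F H :: "'e set" and v :: 'v where
  start: "augment F H v v {} {v}"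
| forward: "augment F H v a K X \<Longrightarrow> e \<in> F - H \<Longrightarrow> t e = a \<Longrightarrow> h e \<notin> X \<Longrightarrow>
    augment F H v (h e) (insert e K) (insert (h e) X)"
| backward: "augment F H v a K X \<Longrightarrow> e \<in> H \<Longrightarrow> h e = a \<Longrightarrow> t e \<notin> X \<Longrightarrow>
    augment F H v (t e) (insert e K) (insert (t e) X)"

text \<open>An initial piece of an augmenting path is again an augmenting path.\<close>

lemma augment_reach: "augment F H v a K X \<Longrightarrow> x \<in> X \<Longrightarrow> \<exists>K X. augment F H v x K X"
  by (induction rule: augment.induct) (blast intro: augment.intros)+

text \<open>\<open>K\<close> being inside \<open>X\<close> is part of the induction because it shows
  that the edge to a new vertex is not yet in \<open>K\<close>.\<close>

lemma augment_net:
  assumes "augment F H v a K X" "finite F" "H \<subseteq> F"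
  shows "K \<subseteq> F \<and> K \<subseteq> inside X \<and> a \<in> X \<and>
    (\<forall>S. net (sym_diff H K) (\<lambda>e. 1) S = net H (\<lambda>e. 1) S + of_bool (v \<in> S) - of_bool (a \<in> S))"
  using assms(1)
proof (induction rule: augment.induct)
  case start
  then show ?case by (simp add: inside_def)
next
  case (forward a K X e)
  have fin: "finite (sym_diff H K)" using forward finite_subset[OF _ assms(2)] assms(3) by auto
  have eK: "e \<notin> K" using forward by (auto simp: inside_def)
  have "sym_diff H (insert e K) = insert e (sym_diff H K)" using forward eK by auto
  then have "net (sym_diff H (insert e K)) (\<lambda>e. 1) S
    = net (sym_diff H K) (\<lambda>e. 1) S + of_bool (a \<in> S) - of_bool (h e \<in> S)" for S
    using net_insert[OF fin, of e "\<lambda>e. 1" S] forward eK by simp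
  then show ?case using forward by (auto simp: inside_def)
next
  case (backward a K X e)
  have fin: "finite (sym_diff H K)" using backward finite_subset[OF _ assms(2)] assms(3) by auto
  have eK: "e \<notin> K" using backward by (auto simp: inside_def)
  have eq: "sym_diff H K = insert e (sym_diff H (insert e K))" using backward eK by auto
  moreover have "e \<notin> sym_diff H (insert e K)" using backward by auto
  moreover have "finite (sym_diff H (insert e K))" using fin eq by (metis finite_insert)
  ultimately have "net (sym_diff H K) (\<lambda>e. 1) S = of_bool (t e \<in> S) - of_bool (a \<in> S)
    + net (sym_diff H (insert e K)) (\<lambda>e. 1) S" for S
    using net_insert[of "sym_diff H (insert e K)" e "\<lambda>e. 1" S] backward by simp
  then show ?case using backward assms(3) by (auto simp: inside_def)
qed

text \<open>Integrality of flows: the constant 1/k on \<open>F\<close> is rounded to a 0/1 function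
  with the same net flows. Take \<open>H\<close> with least total deviation and suppose that some
  \<open>v\<close> has too little outflow. No vertex reached from \<open>v\<close> by an augmenting
  path has too much, or flipping the path would improve \<open>H\<close>. No edge of
  \<open>F - H\<close> leaves the set \<open>A\<close> of these vertices and no edge of
  \<open>H\<close> enters it. Hence \<open>k\<close> times the outflow of \<open>H\<close> from
  \<open>A\<close> is less than that outflow itself, which is nonnegative; this is
  impossible.\<close>

lemma rounding:
  assumes F: "finite F" and k: "0 < k" and dvd: "\<And>v. k dvd net F (\<lambda>e. 1) {v}"
  obtains H where "H \<subseteq> F" "\<And>S. k * net H (\<lambda>e. 1) S = net F (\<lambda>e. 1) S"
proof -
  define V where "V = t ` F \<union> h ` F"
  define n where "n = (\<lambda>H v. net H (\<lambda>e. 1) {v})"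
  define \<Phi> where "\<Phi> = (\<lambda>H. \<Sum>v\<in>V. \<bar>k * n H v - n F v\<bar>)"
  have V: "finite V" using F by (simp add: V_def)
  have vert: "net H (\<lambda>e. 1) S = (\<Sum>v\<in>S \<inter> V. n H v)" if "H \<subseteq> F" for H S
  proof -
    have "t ` H \<union> h ` H \<subseteq> V" using that by (auto simp: V_def)
    then show ?thesis unfolding n_def by (rule net_vertices[OF V])
  qed
  have "\<exists>H. is_arg_min \<Phi> (\<lambda>H. H \<in> Pow F) H"
    by (rule ex_is_arg_min_if_finite) (use F in auto)
  then obtain H where H: "H \<subseteq> F" and min: "\<And>H'. H' \<subseteq> F \<Longrightarrow> \<Phi> H \<le> \<Phi> H'"
    by (auto simp: is_arg_min_linorder)
  have "k * n H v = n F v" if "v \<in> V" for v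
  proof (rule ccontr)
    assume neq: "k * n H v \<noteq> n F v"
    have "net H (\<lambda>e. 1) V = 0" "net F (\<lambda>e. 1) V = 0"
      using H by (auto simp: net_def V_def intro!: sum.neutral)
    then have sum0: "(\<Sum>v\<in>V. n F v - k * n H v) = 0"
      using vert[OF H, of V] vert[of F V] by (simp add: sum_subtractf sum_distrib_left[symmetric])
    have "\<exists>v\<in>V. k * n H v < n F v"
    proof (rule ccontr)
      assume "\<not> ?thesis"
      then have "\<forall>v\<in>V. k * n H v - n F v = 0"
        using sum0 sum_nonneg_eq_0_iff[OF V, of "\<lambda>v. k * n H v - n F v"]
        by (simp add: sum_subtractf not_less)
      then show False using neq that by simp
    qed
    then obtain v where v: "v \<in> V" "k * n H v < n F v" by blast
    \<comment> \<open>Deviations are multiples of \<open>k\<close>, and a flip changes them by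
      exactly \<open>k\<close> at the two ends of the path, so it never overshoots.\<close>
    have vk: "k \<le> n F v - k * n H v"
      using v(2) dvd[of v] by (intro zdvd_imp_le) (auto simp: n_def)
    define A where "A = {a. \<exists>K X. augment F H v a K X}"
    have "v \<in> A" using augment.start unfolding A_def by blast
    have le: "k * n H a \<le> n F a" if "a \<in> A" for a
    proof (rule ccontr)
      assume gt: "\<not> k * n H a \<le> n F a"
      obtain K X where K: "augment F H v a K X" using \<open>a \<in> A\<close> unfolding A_def by blast
      define H' where "H' = sym_diff H K"
      have H': "H' \<subseteq> F" using augment_net[OF K F H] H by (auto simp: H'_def)
      have nH': "n H' x = n H x + of_bool (x = v) - of_bool (x = a)" for x
        using augment_net[OF K F H] by (simp add: n_def H'_def eq_commute)
      have ak: "k \<le> k * n H a - n F a"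
        using gt dvd[of a] by (intro zdvd_imp_le) (auto simp: n_def)
      have "a \<noteq> v" using gt v by auto
      have *: "\<bar>k * n H' x - n F x\<bar> \<le> \<bar>k * n H x - n F x\<bar>" for x
        using vk ak k \<open>a \<noteq> v\<close> by (auto simp: nH' distrib_left right_diff_distrib)
      have "\<bar>k * n H' v - n F v\<bar> < \<bar>k * n H v - n F v\<bar>"
        using vk k \<open>a \<noteq> v\<close> by (auto simp: nH' distrib_left right_diff_distrib)
      then have "\<Phi> H' < \<Phi> H"
        unfolding \<Phi>_def using V v(1) * by (intro sum_strict_mono_ex1) auto
      then show False using min[OF H'] by simp
    qed
    have "k * net H (\<lambda>e. 1) A = (\<Sum>a\<in>A \<inter> V. k * n H a)"
      using vert[OF H] by (simp add: sum_distrib_left)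
    also have "\<dots> < (\<Sum>a\<in>A \<inter> V. n F a)"
      using le v \<open>v \<in> A\<close> V by (intro sum_strict_mono_ex1) auto
    also have "\<dots> = net F (\<lambda>e. 1) A" using vert by simp
    also have "\<dots> = net H (\<lambda>e. 1) A + net (F - H) (\<lambda>e. 1) A"
      using net_Diff[OF F H] by simp
    also have "net (F - H) (\<lambda>e. 1) A \<le> 0"
    proof -
      have "h e \<in> A" if "e \<in> F - H" "t e \<in> A" for e
      proof -
        from that(2) obtain K X where "augment F H v (t e) K X" unfolding A_def by blast
        then show ?thesis
          using augment_reach[of F H v "t e" K X "h e"] augment.forward[OF _ that(1)]
          unfolding A_def by (cases "h e \<in> X") blast+
      qed
      then show ?thesis unfolding net_def by (intro sum_nonpos) auto
    qed
    finally have "k * net H (\<lambda>e. 1) A < net H (\<lambda>e. 1) A" by simp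
    moreover have "0 \<le> net H (\<lambda>e. 1) A"
    proof -
      have "t e \<in> A" if "e \<in> H" "h e \<in> A" for e
      proof -
        from that(2) obtain K X where "augment F H v (h e) K X" unfolding A_def by blast
        then show ?thesis
          using augment_reach[of F H v "h e" K X "t e"] augment.backward[OF _ that(1)]
          unfolding A_def by (cases "t e \<in> X") blast+
      qed
      then show ?thesis unfolding net_def by (intro sum_nonneg) auto
    qed
    ultimately show False using k
      by (metis int_one_le_iff_zero_less mult_le_cancel_right1 not_less)
  qed
  then have "k * net H (\<lambda>e. 1) S = net F (\<lambda>e. 1) S" for S
    using vert[OF H, of S] vert[of F S] by (simp add: sum_distrib_left)
  then show thesis using that H by blast
qed

text \<open>With the value 1 on every edge all net flows are even. A set \<open>H\<close> that
  carries half of each exists by \<open>rounding\<close>, and reversing it makes everything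
  cancel.\<close>

lemma eulerian_orientation:
  assumes "finite C" "eulerian C"
  obtains g where "\<And>e. e \<in> C \<Longrightarrow> g e \<in> {1, -1}" "\<And>e. e \<notin> C \<Longrightarrow> g e = 0"
    "\<And>S. net C g S = 0"
proof -
  have "2 dvd net C (\<lambda>e. 1) {v}" for v
    using par_net[OF assms(1), of "\<lambda>e. 1" "{v}"] assms(2) by (simp add: eulerian_def)
  then obtain H where H: "H \<subseteq> C" "\<And>S. 2 * net H (\<lambda>e. 1) S = net C (\<lambda>e. 1) S"
    using rounding[OF assms(1), of 2] by auto
  define g :: "'e \<Rightarrow> int" where "g = (\<lambda>e. if e \<in> H then -1 else if e \<in> C then 1 else 0)"
  have "net C g S = 0" for S
  proof -
    have "net C g S = net (C - H) g S + net H g S"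
      using net_Diff[OF assms(1) H(1), of g S] by simp
    also have "net (C - H) g S = net (C - H) (\<lambda>e. 1) S"
      by (intro net_cong) (auto simp: g_def)
    also have "net H g S = net H (\<lambda>e. - 1) S"
      by (intro net_cong) (auto simp: g_def)
    finally show ?thesis
      using net_Diff[OF assms(1) H(1), of "\<lambda>e. 1" S] H(2)[of S] net_minus[of H "\<lambda>e. 1" S] by simp
  qed
  then show thesis using H(1) by (intro that[of g]) (auto simp: g_def)
qed

end

text \<open>With all values made congruent to 1, \<open>rounding\<close> by 3 and then by 2
  partitions \<open>D\<close> into \<open>W\<close>, \<open>H\<close> and \<open>Q - H\<close> with
  equal net flows. The union of any two has even net flows and so is Eulerian; two of these unions
  cover \<open>D\<close>.\<close>

lemma (in ends) mod_three_flow_cover: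
  assumes D: "finite D" and flow: "\<And>S. 3 dvd net D f S" and nz: "\<And>e. e \<in> D \<Longrightarrow> \<not> 3 dvd f e"
  obtains X Y where "eulerian X" "eulerian Y" "X \<union> Y = D"
proof -
  define sg :: "'e \<Rightarrow> int" where "sg = (\<lambda>e. if f e mod 3 = 1 then 1 else -1)"
  \<comment> \<open>Reversing the edges with \<open>sg e = -1\<close> turns \<open>sg\<close> into
    the constant 1 that \<open>rounding\<close> requires.\<close>
  define t' where "t' = (\<lambda>e. if f e mod 3 = 1 then t e else h e)"
  define h' where "h' = (\<lambda>e. if f e mod 3 = 1 then h e else t e)"
  interpret s: ends t' h' .
  have net_s: "s.net F (\<lambda>e. 1) S = net F sg S" for F S
    unfolding s.net_def net_def by (intro sum.cong) (auto simp: sg_def t'_def h'_def)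
  have "3 dvd net D sg S" for S
  proof -
    have "3 dvd f e - sg e" if "e \<in> D" for e
      using nz[OF that] unfolding sg_def by presburger
    then have "3 dvd net D (\<lambda>e. f e - sg e) S"
      unfolding net_def by (intro dvd_sum) auto
    moreover have "net D f S = net D (\<lambda>e. f e - sg e) S + net D sg S"
      using net_add[of D "\<lambda>e. f e - sg e" sg S] by simp
    ultimately show ?thesis using flow[of S] by (metis dvd_add_right_iff)
  qed
  then obtain W where W: "W \<subseteq> D" "\<And>S. 3 * net W sg S = net D sg S"
    using s.rounding[OF D, of 3] by (auto simp: net_s)
  define Q where "Q = D - W"
  have Q: "finite Q" "net Q sg S = 2 * net W sg S" for S
    using D W(2)[of S] net_Diff[OF D W(1)] by (auto simp: Q_def)
  then obtain H where H: "H \<subseteq> Q" "\<And>S. 2 * net H sg S = net Q sg S"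
    using s.rounding[OF Q(1), of 2] by (auto simp: net_s)
  have oddsg: "odd (sg e)" for e by (simp add: sg_def)
  have fin: "finite W" "finite H" using D W(1) Q(1) H(1) finite_subset by auto
  have "eulerian Q"
    using par_net[of Q sg] oddsg Q by (simp add: eulerian_def)
  moreover have "eulerian (W \<union> H)"
  proof -
    have "net (W \<union> H) sg S = 2 * net W sg S" for S
    proof -
      have "W \<inter> H = {}" using H(1) by (auto simp: Q_def)
      then show ?thesis using net_Un[OF fin, of sg S] H(2)[of S] Q(2)[of S] by simp
    qed
    then show ?thesis using par_net[of "W \<union> H" sg] oddsg fin by (simp add: eulerian_def)
  qed
  moreover have "Q \<union> (W \<union> H) = D" using W(1) H(1) by (auto simp: Q_def)
  ultimately show thesis using that by blast
qed

section \<open>Seymour's closure argument and the 6-flow theorem\<close>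

context ends
begin

text \<open>
  A Menger-type statement: two vertices of a 2-edge-connected graph lie in a common connected
  component of some Eulerian subgraph. An Eulerian \<open>Z\<close> reaching \<open>w\<close> is extended along an edge \<open>e\<close>
  from \<open>w\<close> to a new vertex by an ear that starts with \<open>e\<close> and returns to \<open>Z\<close> in \<open>z\<close>; the ear
  replaces one of two disjoint \<open>w\<close>-\<open>z\<close> connections of \<open>Z\<close>.
\<close>

lemma eulerian_connecting:
  assumes F: "finite F" "F \<subseteq> inside S" and y: "y1 \<in> S" "y2 \<in> S"
    and cuts: "\<And>A. A \<subset> S \<Longrightarrow> A \<noteq> {} \<Longrightarrow> 2 \<le> card (F \<inter> cut A)"
  obtains Z where "Z \<subseteq> F" "eulerian Z" "con Z y1 y2"
proof -
  define W where "W = {w. \<exists>Z\<subseteq>F. eulerian Z \<and> con Z y1 w}"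
  have cutS: "F \<inter> cut (T \<inter> S) = F \<inter> cut T" for T
    using F(2) by (auto simp: cut_def inside_def)
  have "y1 \<in> W" unfolding W_def using eulerian_empty con_refl by blast
  have "y2 \<in> W"
  proof (rule ccontr)
    assume "y2 \<notin> W"
    then have "2 \<le> card (F \<inter> cut (W \<inter> S))" using y \<open>y1 \<in> W\<close> by (intro cuts) auto
    then have "F \<inter> cut W \<noteq> {}" unfolding cutS by (metis card.empty not_numeral_le_zero)
    then obtain e where e: "e \<in> F" "e \<in> cut W" by blast
    define w where "w = (if t e \<in> W then t e else h e)"
    define u where "u = (if t e \<in> W then h e else t e)"
    have wu: "w \<in> W" "u \<notin> W" "w \<in> S" "u \<in> S" and je: "joins {e} w u" "con {e} w u"
      using e F(2) joins_singleton[of e] joins_sym con_edge[of e "{e}"] con_sym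
      by (auto simp: w_def u_def cut_def inside_def)
    have nobridge: "con (F - {e}) u w"
      unfolding con_def
    proof (intro allI impI)
      fix T assume "u \<in> T" "w \<notin> T"
      then have "2 \<le> card (F \<inter> cut (T \<inter> S))" using wu by (intro cuts) auto
      then have "2 \<le> card (F \<inter> cut T)" by (simp add: cutS)
      then have "\<not> F \<inter> cut T \<subseteq> {e}" using card_mono[of "{e}" "F \<inter> cut T"] by auto
      then show "(F - {e}) \<inter> cut T \<noteq> {}" by blast
    qed
    obtain Z where Z: "Z \<subseteq> F" "eulerian Z" "con Z y1 w" using wu(1) unfolding W_def by blast
    define K where "K = component Z w"
    define ZK where "ZK = Z \<inter> inside K"
    have ZcutK: "Z \<inter> cut K = {}" by (simp add: K_def)
    have y1K: "y1 \<in> K" and wK: "w \<in> K" using Z(3) con_sym by (auto simp: K_def component_def)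
    have KW: "K \<subseteq> W" using Z con_trans unfolding K_def component_def W_def by blast
    have ZK: "ZK \<subseteq> F" "finite ZK" "eulerian ZK"
      using Z eulerian_inside[OF Z(2) ZcutK] F(1) finite_subset by (auto simp: ZK_def)
    have conZK: "con ZK x x'" if "x \<in> K" "x' \<in> K" for x x'
    proof -
      have "con Z x x'" using that con_sym con_trans unfolding K_def component_def by blast
      then show ?thesis unfolding ZK_def using con_inside[OF _ ZcutK that(1)] by blast
    qed
    have "u \<notin> K" using wu KW by blast
    define A where "A = {v. \<exists>R\<subseteq>F - {e}. R \<inter> ZK = {} \<and> joins R u v}"
    have "u \<in> A" unfolding A_def using joins_refl_iff by fastforce
    have "A \<inter> K \<noteq> {}"
    proof
      assume AK: "A \<inter> K = {}"
      then obtain e' where e': "e' \<in> F - {e}" "e' \<in> cut A"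
        using nobridge \<open>u \<in> A\<close> wK unfolding con_def by blast
      define x where "x = (if t e' \<in> A then t e' else h e')"
      define x' where "x' = (if t e' \<in> A then h e' else t e')"
      have x: "x \<in> A" "x' \<notin> A" "joins {e'} x x'" "e' \<notin> ZK"
        using e' joins_singleton[of e'] joins_sym AK
        by (auto simp: x_def x'_def cut_def ZK_def inside_def)
      then obtain R where R: "R \<subseteq> F - {e}" "R \<inter> ZK = {}" "joins R u x" unfolding A_def by blast
      have "joins (sym_diff R {e'}) u x'"
        using join_sym_diff[OF _ _ R(3) x(3)] R(1) F(1) finite_subset by blast
      moreover have "sym_diff R {e'} \<subseteq> F - {e}" "sym_diff R {e'} \<inter> ZK = {}" using R e' x by auto
      ultimately show False using x(2) unfolding A_def by blast
    qed
    then obtain z R where z: "z \<in> K" and R: "R \<subseteq> F - {e}" "R \<inter> ZK = {}" "joins R u z"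
      unfolding A_def by blast
    define R' where "R' = insert e R"
    have finR: "finite R" using R(1) F(1) finite_subset by auto
    have "R' = sym_diff {e} R" using R(1) by (auto simp: R'_def)
    then have R': "joins R' w z" "finite R'" "R' \<subseteq> F" "R' \<inter> ZK = {}"
      using join_sym_diff[OF _ finR je(1) R(3)] R e(1) \<open>u \<notin> K\<close> finR
      by (auto simp: R'_def ZK_def inside_def u_def split: if_splits)
    have eR': "e \<in> R'" by (simp add: R'_def)
    obtain P0 where P0: "P0 \<subseteq> ZK \<and> joins P0 w z"
      using con_joins[OF conZK[OF wK z] ZK(2)] by blast
    \<comment> \<open>Leastness means that nothing can be split off from \<open>P\<close>; this
      excludes the separating set \<open>T\<close> below.\<close>
    obtain P where P: "P \<subseteq> ZK" "joins P w z"
      and Pmin: "\<And>P'. P' \<subseteq> ZK \<Longrightarrow> joins P' w z \<Longrightarrow> card P \<le> card P'"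
      using ex_has_least_nat[of "\<lambda>P. P \<subseteq> ZK \<and> joins P w z" P0 card] P0 by metis
    have extend: "eulerian ((ZK - Q) \<union> R')" "(ZK - Q) \<union> R' \<subseteq> F" if "Q \<subseteq> ZK" "joins Q w z" for Q
    proof -
      show "eulerian ((ZK - Q) \<union> R')"
        unfolding eulerian_def
      proof
        fix T
        have "par ((ZK - Q) \<union> R') T \<longleftrightarrow> par (ZK - Q) T \<noteq> par R' T"
          using ZK(2) R' by (intro par_Un) auto
        also have "par (ZK - Q) T \<longleftrightarrow> par ZK T \<noteq> par Q T"
          using ZK(2) that(1) by (rule par_Diff)
        finally show "\<not> par ((ZK - Q) \<union> R') T"
          using that(2) R'(1) ZK(3) by (simp add: joins_def eulerian_def)
      qed
    qed (use ZK R' in auto)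
    have False if "Q \<subseteq> ZK" "joins Q w z" "con ((ZK - Q) \<union> R') y1 u" for Q
      using extend[OF that(1,2)] that(3) wu(2) unfolding W_def by blast
    moreover have "\<exists>Q. Q \<subseteq> ZK \<and> joins Q w z \<and> con ((ZK - Q) \<union> R') y1 u"
    proof (cases "con (ZK - P) y1 w")
      case True
      then have "con ((ZK - P) \<union> R') y1 u"
        using con_trans[OF con_mono[OF True] con_mono[OF je(2)]] eR' by auto
      then show ?thesis using P by blast
    next
      case False
      \<comment> \<open>Removing \<open>P\<close> would cut \<open>y1\<close> off from
        \<open>w\<close>. Instead the part of \<open>ZK - P\<close> around \<open>w\<close> and
        \<open>z\<close> is removed, which is another join, and \<open>P\<close> stays.\<close>
      define L where "L = component (ZK - P) w"
      define Q where "Q = (ZK - P) \<inter> inside L"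
      have joinsD: "joins (ZK - P) w z"
        using P ZK(2,3) by (simp add: joins_def par_Diff eulerian_def)
      then have wzL: "w \<in> L" "z \<in> L" "y1 \<notin> L"
        using joins_con[OF joinsD] False con_sym by (auto simp: L_def component_def)
      have cutL: "(ZK - P) \<inter> cut L = {}" by (simp add: L_def)
      have Q: "Q \<subseteq> ZK" "joins Q w z"
        using joinsD wzL by (auto simp: Q_def joins_def par_inside[OF cutL])
      have "con ((ZK - Q) \<union> R') y1 u"
        unfolding con_def
      proof (intro allI impI notI)
        fix T assume T: "y1 \<in> T" "u \<notin> T" and empty: "((ZK - Q) \<union> R') \<inter> cut T = {}"
        have RT: "R' \<inter> cut T = {}" "(ZK - Q) \<inter> cut T = {}" using empty by auto
        have "con R' w u" using con_mono[OF je(2)] eR' by simp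
        then have "w \<notin> T" using RT T unfolding con_def by blast
        moreover have "z \<notin> T"
          using joins_con[OF R'(1) subset_refl] con_sym RT(1) \<open>w \<notin> T\<close> unfolding con_def by blast
        ultimately have wz: "w \<notin> T" "z \<notin> T" .
        have "con ZK y1 w" using conZK y1K wK by blast
        then obtain e' where e': "e' \<in> ZK" "e' \<in> cut (T - L)"
          using T wzL wz unfolding con_def by blast
        have PT: "P \<inter> cut T = {}" using P(1) RT(2) by (auto simp: Q_def)
        have "e' \<notin> Q" using e'(2) by (auto simp: Q_def cut_def inside_def)
        then have "e' \<notin> cut T" using e'(1) RT(2) by blast
        then have eT: "e' \<in> inside T" "e' \<in> cut L" using e'(2) by (auto simp: cut_def inside_def)
        then have "e' \<in> P" using cutL e'(1) by blast
        define P' where "P' = P - inside T"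
        have "joins P' w z"
          unfolding joins_def
        proof
          fix X
          have "P' = P - (P \<inter> inside T)" by (auto simp: P'_def)
          then have "par P' X \<longleftrightarrow> par P X \<noteq> par (P \<inter> inside T) X"
            using par_Diff[of P "P \<inter> inside T" X] P(1) ZK(2) finite_subset by auto
          also have "par (P \<inter> inside T) X \<longleftrightarrow> par P (X \<inter> T)" by (rule par_inside[OF PT])
          finally show "par P' X \<longleftrightarrow> (w \<in> X) \<noteq> (z \<in> X)" using P(2) wz by (simp add: joins_def)
        qed
        moreover have "card P' < card P"
          using \<open>e' \<in> P\<close> eT(1) P(1) ZK(2) finite_subset
          by (intro psubset_card_mono) (auto simp: P'_def)
        ultimately show False using Pmin[of P'] P(1) by (auto simp: P'_def)
      qed
      then show ?thesis using Q by blast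
    qed
    ultimately show False by blast
  qed
  then show thesis using that unfolding W_def by blast
qed

text \<open>
  The inductive notion behind Seymour's closure argument. Avoiding arbitrary values \<open>q e\<close> instead of
  zero makes it stable under adding a correction by the flows through the edges added later.
\<close>

definition avoidable :: "'e set \<Rightarrow> 'v set \<Rightarrow> 'e set \<Rightarrow> bool" where
  "avoidable P X C \<longleftrightarrow> C \<subseteq> P \<inter> inside X \<and> eulerian C \<and>
     (\<forall>u\<in>X. \<forall>w\<in>X. con (P \<inter> inside X) u w) \<and>
     (\<forall>q. \<exists>f. (\<forall>e. e \<notin> P \<inter> inside X \<longrightarrow> f e = 0) \<and> (\<forall>S. 3 dvd net P f S) \<and>
       (\<forall>e\<in>P \<inter> inside X - C. \<not> 3 dvd f e - q e))"

text \<open>Only loops lie inside \<open>{v}\<close>, and they may carry any value.\<close>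

lemma avoidable_singleton: "avoidable P {v} {}"
  unfolding avoidable_def
proof (intro conjI allI)
  fix q :: "'e \<Rightarrow> int"
  let ?f = "\<lambda>e. if e \<in> P \<inter> inside {v} then q e + 1 else 0"
  have "net P ?f S = 0" for S
    unfolding net_def by (intro sum.neutral) (auto simp: inside_def)
  then show "\<exists>f. (\<forall>e. e \<notin> P \<inter> inside {v} \<longrightarrow> f e = 0) \<and> (\<forall>S. 3 dvd net P f S) \<and>
      (\<forall>e\<in>P \<inter> inside {v} - {}. \<not> 3 dvd f e - q e)"
    by (intro exI[of _ ?f]) auto
qed auto

text \<open>A unit is sent through \<open>e\<close> and returned from \<open>h e\<close> to
  \<open>t e\<close> within \<open>B\<close>.\<close>

lemma fundamental_flow:
  assumes "finite P" "insert e B \<subseteq> P" "e \<notin> B" "con B (h e) (t e)"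
  obtains g where "g e = 1" "\<And>e'. e' \<notin> insert e B \<Longrightarrow> g e' = 0" "\<And>S. net P g S = 0"
proof -
  have B: "finite B" using finite_subset[OF assms(2,1)] by simp
  obtain g0 where g0: "\<And>e'. e' \<notin> B \<Longrightarrow> g0 e' = 0"
    "\<And>S. net B g0 S = of_bool (h e \<in> S) - of_bool (t e \<in> S)"
    by (rule con_unit_flow[OF assms(4) B]) (rule that)
  let ?g = "\<lambda>e'. if e' = e then 1 else g0 e'"
  have "net P ?g S = 0" for S
  proof -
    have "net P ?g S = net (insert e B) ?g S"
      using assms(1,2) g0(1) by (intro net_mono_neutral) auto
    also have "\<dots> = of_bool (t e \<in> S) - of_bool (h e \<in> S) + net B ?g S"
      using B assms(3) by (simp add: net_insert)
    also have "net B ?g S = net B g0 S" using assms(3) by (intro net_cong) auto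
    finally show ?thesis using g0(2) by simp
  qed
  then show thesis using g0(1) by (intro that[of ?g]) auto
qed

text \<open>Each condition forbids one residue of \<open>a\<close> modulo 3, so at least one of the
  three is left.\<close>

lemma avoid_two_residues:
  assumes "r = 1 \<or> r = (-1 :: int)"
  shows "\<exists>a. \<not> 3 dvd a - u \<and> \<not> 3 dvd v + a * r"
  using assms by (elim disjE; simp; presburger)

text \<open>\<open>B\<close> connects \<open>X\<close> and \<open>Y\<close> by the edges inside
  \<open>X\<close>, those of \<open>CY\<close>, and \<open>x1\<close>. Each further edge can be
  given any value by its fundamental flow through \<open>B\<close>, which disturbs only
  \<open>B\<close>. The edges of \<open>CY\<close> join the Eulerian set, where nothing must be
  avoided; the edges inside \<open>X\<close> are repaired by the hypothesis on \<open>X\<close>. For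
  \<open>x1\<close> the flow through the second edge \<open>x2\<close> is used: its multiple has
  three residues, and \<open>x1\<close> and \<open>x2\<close> forbid one each.\<close>

lemma avoidable_grow:
  assumes P: "finite P" and X: "avoidable P X C"
    and CY: "CY \<subseteq> P \<inter> inside Y" "eulerian CY" "\<And>u w. u \<in> Y \<Longrightarrow> w \<in> Y \<Longrightarrow> con CY u w"
    and XY: "X \<inter> Y = {}"
    and x: "x1 \<in> P" "x2 \<in> P" "x1 \<noteq> x2"
      "x1 \<in> inside (X \<union> Y) \<inter> cut X" "x2 \<in> inside (X \<union> Y) \<inter> cut X"
  shows "avoidable P (X \<union> Y) (C \<union> CY)"
proof -
  define I where "I = P \<inter> inside X"
  define A where "A = P \<inter> inside (X \<union> Y)"
  define B where "B = insert x1 (I \<union> CY)"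
  have C: "C \<subseteq> I" "eulerian C" and conI: "\<And>u w. u \<in> X \<Longrightarrow> w \<in> X \<Longrightarrow> con I u w"
    using X by (auto simp: avoidable_def I_def)
  define avoids where "avoids = (\<lambda>q f. (\<forall>e. e \<notin> I \<longrightarrow> f e = 0) \<and> (\<forall>S. 3 dvd net P f S) \<and>
      (\<forall>e\<in>I - C. \<not> 3 dvd f e - q e))"
  have avoid: "\<forall>q. \<exists>f. avoids q f"
    using X unfolding avoidable_def avoids_def I_def by (elim conjE)
  have fin: "finite C" "finite CY" "finite B" "finite A"
    using P C(1) CY(1) finite_subset by (auto simp: B_def I_def A_def)
  have disj: "I \<inter> CY = {}" using CY(1) XY by (auto simp: I_def inside_def)
  have BA: "B \<subseteq> A" using CY(1) x by (auto simp: B_def A_def I_def inside_def)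
  have x1B: "x1 \<notin> I \<union> CY" using x(4) CY(1) XY by (auto simp: I_def inside_def cut_def)
  have x2B: "x2 \<notin> B" using x(3,5) CY(1) XY by (auto simp: B_def I_def inside_def cut_def)
  have conB: "con B u w" if "u \<in> X \<union> Y" "w \<in> X \<union> Y" for u w
  proof -
    define a where "a = (if t x1 \<in> X then t x1 else h x1)"
    have aX: "a \<in> X" using x(4) by (auto simp: a_def cut_def)
    have x1: "con B (t x1) (h x1)" using con_edge by (simp add: B_def)
    have "con B a w" if "w \<in> X \<union> Y" for w
    proof (cases "w \<in> X")
      case True
      then show ?thesis using con_mono[OF conI[OF aX True], of B] by (auto simp: B_def)
    next
      case False
      define b where "b = (if t x1 \<in> X then h x1 else t x1)"
      have "b \<in> Y" using x(4) by (auto simp: b_def cut_def inside_def)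
      then have "con B b w" using con_mono[OF CY(3), of b w B] False that by (auto simp: B_def)
      moreover have "con B a b" using x1 con_sym[OF x1] by (auto simp: a_def b_def)
      ultimately show ?thesis using con_trans[of B a b w] by simp
    qed
    then show ?thesis using con_trans[OF con_sym] that by metis
  qed
  have "\<exists>g. g e = 1 \<and> (\<forall>e'. e' \<notin> insert e B \<longrightarrow> g e' = 0) \<and> (\<forall>S. net P g S = 0)"
    if "e \<in> A - B" for e
  proof -
    have "insert e B \<subseteq> P" using that BA by (auto simp: A_def)
    moreover have "con B (h e) (t e)" using that by (intro conB) (auto simp: A_def inside_def)
    ultimately show ?thesis using fundamental_flow[OF P, of e B] that by (metis DiffD2)
  qed
  then obtain Q where Q: "\<And>e. e \<in> A - B \<Longrightarrow> Q e e = 1"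
    "\<And>e e'. e \<in> A - B \<Longrightarrow> e' \<notin> insert e B \<Longrightarrow> Q e e' = 0"
    "\<And>e S. e \<in> A - B \<Longrightarrow> net P (Q e) S = 0"
    by metis
  have x2A: "x2 \<in> A - B" using x x2B by (auto simp: A_def)
  \<comment> \<open>As \<open>x1\<close> is the only edge of \<open>B\<close> that crosses
    \<open>X\<close>, the unit through \<open>x2\<close> has to return through it.\<close>
  have "Q x2 x1 = 1 \<or> Q x2 x1 = -1"
  proof -
    have "B \<inter> cut X = {x1}"
      using x(4) CY(1) XY by (auto simp: B_def I_def inside_def cut_def)
    then have "net P (Q x2) X = net {x1, x2} (Q x2) X"
      unfolding net_cut[OF P, of "Q x2" X] using P x Q(2)[OF x2A]
      by (intro net_mono_neutral) auto
    then have "net {x1, x2} (Q x2) X = 0" using Q(3)[OF x2A] by simp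
    then show ?thesis using x(3,4,5) Q(1)[OF x2A] by (auto simp: net_def cut_def)
  qed
  note r = this
  show ?thesis
    unfolding avoidable_def
  proof (intro conjI allI ballI)
    show "C \<union> CY \<subseteq> P \<inter> inside (X \<union> Y)" using C(1) CY(1) by (auto simp: I_def inside_def)
    show "eulerian (C \<union> CY)" using eulerian_Un fin C CY(2) disj by blast
    show "con (P \<inter> inside (X \<union> Y)) u w" if "u \<in> X \<union> Y" "w \<in> X \<union> Y" for u w
      using con_mono[OF conB[OF that] BA] by (simp add: A_def)
  next
    fix q :: "'e \<Rightarrow> int"
    \<comment> \<open>The value \<open>q e + 1\<close> is merely one that differs from
      \<open>q e\<close> modulo 3.\<close>
    define f1 where "f1 = (\<lambda>e. \<Sum>e'\<in>A - B - {x2}. (q e' + 1) * Q e' e)"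
    have f1_out: "f1 e = 0" if "e \<notin> A" for e
    proof -
      have "Q e' e = 0" if "e' \<in> A - B" for e'
        using Q(2)[OF that, of e] that BA \<open>e \<notin> A\<close> by auto
      then show ?thesis unfolding f1_def by (intro sum.neutral) auto
    qed
    have f1_in: "f1 e = q e + 1" if "e \<in> A - B - {x2}" for e
    proof -
      have "f1 e = (\<Sum>e'\<in>A - B - {x2}. if e' = e then q e + 1 else 0)"
        unfolding f1_def using that Q(1,2) by (intro sum.cong) auto
      then show ?thesis using that fin(4) by simp
    qed
    have f1_x2: "f1 x2 = 0"
      unfolding f1_def using x2B Q(2) by (intro sum.neutral) auto
    have net_f1: "net P f1 S = 0" for S
      unfolding f1_def net_sum using Q(3) by (intro sum.neutral) (auto simp: net_cmult)
    obtain a where a: "\<not> 3 dvd a - q x2" "\<not> 3 dvd (f1 x1 - q x1) + a * Q x2 x1"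
      using avoid_two_residues[OF r] by blast
    define f2 where "f2 = (\<lambda>e. f1 e + a * Q x2 e)"
    \<comment> \<open>The values \<open>f2\<close> are already fixed, so inside \<open>X\<close> the
      correction \<open>g\<close> must avoid \<open>q - f2\<close> instead of
      \<open>q\<close>.\<close>
    obtain g where "avoids (\<lambda>e. q e - f2 e) g" using avoid by blast
    then have g: "\<And>e. e \<notin> I \<Longrightarrow> g e = 0" "\<And>S. 3 dvd net P g S"
      "\<And>e. e \<in> I - C \<Longrightarrow> \<not> 3 dvd g e - (q e - f2 e)" by (simp_all add: avoids_def)
    define f where "f = (\<lambda>e. f2 e + g e)"
    have "f e = 0" if "e \<notin> A" for e
    proof -
      have "e \<notin> insert x2 B" using that x2A BA by blast
      then show ?thesis
        using f1_out[OF that] g(1)[of e] Q(2)[OF x2A, of e] by (simp add: f_def f2_def B_def)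
    qed
    moreover have "3 dvd net P f S" for S
      using g(2)[of S] net_f1[of S] Q(3)[OF x2A, of S]
      by (simp add: f_def f2_def net_add net_cmult)
    moreover have "\<not> 3 dvd f e - q e" if e: "e \<in> A - (C \<union> CY)" for e
    proof -
      consider "e \<in> I - C" | "e = x1" | "e = x2" | "e \<in> A - B - {x2}" "e \<notin> I"
        using e by (auto simp: B_def)
      then show ?thesis
      proof cases
        case 1
        then show ?thesis using g(3)[OF 1] by (simp add: f_def algebra_simps)
      next
        case 2
        then show ?thesis using a(2) g(1)[of x1] x1B by (simp add: f_def f2_def algebra_simps)
      next
        case 3
        then show ?thesis
          using a(1) g(1)[of x2] x2B f1_x2 Q(1)[OF x2A] by (simp add: f_def f2_def B_def)
      next
        case 4
        then show ?thesis
          using f1_in[OF 4(1)] g(1)[OF 4(2)] Q(2)[OF x2A, of e] by (simp add: f_def f2_def)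
      qed
    qed
    ultimately show "\<exists>f. (\<forall>e. e \<notin> P \<inter> inside (X \<union> Y) \<longrightarrow> f e = 0) \<and> (\<forall>S. 3 dvd net P f S) \<and>
        (\<forall>e\<in>P \<inter> inside (X \<union> Y) - (C \<union> CY). \<not> 3 dvd f e - q e)"
      unfolding A_def[symmetric] by blast
  qed
qed

lemma finite_component: "finite F \<Longrightarrow> finite (component F v)"
proof (rule finite_subset)
  show "component F v \<subseteq> insert v (t ` F \<union> h ` F)"
  proof
    fix w assume w: "w \<in> component F v"
    show "w \<in> insert v (t ` F \<union> h ` F)"
    proof (cases "w = v")
      case False
      then have "F \<inter> cut (- {w}) \<noteq> {}"
        using w[unfolded component_def con_def mem_Collect_eq, rule_format, of "- {w}"] by simp
      then obtain e where "e \<in> F" "e \<in> cut {w}" by auto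
      then show ?thesis by (auto simp: cut_def)
    qed simp
  qed
qed auto

text \<open>\<open>S\<close> is a leaf of the bridge tree of the unfinished part \<open>D\<close> of
  the component: a smallest nonempty subset that at most one edge of \<open>R\<close> leaves. As at
  least three edges leave \<open>S\<close> in \<open>P\<close>, two of them end in \<open>X\<close>.
  Smallness makes the graph inside \<open>S\<close> bridgeless and connected, so their ends in
  \<open>S\<close> lie in one component \<open>Y\<close> of an Eulerian set by
  \<open>eulerian_connecting\<close>.\<close>

lemma avoidable_step:
  assumes P: "finite P" and cuts: "\<And>S. P \<inter> cut S = {} \<or> 3 \<le> card (P \<inter> cut S)"
    and X: "avoidable P X C" "x \<in> X" "P \<inter> cut X \<noteq> {}"
  obtains Y C' where "Y \<inter> X = {}" "Y \<noteq> {}" "avoidable P (X \<union> Y) C'"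
proof -
  define D where "D = component P x - X"
  define R where "R = P \<inter> inside (- X)"
  have XK: "X \<subseteq> component P x"
  proof
    fix w assume "w \<in> X"
    then have "con (P \<inter> inside X) x w" using X by (simp add: avoidable_def)
    then show "w \<in> component P x" using con_mono[of _ x w P] by (auto simp: component_def)
  qed
  have "D \<noteq> {}"
  proof
    assume "D = {}"
    then have "component P x = X" using XK by (auto simp: D_def)
    then show False using X(3) cut_component[of P x] by simp
  qed
  have "R \<inter> cut D = {}"
    using cut_component[of P x] by (auto simp: D_def R_def cut_def inside_def)
  then have "D \<subseteq> D \<and> D \<noteq> {} \<and> card (R \<inter> cut D) \<le> 1" using \<open>D \<noteq> {}\<close> by simp
  then obtain S where S: "S \<subseteq> D" "S \<noteq> {}" "card (R \<inter> cut S) \<le> 1"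
    and Smin: "\<And>S'. S' \<subseteq> D \<Longrightarrow> S' \<noteq> {} \<Longrightarrow> card (R \<inter> cut S') \<le> 1 \<Longrightarrow> card S \<le> card S'"
    using ex_has_least_nat[of "\<lambda>S. S \<subseteq> D \<and> S \<noteq> {} \<and> card (R \<inter> cut S) \<le> 1" D card] by metis
  have "finite S" using finite_subset[OF S(1)] finite_component[OF P, of x] by (simp add: D_def)
  have finR: "finite R" using P by (simp add: R_def)
  obtain s where s: "s \<in> S" using S(2) by blast
  then have "con P s x" using S(1) con_sym by (auto simp: D_def component_def)
  moreover have "x \<notin> S" using S(1) X(2) by (auto simp: D_def)
  ultimately have "P \<inter> cut S \<noteq> {}" using s unfolding con_def by blast
  then have "3 \<le> card (P \<inter> cut S)" using cuts by blast
  moreover have "P \<inter> cut S \<subseteq> (R \<inter> cut S) \<union> (P \<inter> cut S \<inter> cut X)"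
    using S(1) by (auto simp: R_def inside_def cut_def D_def)
  then have "card (P \<inter> cut S) \<le> card (R \<inter> cut S) + card (P \<inter> cut S \<inter> cut X)"
    using P finR by (meson card_Un_le card_mono finite_Int finite_UnI order_trans)
  ultimately have "2 \<le> card (P \<inter> cut S \<inter> cut X)" using S(3) by simp
  then obtain x1 x2 where x12: "x1 \<in> P \<inter> cut S \<inter> cut X" "x2 \<in> P \<inter> cut S \<inter> cut X" "x1 \<noteq> x2"
    by (metis One_nat_def card_le_Suc0_iff_eq finite_Int P not_less_eq_eq numeral_2_eq_2)
  define y1 where "y1 = (if t x1 \<in> X then h x1 else t x1)"
  define y2 where "y2 = (if t x2 \<in> X then h x2 else t x2)"
  have y: "y1 \<in> S" "y2 \<in> S"
    using x12 S(1) by (auto simp: y1_def y2_def cut_def D_def)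
  define F where "F = P \<inter> inside S"
  have Fcuts: "2 \<le> card (F \<inter> cut A)" if A: "A \<subset> S" "A \<noteq> {}" for A
  proof (rule ccontr)
    assume "\<not> 2 \<le> card (F \<inter> cut A)"
    then have le1: "card (F \<inter> cut A) \<le> 1" by simp
    \<comment> \<open>The possible single edge of \<open>R\<close> leaving \<open>S\<close> has its
      inner end in only one of \<open>A\<close> and \<open>S - A\<close>; the other one contradicts
      the choice of \<open>S\<close>.\<close>
    have "\<exists>A'. A' \<subset> S \<and> A' \<noteq> {} \<and> R \<inter> cut A' \<subseteq> F \<inter> cut A"
    proof (cases "R \<inter> cut S \<inter> cut A = {}")
      case True
      then have "R \<inter> cut A \<subseteq> F \<inter> cut A"
        using A by (auto simp: R_def F_def inside_def cut_def)
      then show ?thesis using A by blast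
    next
      case False
      then obtain b where b: "b \<in> R \<inter> cut S" "b \<in> cut A" by blast
      have "R \<inter> cut S \<subseteq> {b}"
        using S(3) b finR by (metis One_nat_def card_le_Suc0_iff_eq finite_Int singletonI subsetI)
      moreover have "b \<notin> cut (S - A)" using b A by (auto simp: cut_def)
      ultimately have "R \<inter> cut (S - A) \<inter> cut S = {}" by blast
      then have "R \<inter> cut (S - A) \<subseteq> F \<inter> cut A"
        using A by (auto simp: R_def F_def inside_def cut_def)
      then show ?thesis using A by (intro exI[of _ "S - A"]) auto
    qed
    then obtain A' where A': "A' \<subset> S" "A' \<noteq> {}" "R \<inter> cut A' \<subseteq> F \<inter> cut A" by blast
    have "card (R \<inter> cut A') \<le> 1"
      using card_mono[OF _ A'(3)] le1 P by (simp add: F_def)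
    then have "card S \<le> card A'" using Smin A' S(1) by blast
    then show False using psubset_card_mono[OF \<open>finite S\<close> A'(1)] by simp
  qed
  obtain Z where Z: "Z \<subseteq> F" "eulerian Z" "con Z y1 y2"
    using eulerian_connecting[of F S y1 y2] P y Fcuts by (auto simp: F_def)
  define Y where "Y = component Z y1"
  define CY where "CY = Z \<inter> inside Y"
  have cutY: "Z \<inter> cut Y = {}" by (simp add: Y_def)
  have YS: "Y \<subseteq> S"
    unfolding Y_def using Z(1) y(1) by (intro component_least) (auto simp: F_def inside_def cut_def)
  have y12: "y1 \<in> Y" "y2 \<in> Y" using Z(3) by (auto simp: Y_def component_def)
  have "avoidable P (X \<union> Y) (C \<union> CY)"
  proof (rule avoidable_grow[OF P X(1)])
    show "CY \<subseteq> P \<inter> inside Y" using Z(1) by (auto simp: CY_def F_def)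
    show "eulerian CY" unfolding CY_def using Z(2) cutY by (rule eulerian_inside)
    show "con CY u w" if "u \<in> Y" "w \<in> Y" for u w
    proof -
      have "con Z u w" using that con_component by (simp add: Y_def)
      then show ?thesis unfolding CY_def using con_inside[OF _ cutY that(1)] by blast
    qed
    show "X \<inter> Y = {}" using YS S(1) by (auto simp: D_def)
    show "x1 \<in> P" "x2 \<in> P" "x1 \<noteq> x2" using x12 by auto
    show "x1 \<in> inside (X \<union> Y) \<inter> cut X" "x2 \<in> inside (X \<union> Y) \<inter> cut X"
      using x12 y12 by (auto simp: y1_def y2_def inside_def cut_def split: if_splits)
  qed
  moreover have "Y \<inter> X = {}" "Y \<noteq> {}" using YS S(1) y12 by (auto simp: D_def)
  ultimately show thesis using that by blast
qed

lemma avoidable_component: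
  assumes P: "finite P" and cuts: "\<And>S. P \<inter> cut S = {} \<or> 3 \<le> card (P \<inter> cut S)"
  obtains X C where "x \<in> X" "avoidable P X C" "P \<inter> cut X = {}"
proof -
  define \<X> where "\<X> = {X. x \<in> X \<and> (\<exists>C. avoidable P X C)}"
  have "\<X> \<subseteq> Pow (component P x)"
  proof (intro subsetI PowI)
    fix X w assume "X \<in> \<X>" "w \<in> X"
    then have "con (P \<inter> inside X) x w" by (auto simp: \<X>_def avoidable_def)
    then show "w \<in> component P x" using con_mono[of _ x w P] by (auto simp: component_def)
  qed
  then have "finite \<X>" using finite_component[OF P] finite_subset by blast
  moreover have "{x} \<in> \<X>" using avoidable_singleton by (auto simp: \<X>_def)
  ultimately obtain X where X: "X \<in> \<X>" "\<And>X'. X' \<in> \<X> \<Longrightarrow> X \<subseteq> X' \<Longrightarrow> X' = X"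
    using finite_has_maximal2 by (metis (no_types, lifting))
  obtain C where C: "avoidable P X C" "x \<in> X" using X(1) by (auto simp: \<X>_def)
  have "P \<inter> cut X = {}"
  proof (rule ccontr)
    assume "P \<inter> cut X \<noteq> {}"
    then obtain Y C' where "Y \<inter> X = {}" "Y \<noteq> {}" "avoidable P (X \<union> Y) C'"
      using avoidable_step[OF P cuts C] by blast
    then show False using X(2)[of "X \<union> Y"] C(2) by (auto simp: \<X>_def)
  qed
  then show thesis using that C by blast
qed

section \<open>Reductions for the 6-flow theorem: contraction and finished components\<close>

lemma net_Compl: "net F f (- S) = - net F f S"
  unfolding net_def sum_negf[symmetric] by (intro sum.cong) auto

lemma net_eqI_cut: "finite F \<Longrightarrow> F \<inter> cut S \<subseteq> F' \<Longrightarrow> F' \<subseteq> F \<Longrightarrow> net F f S = net F' f S"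
  unfolding net_def by (intro sum.mono_neutral_right) (auto simp: cut_def)

text \<open>Contracting \<open>e2\<close> preserves the cuts that \<open>e2\<close> does not cross.
  Any other cut differs from that of \<open>S0\<close> by one of these, so the parity of
  \<open>C'\<close> at \<open>S0\<close> decides whether \<open>e2\<close> must be added, and
  conservation at \<open>t e2\<close> dictates its value. Only \<open>e1\<close> and
  \<open>e2\<close> cross \<open>S0\<close>: if \<open>e2\<close> stays outside \<open>C\<close>,
  then \<open>e1\<close> is outside \<open>C'\<close>, and the nonzero value of \<open>e1\<close>
  modulo 3 passes to \<open>e2\<close> up to sign.\<close>

lemma six_flow_contract:
  fixes e2 :: 'e
  defines "r \<equiv> (\<lambda>v. if v = h e2 then t e2 else v)"
  assumes P: "finite P" and cut2: "P \<inter> cut S0 = {e1, e2}" "e1 \<noteq> e2"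
    and C': "C' \<subseteq> P - {e2}" "ends.eulerian (r \<circ> t) (r \<circ> h) C'"
    and f': "\<And>S. 3 dvd ends.net (r \<circ> t) (r \<circ> h) (P - {e2}) f' S"
      "\<And>e. e \<in> P - {e2} - C' \<Longrightarrow> \<not> 3 dvd f' e"
  shows "\<exists>C f. C \<subseteq> P \<and> eulerian C \<and> (\<forall>S. 3 dvd net P f S) \<and> (\<forall>e\<in>P - C. \<not> 3 dvd f e)"
proof -
  interpret c: ends "r \<circ> t" "r \<circ> h" .
  define P' where "P' = P - {e2}"
  have P': "finite P'" "P = insert e2 P'" "e2 \<notin> P'" using P cut2(1) by (auto simp: P'_def)
  have e12: "e1 \<in> P" "e2 \<in> P" "e1 \<in> cut S0" "e2 \<in> cut S0" using cut2(1) by auto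
  have ccut: "c.cut S = cut (r -` S)" for S by (simp add: c.cut_def cut_def)
  have r_id: "r -` S = S" if "e2 \<notin> cut S" for S
    using that by (auto simp: r_def cut_def split: if_splits)
  have par0: "\<not> par C' S" if "e2 \<notin> cut S" for S
  proof -
    have "\<not> c.par C' S" using C'(2) by (simp add: c.eulerian_def)
    then show ?thesis using r_id[OF that] by (simp add: c.par_def par_def ccut)
  qed
  have net0: "3 dvd net P' f' S" if "e2 \<notin> cut S" for S
  proof -
    have "c.net P' f' S = net P' f' (r -` S)" by (simp add: c.net_def net_def)
    then show ?thesis using f'(1)[of S] r_id[OF that] by (simp add: P'_def)
  qed
  have finC': "finite C'" using P'(1) C'(1) finite_subset by (auto simp: P'_def)
  define C where "C = (if par C' S0 then insert e2 C' else C')"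
  define c where "c = - net P' f' {t e2}"
  define f where "f = f'(e2 := c)"
  have "e2 \<notin> C'" using C'(1) by auto
  have parC: "par (insert e2 C') S \<longleftrightarrow> (e2 \<in> cut S) \<noteq> par C' S" for S
    using par_Un[of "{e2}" C' S] finC' \<open>e2 \<notin> C'\<close> by (auto simp: par_singleton cut_def)
  have "eulerian C"
    unfolding eulerian_def
  proof
    fix S
    show "\<not> par C S"
    proof (cases "e2 \<in> cut S")
      case True
      then have "e2 \<notin> cut (sym_diff S S0)" using e12(4) by (auto simp: cut_def)
      then have "par C' S \<longleftrightarrow> par C' S0" using par0 par_cut_sym_diff[OF finC'] by blast
      then show ?thesis using True e12(4) by (simp add: C_def parC)
    next
      case False
      then show ?thesis using par0[OF False] by (simp add: C_def parC)
    qed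
  qed
  moreover have "3 dvd net P f S" for S
  proof -
    have netP: "net P f S = c * (of_bool (t e2 \<in> S) - of_bool (h e2 \<in> S)) + net P' f' S" for S
    proof -
      have "net P' f S = net P' f' S" using P'(3) by (intro net_cong) (auto simp: f_def)
      then show ?thesis unfolding P'(2) by (simp add: net_insert[OF P'(1,3)] f_def)
    qed
    have *: "3 dvd net P f S" if S: "t e2 \<in> S" "h e2 \<notin> S" for S
    proof -
      have "S = {t e2} \<union> (S - {t e2})" using S by auto
      then have "net P' f' S = net P' f' {t e2} + net P' f' (S - {t e2})"
        by (metis Diff_disjoint net_disjoint_Un)
      moreover have "3 dvd net P' f' (S - {t e2})" using S by (intro net0) (auto simp: cut_def)
      ultimately show ?thesis using S by (simp add: netP c_def)
    qed
    show ?thesis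
    proof (cases "e2 \<in> cut S")
      case True
      then consider "t e2 \<in> S" "h e2 \<notin> S" | "t e2 \<in> - S" "h e2 \<notin> - S" by (auto simp: cut_def)
      then show ?thesis
      proof cases
        case 2
        then show ?thesis using *[of "- S"] by (simp add: net_Compl)
      qed (rule *)
    next
      case False
      then show ?thesis using net0[OF False] by (auto simp: netP cut_def)
    qed
  qed
  note flow = this
  moreover have "\<not> 3 dvd f e" if e: "e \<in> P - C" for e
  proof (cases "e = e2")
    case True
    then have "\<not> par C' S0" using e by (auto simp: C_def split: if_splits)
    moreover have "C' \<inter> cut S0 = (if e1 \<in> C' then {e1} else {})" using cut2 C'(1) by auto
    ultimately have "e1 \<notin> C'" by (auto simp: par_def)
    then have "\<not> 3 dvd f e1" using f'(2)[of e1] e12(1) cut2(2) by (simp add: f_def)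
    moreover have "net P f S0 = net {e1, e2} f S0" using cut2(1) e12 P by (intro net_eqI_cut) auto
    moreover have "net {e1, e2} f S0 \<in>
        {f e1 + f e2, f e1 - f e2, - f e1 + f e2, - f e1 - f e2}"
      using cut2(2) e12(3,4) by (auto simp: net_def cut_def)
    moreover have "3 dvd net P f S0" using flow by simp
    ultimately show ?thesis unfolding True by (elim insertE emptyE) presburger+
  next
    case False
    then show ?thesis using f'(2)[of e] e by (auto simp: f_def C_def split: if_splits)
  qed
  moreover have "C \<subseteq> P" using C'(1) e12(2) by (auto simp: C_def)
  ultimately show ?thesis by blast
qed

lemma six_flow_component:
  assumes P: "finite P" and X: "avoidable P X C" "P \<inter> cut X = {}"
    and rest: "C' \<subseteq> P - inside X" "eulerian C'" "\<And>S. 3 dvd net (P - inside X) f' S"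
      "\<And>e. e \<in> P - inside X - C' \<Longrightarrow> \<not> 3 dvd f' e"
  shows "\<exists>C f. C \<subseteq> P \<and> eulerian C \<and> (\<forall>S. 3 dvd net P f S) \<and> (\<forall>e\<in>P - C. \<not> 3 dvd f e)"
proof -
  define Q where "Q = P - inside X"
  have avoid: "\<forall>q. \<exists>f. (\<forall>e. e \<notin> P \<inter> inside X \<longrightarrow> f e = 0) \<and> (\<forall>S. 3 dvd net P f S) \<and>
       (\<forall>e\<in>P \<inter> inside X - C. \<not> 3 dvd f e - q e)" and C: "C \<subseteq> P \<inter> inside X" "eulerian C"
    using X(1) unfolding avoidable_def by auto
  \<comment> \<open>In the end the only value to be avoided is zero.\<close>
  from avoid[rule_format, of "\<lambda>e. 0"] obtain g where
    "(\<forall>e. e \<notin> P \<inter> inside X \<longrightarrow> g e = 0) \<and> (\<forall>S. 3 dvd net P g S) \<and>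
       (\<forall>e\<in>P \<inter> inside X - C. \<not> 3 dvd g e - 0)" ..
  then have g: "\<And>e. e \<notin> P \<inter> inside X \<Longrightarrow> g e = 0" "\<And>S. 3 dvd net P g S"
    "\<And>e. e \<in> P \<inter> inside X - C \<Longrightarrow> \<not> 3 dvd g e" by auto
  define f where "f = (\<lambda>e. if e \<in> Q then f' e else 0)"
  have "net P f S = net Q f' S" for S
  proof -
    have "net P f S = net Q f S"
      using P by (intro net_mono_neutral) (auto simp: f_def Q_def)
    also have "\<dots> = net Q f' S" by (intro net_cong) (simp add: f_def)
    finally show ?thesis .
  qed
  then have "3 dvd net P (\<lambda>e. f e + g e) S" for S
    using rest(3)[of S] g(2)[of S] by (simp add: net_add Q_def)
  moreover have "eulerian (C \<union> C')"
    using C rest(1,2) P finite_subset[OF C(1)] finite_subset[OF rest(1)] by (intro eulerian_Un) auto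
  moreover have "\<not> 3 dvd f e + g e" if "e \<in> P - (C \<union> C')" for e
    using that rest(4)[of e] g(1,3)[of e] by (cases "e \<in> inside X") (auto simp: f_def Q_def)
  moreover have "C \<union> C' \<subseteq> P" using C(1) rest(1) by auto
  ultimately show ?thesis by (intro exI[of _ "C \<union> C'"] exI[of _ "\<lambda>e. f e + g e"]) auto
qed

end

text \<open>
  Seymour's 6-flow theorem: a nowhere-zero \<open>\<int>\<^sub>2 \<times> \<int>\<^sub>3\<close>-flow, with \<open>C\<close> the support of its
  \<open>\<int>\<^sub>2\<close>-part. Edges in a common 2-edge-cut can be contracted as they carry equal values up to sign.
\<close>

theorem six_flow:
  fixes t h :: "'e \<Rightarrow> 'v"
  assumes "finite P" "\<And>S. card (P \<inter> ends.cut t h S) \<noteq> 1"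
  shows "\<exists>C f. C \<subseteq> P \<and> ends.eulerian t h C \<and> (\<forall>S. 3 dvd ends.net t h P f S) \<and>
    (\<forall>e\<in>P - C. \<not> 3 dvd f e)"
  using assms
proof (induction "card P" arbitrary: P t h rule: less_induct)
  case less
  interpret ends t h .
  note P = less.prems(1)
  consider "P = {}" | (cut2) S0 where "card (P \<inter> cut S0) = 2"
    | "P \<noteq> {}" "\<And>S. card (P \<inter> cut S) \<noteq> 2" by blast
  then show ?case
  proof cases
    case 1
    then show ?thesis by (intro exI[of _ "{}"]) (auto simp: net_def)
  next
    case (cut2 S0)
    then obtain e1 e2 where e: "P \<inter> cut S0 = {e1, e2}" "e1 \<noteq> e2" by (auto simp: card_2_iff)
    define r where "r = (\<lambda>v. if v = h e2 then t e2 else v)"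
    interpret c: ends "r \<circ> t" "r \<circ> h" .
    have "c.cut S = cut (r -` S)" "e2 \<notin> cut (r -` S)" for S
      by (simp add: c.cut_def cut_def) (auto simp: r_def cut_def)
    then have "(P - {e2}) \<inter> c.cut S = P \<inter> cut (r -` S)" for S by auto
    then have "card ((P - {e2}) \<inter> c.cut S) \<noteq> 1" for S using less.prems(2) by simp
    moreover have "card (P - {e2}) < card P" using P e by (intro psubset_card_mono) auto
    ultimately obtain C' f' where "C' \<subseteq> P - {e2}" "c.eulerian C'"
      "\<forall>S. 3 dvd c.net (P - {e2}) f' S" "\<forall>e\<in>P - {e2} - C'. \<not> 3 dvd f' e"
      using less.hyps[of "P - {e2}" "r \<circ> t" "r \<circ> h"] P by blast
    then show ?thesis
      using six_flow_contract[OF P e, of C' f', folded r_def] by blast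
  next
    case 3
    then obtain e where "e \<in> P" by blast
    have cuts: "P \<inter> cut S = {} \<or> 3 \<le> card (P \<inter> cut S)" for S
    proof -
      have "card (P \<inter> cut S) \<noteq> 1" "card (P \<inter> cut S) \<noteq> 2" using less.prems(2) 3(2) by auto
      then have "card (P \<inter> cut S) = 0 \<or> 3 \<le> card (P \<inter> cut S)" by linarith
      then show ?thesis using P by simp
    qed
    obtain X C where X: "t e \<in> X" "avoidable P X C" "P \<inter> cut X = {}"
      using avoidable_component[OF P cuts] by metis
    have "e \<in> inside X" using X(1,3) \<open>e \<in> P\<close> by (auto simp: inside_def cut_def)
    then have "card (P - inside X) < card P"
      using \<open>e \<in> P\<close> P by (intro psubset_card_mono) auto
    moreover have "(P - inside X) \<inter> cut S = P \<inter> cut (S - X)" for S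
      using X(3) by (auto simp: inside_def cut_def)
    then have "card ((P - inside X) \<inter> cut S) \<noteq> 1" for S using less.prems(2) by simp
    ultimately obtain C' f' where "C' \<subseteq> P - inside X" "eulerian C'"
      "\<forall>S. 3 dvd net (P - inside X) f' S" "\<forall>e\<in>P - inside X - C'. \<not> 3 dvd f' e"
      using less.hyps[of "P - inside X" t h] P by blast
    then show ?thesis using six_flow_component[OF P X(2,3), of C' f'] by blast
  qed
qed

section \<open>Three Eulerian sets that cover a bridgeless graph\<close>

lemma card_eq_sum_of_bool: "finite P \<Longrightarrow> S \<subseteq> P \<Longrightarrow> card S = (\<Sum>e\<in>P. of_bool (e \<in> S))"
  by (simp add: Int_absorb1)

context ends
begin

text \<open>Each edge of \<open>D\<close> lies in exactly two of \<open>X\<close>, \<open>Y\<close>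
  and their sum. The three sizes add up to twice that of \<open>D\<close>, and the two smallest make
  up at most two thirds of this.\<close>

lemma two_of_three:
  assumes "finite D" "eulerian X" "eulerian Y" "X \<union> Y = D"
  obtains X' Y' where "eulerian X'" "eulerian Y'" "X' \<union> Y' = D"
    "3 * (card X' + card Y') \<le> 4 * card D"
proof -
  define Z where "Z = sym_diff X Y"
  have fin: "finite X" "finite Y" using assms(1,4) by auto
  have Z: "eulerian Z" "X \<union> Z = D" "Y \<union> Z = D"
    using eulerian_sym_diff[OF fin assms(2,3)] assms(4) by (auto simp: Z_def)
  have sub: "X \<subseteq> D" "Y \<subseteq> D" "Z \<subseteq> D" using assms(4) by (auto simp: Z_def)
  have "(\<Sum>e\<in>D. 2) = (\<Sum>e\<in>D. of_bool (e \<in> X) + of_bool (e \<in> Y) + of_bool (e \<in> Z) :: nat)"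
    using assms(4) by (intro sum.cong) (auto simp: Z_def)
  also have "\<dots> = card X + card Y + card Z"
    unfolding sum.distrib sub[THEN card_eq_sum_of_bool[OF assms(1)]] ..
  finally have "3 * (card X + card Y) \<le> 4 * card D \<or> 3 * (card X + card Z) \<le> 4 * card D \<or>
      3 * (card Y + card Z) \<le> 4 * card D" by simp linarith
  then show thesis using that assms Z by blast
qed

text \<open>
  Let \<open>c\<close> and \<open>d\<close> be the numbers of edges in the \<open>\<int>\<^sub>2\<close>-support \<open>C\<close> and in the \<open>\<int>\<^sub>3\<close>-support \<open>D\<close> of
  a 6-flow. Two Eulerian sets of total size \<open>4d/3\<close> cover \<open>D\<close>; the third set is \<open>C\<close> if
  \<open>c \<le> 3m/5\<close>, and otherwise the best of the four sums of \<open>C\<close> with the Eulerian sets covering \<open>D\<close>.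
  Adding an orientation of \<open>C\<close> to the \<open>\<int>\<^sub>3\<close>-flow zero, one or two times,
  one achieves \<open>d \<le> m - c/3\<close>.
\<close>

theorem bridgeless_cover:
  assumes P: "finite P" and bridgeless: "\<And>S. card (P \<inter> cut S) \<noteq> 1"
  obtains A1 A2 A3 where "eulerian A1" "eulerian A2" "eulerian A3" "A1 \<union> A2 \<union> A3 = P"
    "3 * (card A1 + card A2 + card A3) \<le> 5 * card P"
proof -
  obtain C f where C: "C \<subseteq> P" "eulerian C" and f: "\<And>S. 3 dvd net P f S"
    "\<And>e. e \<in> P - C \<Longrightarrow> \<not> 3 dvd f e"
    using six_flow[OF P bridgeless] by blast
  have finC: "finite C" using C(1) P finite_subset by blast
  obtain g where g: "\<And>e. e \<in> C \<Longrightarrow> g e \<in> {1, -1}" "\<And>e. e \<notin> C \<Longrightarrow> g e = 0"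
    "\<And>S. net C g S = 0"
    using eulerian_orientation[OF finC C(2)] by metis
  have netg: "net P g S = 0" for S
    using net_mono_neutral[OF P C(1), of g S] g(2,3) by simp
  \<comment> \<open>As \<open>g\<close> is 1 or -1 on \<open>C\<close>, each edge of
    \<open>C\<close> lies in \<open>Z k\<close> for exactly one of the three \<open>k\<close>, so
    one of these sets contains a third of \<open>C\<close>.\<close>
  define Z where "Z = (\<lambda>k. {e \<in> C. 3 dvd f e + k * g e})"
  have Zf: "finite (Z k)" for k using finC by (simp add: Z_def)
  have "card (Z 0) + card (Z 1) + card (Z (-1)) = (\<Sum>e\<in>C. 1)"
  proof -
    have sub: "Z k \<subseteq> C" for k by (auto simp: Z_def)
    have one: "of_bool (e \<in> Z 0) + of_bool (e \<in> Z 1) + of_bool (e \<in> Z (-1)) = (1 :: nat)"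
      if "e \<in> C" for e
    proof -
      have "(3 dvd f e \<and> \<not> 3 dvd f e + 1 \<and> \<not> 3 dvd f e - 1) \<or>
        (\<not> 3 dvd f e \<and> 3 dvd f e + 1 \<and> \<not> 3 dvd f e - 1) \<or>
        (\<not> 3 dvd f e \<and> \<not> 3 dvd f e + 1 \<and> 3 dvd f e - 1)" by presburger
      then show ?thesis using that g(1)[OF that] by (auto simp: Z_def)
    qed
    have "(\<Sum>e\<in>C. 1) = (\<Sum>e\<in>C. of_bool (e \<in> Z 0) + of_bool (e \<in> Z 1) + of_bool (e \<in> Z (-1)) :: nat)"
      using one by (intro sum.cong) auto
    also have "\<dots> = card (Z 0) + card (Z 1) + card (Z (-1))"
      unfolding sum.distrib card_eq_sum_of_bool[OF finC sub] ..
    finally show ?thesis by simp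
  qed
  then have "\<exists>k\<in>{0, 1, -1}. card C \<le> 3 * card (Z k)" by simp linarith
  then obtain k where k: "card C \<le> 3 * card (Z k)" by blast
  define D where "D = P - Z k"
  have ZP: "Z k \<subseteq> P" using C(1) by (auto simp: Z_def)
  have finD: "finite D" and cD: "card D + card (Z k) = card P"
    using P card_Diff_subset[OF Zf ZP] card_mono[OF P ZP] by (auto simp: D_def)
  have "3 dvd net D (\<lambda>e. f e + k * g e) S" for S
  proof -
    have "3 dvd net (Z k) (\<lambda>e. f e + k * g e) S"
      unfolding net_def by (intro dvd_sum) (auto simp: Z_def)
    moreover have "3 dvd net P (\<lambda>e. f e + k * g e) S"
      using f(1)[of S] netg[of S] by (simp add: net_add net_cmult)
    ultimately show ?thesis
      unfolding D_def net_Diff[OF P ZP] by (rule dvd_diff[rotated])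
  qed
  moreover have "\<not> 3 dvd f e + k * g e" if "e \<in> D" for e
    using that f(2)[of e] g(2)[of e] by (cases "e \<in> C") (auto simp: D_def Z_def)
  ultimately obtain X Y where XY: "eulerian X" "eulerian Y" "X \<union> Y = D"
    using mod_three_flow_cover[OF finD] by blast
  have finXY: "finite X" "finite Y" using XY(3) finD by auto
  obtain X' Y' where XY': "eulerian X'" "eulerian Y'" "X' \<union> Y' = D"
    "3 * (card X' + card Y') \<le> 4 * card D"
    using two_of_three[OF finD XY] by blast
  have PC: "P - C \<subseteq> D" by (auto simp: D_def Z_def)
  show thesis
  \<comment> \<open>With d at most m - c/3, the first choice costs 4d/3 + c, at most 4m/3 + 5c/9.
    The second costs 4d/3 + (m - d/2) = m + 5d/6. Both bounds become 5m/3 at c = 3m/5.\<close>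
  proof (cases "5 * card C \<le> 3 * card P")
    case True
    have "X' \<union> Y' \<union> C = P" using XY'(3) PC C(1) by (auto simp: D_def)
    moreover have "3 * (card X' + card Y' + card C) \<le> 5 * card P"
    proof -
      have "9 * (card X' + card Y') \<le> 12 * card D" "4 * card C \<le> 12 * card (Z k)"
        "5 * card C \<le> 3 * card D + 3 * card (Z k)"
        using XY'(4) k True cD by simp_all
      then have "9 * (card X' + card Y') + 9 * card C \<le> 15 * card D + 15 * card (Z k)"
        by linarith
      then show ?thesis unfolding cD[symmetric] by simp
    qed
    ultimately show ?thesis using that[of X' Y' C] XY' C(2) by blast
  next
    case False
    define B where "B = (\<lambda>A. sym_diff C A)"
    have B: "eulerian (B A)" "P - D \<subseteq> B A" "B A \<subseteq> P" if "eulerian A" "A \<subseteq> D" for A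
      using that eulerian_sym_diff[OF finC _ C(2) that(1)] finite_subset[OF that(2) finD] PC C(1)
      by (auto simp: B_def D_def)
    have XYs: "eulerian (sym_diff X Y)" using eulerian_sym_diff[OF finXY XY(1,2)] .
    have sub: "{} \<subseteq> D" "X \<subseteq> D" "Y \<subseteq> D" "sym_diff X Y \<subseteq> D" using XY(3) by auto
    have "card (B {}) + card (B X) + card (B Y) + card (B (sym_diff X Y))
      = (\<Sum>e\<in>P. of_bool (e \<in> B {}) + of_bool (e \<in> B X) + of_bool (e \<in> B Y)
          + of_bool (e \<in> B (sym_diff X Y)))"
      unfolding sum.distrib card_eq_sum_of_bool[OF P B(3)[OF eulerian_empty sub(1)]]
        card_eq_sum_of_bool[OF P B(3)[OF XY(1) sub(2)]]
        card_eq_sum_of_bool[OF P B(3)[OF XY(2) sub(3)]]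
        card_eq_sum_of_bool[OF P B(3)[OF XYs sub(4)]] ..
    \<comment> \<open>An edge of \<open>Z k\<close> is in \<open>C\<close> and outside
      \<open>D\<close>, hence in all four sums; an edge of \<open>D\<close> is in two of
      them.\<close>
    also have "\<dots> = (\<Sum>e\<in>P. 4 * of_bool (e \<in> Z k) + 2 * of_bool (e \<in> D))"
      using XY(3) PC by (intro sum.cong) (auto simp: B_def D_def Z_def)
    also have "\<dots> = 4 * card (Z k) + 2 * card D"
      unfolding sum.distrib sum_distrib_left[symmetric]
      using card_eq_sum_of_bool[OF P ZP] card_eq_sum_of_bool[OF P, of D] by (simp add: D_def)
    finally have "2 * card (B {}) \<le> 2 * card (Z k) + card D \<or> 2 * card (B X) \<le> 2 * card (Z k) + card D
      \<or> 2 * card (B Y) \<le> 2 * card (Z k) + card D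
      \<or> 2 * card (B (sym_diff X Y)) \<le> 2 * card (Z k) + card D" by linarith
    then obtain A where A: "eulerian A" "A \<subseteq> D" "2 * card (B A) \<le> 2 * card (Z k) + card D"
      using XY(1,2) XYs sub eulerian_empty by metis
    have "X' \<union> Y' \<union> B A = P" using XY'(3) B(2,3)[OF A(1,2)] by (auto simp: D_def)
    moreover have "3 * (card X' + card Y' + card (B A)) \<le> 5 * card P"
    proof -
      have "card D \<le> 4 * card (Z k)" using k False unfolding cD[symmetric] by simp
      moreover have "6 * (card X' + card Y') \<le> 8 * card D" "6 * card (B A) \<le> 6 * card (Z k) + 3 * card D"
        using XY'(4) A(3) by simp_all
      ultimately have "6 * (card X' + card Y') + 6 * card (B A) \<le> 10 * card D + 10 * card (Z k)"
        by linarith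
      then show ?thesis unfolding cD[symmetric] by simp
    qed
    ultimately show ?thesis using that[of X' Y' "B A"] XY' B(1)[OF A(1,2)] by blast
  qed
qed

end

section \<open>Circuits and signed decompositions\<close>

context ends
begin

definition vset :: "'e set \<Rightarrow> 'v set" where
  "vset F = t ` F \<union> h ` F"

definition dg :: "'e set \<Rightarrow> 'v \<Rightarrow> nat" where
  "dg F v = card {e \<in> F. t e = v} + card {e \<in> F. h e = v}"

definition circuit_set :: "'e set \<Rightarrow> bool" where
  "circuit_set U \<longleftrightarrow> finite U \<and> U \<noteq> {} \<and> (\<forall>v. dg U v = 0 \<or> dg U v = 2) \<and>
     (\<forall>u\<in>vset U. \<forall>w\<in>vset U. con U u w)"

lemma finite_vset: "finite F \<Longrightarrow> finite (vset F)"
  by (simp add: vset_def)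

lemma vset_mono: "F \<subseteq> F' \<Longrightarrow> vset F \<subseteq> vset F'"
  by (auto simp: vset_def)

lemma dg_empty [simp]: "dg {} v = 0"
  by (simp add: dg_def)

lemma dg_singleton: "dg {e} v = of_bool (v = t e) + of_bool (v = h e)"
proof -
  have "{e' \<in> {e}. f e' = v} = (if v = f e then {e} else {})" for f :: "'e \<Rightarrow> 'v" by auto
  then show ?thesis by (simp add: dg_def)
qed

lemma dg_Un:
  assumes "finite A" "finite B" "A \<inter> B = {}"
  shows "dg (A \<union> B) v = dg A v + dg B v"
proof -
  have "card {e \<in> A \<union> B. f e = v} = card {e \<in> A. f e = v} + card {e \<in> B. f e = v}"
    for f :: "'e \<Rightarrow> 'v"
  proof -
    have "{e \<in> A \<union> B. f e = v} = {e \<in> A. f e = v} \<union> {e \<in> B. f e = v}" by auto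
    then show ?thesis using assms by (simp add: card_Un_disjoint disjoint_iff)
  qed
  then show ?thesis by (simp add: dg_def)
qed

lemma dg_mono: "finite B \<Longrightarrow> A \<subseteq> B \<Longrightarrow> dg A v \<le> dg B v"
  unfolding dg_def by (intro add_mono card_mono) auto

lemma dg_eq_0_iff: "finite F \<Longrightarrow> dg F v = 0 \<longleftrightarrow> v \<notin> vset F"
  by (auto simp: dg_def vset_def)

lemma odd_dg_iff: "finite F \<Longrightarrow> odd (dg F v) \<longleftrightarrow> odd (net F (\<lambda>e. 1) {v})"
proof -
  assume F: "finite F"
  have "(\<Sum>e\<in>F. of_bool (f e \<in> {v})) = int (card {e \<in> F. f e = v})" for f :: "'e \<Rightarrow> 'v"
    using F by (simp add: Int_def)
  then have "net F (\<lambda>e. 1) {v} = int (card {e \<in> F. t e = v}) - int (card {e \<in> F. h e = v})"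
    by (simp add: net_def sum_subtractf)
  then show ?thesis by (simp add: dg_def)
qed

text \<open>In the degree sum over \<open>S\<close> an edge inside \<open>S\<close> counts twice and
  a crossing edge once.\<close>

lemma par_dg:
  assumes "finite F" "finite V" "vset F \<subseteq> V"
  shows "par F S \<longleftrightarrow> odd (\<Sum>v\<in>S \<inter> V. dg F v)"
proof -
  have parity: "even (net F (\<lambda>e. 1) {v}) \<longleftrightarrow> even (dg F v)" for v
    using odd_dg_iff[OF assms(1), of v] by blast
  have "odd (\<Sum>v\<in>A. net F (\<lambda>e. 1) {v}) \<longleftrightarrow> odd (\<Sum>v\<in>A. dg F v)" if "finite A" for A
    using that by (induction A rule: finite_induct) (auto simp: parity)
  then show ?thesis
    using assms par_net[OF assms(1), of "\<lambda>e. 1" S] net_vertices[OF assms(2), of F "\<lambda>e. 1" S]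
    by (simp add: vset_def)
qed

lemma eulerian_if_even_dg: "finite F \<Longrightarrow> (\<And>v. even (dg F v)) \<Longrightarrow> eulerian F"
  unfolding eulerian_def using par_dg[OF _ finite_vset subset_refl] by (simp add: dvd_sum)

lemma eulerian_even_dg: "finite F \<Longrightarrow> eulerian F \<Longrightarrow> even (dg F v)"
  using odd_dg_iff[of F v] par_net[of F "\<lambda>e. 1" "{v}"] by (simp add: eulerian_def)

lemma circuit_set_eulerian: "circuit_set U \<Longrightarrow> eulerian U"
  unfolding circuit_set_def by (metis eulerian_if_even_dg even_zero even_two_times_div_two dvd_refl)

text \<open>At a vertex of \<open>Z\<close> the degree in \<open>Z\<close> is at least 2 and so
  exhausts the degree in \<open>U\<close>. Hence no edge of \<open>U\<close> leaves the vertices of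
  \<open>Z\<close>.\<close>

lemma circuit_set_minimal:
  assumes U: "circuit_set U" and Z: "Z \<subseteq> U" "eulerian Z" "Z \<noteq> {}"
  shows "Z = U"
proof -
  have fin: "finite U" "finite Z" using U Z(1) finite_subset by (auto simp: circuit_set_def)
  have mem: "e \<in> Z" if e: "e \<in> U" "v \<in> vset Z" "v \<in> {t e, h e}" for e v
  proof (rule ccontr)
    assume "e \<notin> Z"
    have "dg Z v \<noteq> 0" "even (dg Z v)"
      using dg_eq_0_iff[OF fin(2)] e(2) eulerian_even_dg[OF fin(2) Z(2)] by auto
    then have "2 \<le> dg Z v" by (simp add: dvd_imp_le)
    moreover have "dg (Z \<union> {e}) v = dg Z v + dg {e} v" using fin \<open>e \<notin> Z\<close> by (intro dg_Un) auto
    moreover have "1 \<le> dg {e} v" using e(3) by (auto simp: dg_singleton)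
    moreover have "dg (Z \<union> {e}) v \<le> dg U v" using Z(1) e(1) fin by (intro dg_mono) auto
    moreover have "dg U v \<le> 2" using U by (metis circuit_set_def le_refl zero_le)
    ultimately show False by linarith
  qed
  have "U \<inter> cut (vset Z) = {}"
  proof (rule equals0I)
    fix e assume "e \<in> U \<inter> cut (vset Z)"
    then have e: "e \<in> U" "(t e \<in> vset Z) \<noteq> (h e \<in> vset Z)" by (auto simp: cut_def)
    then have "e \<in> Z" using mem[OF e(1)] by blast
    then show False using e(2) by (auto simp: vset_def)
  qed
  moreover obtain z where z: "z \<in> vset Z" using Z(3) by (auto simp: vset_def)
  moreover have "con U z (t e)" if "e \<in> U" for e
    using U z vset_mono[OF Z(1)] that by (auto simp: circuit_set_def vset_def)
  ultimately have "t e \<in> vset Z" if "e \<in> U" for e using that unfolding con_def by blast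
  then show ?thesis using mem Z(1) by blast
qed

text \<open>
  \<open>ray R A B vs es\<close>: a path in \<open>R\<close>, built backwards from its last vertex, which is its only vertex
  in \<open>B\<close>; only its first vertex may lie in \<open>A\<close>.
\<close>

inductive ray :: "'e set \<Rightarrow> 'v set \<Rightarrow> 'v set \<Rightarrow> 'v list \<Rightarrow> 'e list \<Rightarrow> bool"
  for R A B where
  stop: "v \<in> B \<Longrightarrow> ray R A B [v] []"
| step: "ray R A B (v # vs) es \<Longrightarrow> e \<in> R \<Longrightarrow> {t e, h e} = {u, v} \<Longrightarrow> u \<notin> B \<Longrightarrow> v \<notin> A \<Longrightarrow>
    u \<notin> set (v # vs) \<Longrightarrow> ray R A B (u # v # vs) (e # es)"

text \<open>A path with ends \<open>a\<close>, \<open>b\<close> and vertex set \<open>W\<close>,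
  described by degrees so that pieces can be glued by addition. The two indicators stand for the
  missing half-edges at the ends; if \<open>a = b\<close>, they force the trivial path.\<close>

definition segment :: "'v \<Rightarrow> 'v \<Rightarrow> 'v set \<Rightarrow> 'e set \<Rightarrow> bool" where
  "segment a b W P \<longleftrightarrow> finite P \<and> finite W \<and> a \<in> W \<and> b \<in> W \<and> vset P \<subseteq> W \<and>
     (\<forall>v. dg P v + of_bool (v = a) + of_bool (v = b) = 2 * of_bool (v \<in> W)) \<and>
     (\<forall>x\<in>W. con P a x)"

lemma ray_suffix: "ray R A B vs es \<Longrightarrow> x \<in> set vs \<Longrightarrow> \<exists>vs es. ray R A B (x # vs) es"
proof (induction rule: ray.induct)
  case (stop v)
  then have "ray R A B [x] []" using ray.stop[of x B R A] by simp
  then show ?case by blast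
next
  case (step v vs es e u)
  then show ?case using ray.step[OF step.hyps] by (cases "x = u") auto
qed

text \<open>The set \<open>T\<close> of vertices where some ray starts contains \<open>B\<close>. If
  it missed \<open>A\<close>, an edge of \<open>R\<close> would enter \<open>T\<close> from outside
  and prolong a ray at its front.\<close>

lemma ray_exists:
  assumes "con R a b" "a \<in> A" "b \<in> B"
  obtains u vs es where "u \<in> A" "ray R A B (u # vs) es"
proof -
  define T where "T = {v. \<exists>vs es. ray R A B (v # vs) es}"
  have BT: "B \<subseteq> T" using ray.stop unfolding T_def by blast
  have "A \<inter> T \<noteq> {}"
  proof
    assume AT: "A \<inter> T = {}"
    then have "a \<notin> T" "b \<in> T" using assms BT by auto
    then obtain e where e: "e \<in> R" "e \<in> cut T" using con_sym[OF assms(1)] unfolding con_def by blast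
    then obtain u v where uv: "{t e, h e} = {u, v}" "v \<in> T" "u \<notin> T"
      unfolding cut_def by (cases "t e \<in> T") (auto simp: insert_commute)
    then obtain vs es where ray: "ray R A B (v # vs) es" unfolding T_def by blast
    have "u \<notin> set (v # vs)" using ray_suffix[OF ray, of u] uv(3) unfolding T_def by blast
    then have "ray R A B (u # v # vs) (e # es)"
      using ray.step[OF ray e(1) uv(1)] uv AT BT by blast
    then show False using uv(3) unfolding T_def by blast
  qed
  then show thesis using that unfolding T_def by blast
qed

lemma ray_path:
  assumes "ray R A B vs es"
  shows "distinct vs \<and> distinct es \<and> length vs = Suc (length es) \<and> set es \<subseteq> R \<and>
    set vs \<inter> B = {last vs} \<and> set vs \<inter> A \<subseteq> {hd vs} \<and> vset (set es) \<subseteq> set vs \<and>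
    (\<forall>i<length es. {t (es ! i), h (es ! i)} = {vs ! i, vs ! Suc i})"
  using assms
proof (induction rule: ray.induct)
  case (stop v)
  then show ?case by (auto simp: vset_def)
next
  case (step v vs es e u)
  have "e \<notin> set es" using step.IH step.hyps(3,6) by (auto simp: vset_def doubleton_eq_iff)
  moreover have "{t ((e # es) ! i), h ((e # es) ! i)} = {(u # v # vs) ! i, (u # v # vs) ! Suc i}"
    if "i < length (e # es)" for i
    using step.IH step.hyps(3) that by (cases i) auto
  ultimately show ?case using step by (auto simp: vset_def doubleton_eq_iff)
qed

lemma ray_segment:
  assumes "ray R A B vs es"
  shows "segment (hd vs) (last vs) (set vs) (set es)"
  using assms
proof (induction rule: ray.induct)
  case (stop v)
  then show ?case by (simp add: segment_def vset_def)
next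
  case (step v vs es e u)
  have IH: "segment v (last (v # vs)) (set (v # vs)) (set es)" using step.IH by simp
  have "e \<notin> set es" "vset (set es) \<subseteq> set (v # vs)"
    using ray_path[OF step.hyps(1)] step.hyps(3,6) by (auto simp: vset_def doubleton_eq_iff)
  then have dg: "dg (set (e # es)) x = dg (set es) x + of_bool (x = u) + of_bool (x = v)" for x
    using dg_Un[of "{e}" "set es" x] step.hyps(3,6) by (auto simp: dg_singleton doubleton_eq_iff)
  have "con {e} u v"
    using step.hyps(3) con_edge[of e "{e}"] con_sym[of "{e}" "t e" "h e"] by (auto simp: doubleton_eq_iff)
  then have uv: "con (set (e # es)) u v" by (rule con_mono) auto
  have "con (set (e # es)) u x" if "x \<in> set (u # v # vs)" for x
  proof (cases "x = u")
    case False
    then have "con (set es) v x" using IH that by (auto simp: segment_def)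
    then have "con (set (e # es)) v x" by (rule con_mono) auto
    then show ?thesis using con_trans[OF uv] by blast
  qed simp
  moreover have "vset (set (e # es)) \<subseteq> set (u # v # vs)"
    using IH step.hyps(3) by (auto simp: segment_def vset_def doubleton_eq_iff)
  moreover have "dg (set (e # es)) x + of_bool (x = u) + of_bool (x = last (v # vs))
      = 2 * of_bool (x \<in> set (u # v # vs))" for x
  proof -
    have "dg (set es) x + of_bool (x = v) + of_bool (x = last (v # vs)) = 2 * of_bool (x \<in> set (v # vs))"
      using IH unfolding segment_def by blast
    moreover have "of_bool (x \<in> set (u # v # vs)) = of_bool (x = u) + (of_bool (x \<in> set (v # vs)) :: nat)"
      using step.hyps(6) by auto
    ultimately show ?thesis unfolding dg by linarith
  qed
  ultimately show ?case by (simp add: segment_def)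
qed

lemma segment_joins:
  assumes "segment a b W P"
  shows "joins P a b"
  unfolding joins_def
proof
  fix S
  have P: "finite P" "finite W" "vset P \<subseteq> W" and ab: "a \<in> W" "b \<in> W"
    using assms by (auto simp: segment_def)
  have "(\<Sum>v\<in>S \<inter> W. dg P v + of_bool (v = a) + of_bool (v = b)) = (\<Sum>v\<in>S \<inter> W. 2 * of_bool (v \<in> W))"
    using assms by (intro sum.cong) (auto simp: segment_def)
  then have "even (\<Sum>v\<in>S \<inter> W. dg P v + of_bool (v = a) + of_bool (v = b))"
    by (simp add: sum_distrib_left[symmetric])
  moreover have "(\<Sum>v\<in>S \<inter> W. of_bool (v = c)) = (of_bool (c \<in> S) :: nat)" if "c \<in> W" for c
    using that P(2) by (auto simp: of_bool_def)
  ultimately show "par P S \<longleftrightarrow> (a \<in> S) \<noteq> (b \<in> S)"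
    using par_dg[OF P] ab by (auto simp: sum.distrib)
qed

lemma joins_nonempty: "joins P a b \<Longrightarrow> a \<noteq> b \<Longrightarrow> P \<noteq> {}"
  using joins_con[of P a b "{}"] by (auto simp: con_def)

lemma segment_circuit:
  assumes P: "segment a b W P" and P': "segment a b W' P'" and ab: "a \<noteq> b" "W \<inter> W' = {a, b}" "P \<inter> P' = {}"
  shows "circuit_set (P \<union> P')"
proof -
  have fin: "finite P" "finite P'" using P P' by (auto simp: segment_def)
  have "P \<noteq> {}" using joins_nonempty[OF segment_joins[OF P] ab(1)] .
  moreover have "dg (P \<union> P') v = 0 \<or> dg (P \<union> P') v = 2" for v
  proof -
    have "dg P v + of_bool (v = a) + of_bool (v = b) = 2 * of_bool (v \<in> W)"
      "dg P' v + of_bool (v = a) + of_bool (v = b) = 2 * of_bool (v \<in> W')"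
      using P P' unfolding segment_def by blast+
    moreover have "v \<in> W \<inter> W' \<longleftrightarrow> v = a \<or> v = b" using ab(2) by auto
    ultimately show ?thesis using dg_Un[OF fin ab(3)] ab(1) by (auto split: if_splits)
  qed
  moreover have "con (P \<union> P') u w" if "u \<in> vset (P \<union> P')" "w \<in> vset (P \<union> P')" for u w
  proof -
    have "con (P \<union> P') a x" if "x \<in> vset (P \<union> P')" for x
    proof -
      have "x \<in> W \<or> x \<in> W'" using that P P' by (auto simp: segment_def vset_def)
      then have "con P a x \<or> con P' a x" using P P' unfolding segment_def by blast
      then show ?thesis using con_mono[of P a x "P \<union> P'"] con_mono[of P' a x "P \<union> P'"] by auto
    qed
    then show ?thesis using con_trans[OF con_sym] that by metis
  qed
  ultimately show ?thesis using fin by (simp add: circuit_set_def)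
qed

text \<open>A path in \<open>Z - {e}\<close> between the ends of \<open>e\<close> is closed by
  \<open>e\<close>; for a loop the path is trivial.\<close>

lemma eulerian_circuit:
  assumes Z: "finite Z" "eulerian Z" "e \<in> Z"
  obtains U where "U \<subseteq> Z" "circuit_set U" "e \<in> U"
proof -
  obtain u vs es where "u \<in> {t e}" and ray0: "ray (Z - {e}) {t e} {h e} (u # vs) es"
    using ray_exists[OF eulerian_not_bridge[OF Z(2,3)], of "{t e}" "{h e}"] by blast
  define ws where "ws = t e # vs"
  have ray: "ray (Z - {e}) {t e} {h e} ws es" using ray0 \<open>u \<in> {t e}\<close> by (simp add: ws_def)
  have hdlast: "hd ws = t e" "last ws = h e" "set es \<subseteq> Z - {e}"
    using ray_path[OF ray] by (auto simp: ws_def)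
  have segment: "segment (t e) (h e) (set ws) (set es)" using ray_segment[OF ray] hdlast by simp
  define U where "U = set es \<union> {e}"
  have dg: "dg U v = 2 * of_bool (v \<in> set ws)" for v
  proof -
    have "dg U v = dg (set es) v + dg {e} v" unfolding U_def using hdlast(3) by (intro dg_Un) auto
    moreover have "dg (set es) v + of_bool (v = t e) + of_bool (v = h e) = 2 * of_bool (v \<in> set ws)"
      using segment unfolding segment_def by blast
    ultimately show ?thesis by (simp add: dg_singleton)
  qed
  have con: "con U (t e) x" if "x \<in> set ws" for x
    using segment that con_mono[of "set es" "t e" x U] by (auto simp: segment_def U_def)
  have "vset U \<subseteq> set ws" using dg dg_eq_0_iff[of U] by (auto simp: U_def)
  then have "con U u w" if "u \<in> vset U" "w \<in> vset U" for u w
    using con_trans[OF con_sym[OF con] con] that by blast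
  then have "circuit_set U" using dg by (simp add: circuit_set_def U_def)
  then show thesis using that[of U] hdlast(3) Z(3) by (auto simp: U_def)
qed

text \<open>
  The two circuits contain a theta graph, and one of the two circuits through its third path is
  balanced.
\<close>

lemma theta_balanced_circuit:
  assumes U: "circuit_set U" "odd (card (U \<inter> N))" and U': "circuit_set U'"
    and "U \<inter> U' = {}" "u \<noteq> w" "u \<in> vset U \<inter> vset U'" "w \<in> vset U \<inter> vset U'"
  obtains Q where "Q \<subseteq> U \<union> U'" "circuit_set Q" "even (card (Q \<inter> N))"
proof -
  have fin: "finite U" "finite U'" using U U' by (auto simp: circuit_set_def)
  have "con U' u w" using U' assms(6,7) by (auto simp: circuit_set_def)
  \<comment> \<open>A ray meets its starting set only in its first vertex, so this one is an ear of
    \<open>U\<close>: it leaves \<open>U\<close> at \<open>a\<close> and meets it again only in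
    \<open>w\<close>.\<close>
  then obtain a vs0 es3 where a: "a \<in> vset U - {w}" "ray U' (vset U - {w}) {w} (a # vs0) es3"
    using ray_exists[of U' u w "vset U - {w}" "{w}"] assms(5-7) by blast
  define vs3 where "vs3 = a # vs0"
  define P3 where "P3 = set es3"
  have ray3: "ray U' (vset U - {w}) {w} vs3 es3" using a(2) by (simp add: vs3_def)
  have arc3: "segment a w (set vs3) P3" and P3: "P3 \<subseteq> U'" and vs3: "set vs3 \<inter> vset U = {a, w}"
    using ray_segment[OF ray3] ray_path[OF ray3] a(1) assms(7) by (auto simp: P3_def vs3_def)
  have find: "\<exists>W P. segment a w W P \<and> P \<subseteq> F \<and> W \<subseteq> vset U" if "con F a w" "F \<subseteq> U" for F
  proof -
    from ray_exists[OF that(1), of "{a}" "{w}"]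
    obtain v vs es where "v \<in> {a}" and ray: "ray F {a} {w} (v # vs) es" by blast
    have "last (v # vs) \<in> {w}" using ray_path[OF ray] by blast
    then have segment: "segment a w (set (a # vs)) (set es)" and es: "set es \<subseteq> F"
      using ray_segment[OF ray] ray_path[OF ray] \<open>v \<in> {a}\<close> by auto
    have "set (a # vs) \<subseteq> vset U"
    proof
      fix x assume x: "x \<in> set (a # vs)"
      have "dg (set es) x + of_bool (x = a) + of_bool (x = w) = 2 * of_bool (x \<in> set (a # vs))"
        using segment unfolding segment_def by blast
      then have "x = a \<or> x = w \<or> dg (set es) x \<noteq> 0" using x by (cases "x = a"; cases "x = w"; simp)
      then show "x \<in> vset U"
        using a(1) assms(7) dg_eq_0_iff[of "set es" x] vset_mono[of "set es" U] es that(2) by auto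
    qed
    then show ?thesis using segment es by blast
  qed
  have "con U a w" using U(1) a(1) assms(7) by (auto simp: circuit_set_def)
  then obtain W1 P1 where P1: "segment a w W1 P1" "P1 \<subseteq> U" "W1 \<subseteq> vset U" using find by blast
  have "joins (U - P1) a w"
    using segment_joins[OF P1(1)] circuit_set_eulerian[OF U(1)] par_Diff[OF fin(1) P1(2)]
    by (simp add: joins_def eulerian_def)
  then have "con (U - P1) a w" using joins_con by blast
  then obtain W2 P2 where P2: "segment a w W2 P2" "P2 \<subseteq> U - P1" "W2 \<subseteq> vset U" using find by blast
  have finP: "finite P1" "finite P2" "finite P3" using P1(1) P2(1) arc3 by (auto simp: segment_def)
  have "P1 \<union> P2 = U"
  proof (rule circuit_set_minimal[OF U(1)])
    have "P1 \<inter> P2 = {}" using P2(2) by auto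
    then show "eulerian (P1 \<union> P2)"
      using par_Un[OF finP(1,2)] segment_joins[OF P1(1)] segment_joins[OF P2(1)]
      by (simp add: joins_def eulerian_def)
    show "P1 \<union> P2 \<noteq> {}" using joins_nonempty[OF segment_joins[OF P1(1)]] a(1) by blast
  qed (use P1(2) P2(2) in auto)
  then have U_N: "U \<inter> N = (P1 \<inter> N) \<union> (P2 \<inter> N)" by auto
  have "card (U \<inter> N) = card (P1 \<inter> N) + card (P2 \<inter> N)"
    unfolding U_N using finP P2(2) by (intro card_Un_disjoint) auto
  then have "even (card (P1 \<inter> N) + card (P3 \<inter> N)) \<or> even (card (P2 \<inter> N) + card (P3 \<inter> N))"
    using U(2) by auto
  moreover have "circuit_set (P \<union> P3) \<and> P \<union> P3 \<subseteq> U \<union> U' \<and>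
      card ((P \<union> P3) \<inter> N) = card (P \<inter> N) + card (P3 \<inter> N)"
    if "segment a w W P" "P \<subseteq> U" "W \<subseteq> vset U" for W P
  proof (intro conjI)
    have disj: "P \<inter> P3 = {}" using that(2) P3 assms(4) by auto
    have "a \<in> W" "w \<in> W" using that(1) by (auto simp: segment_def)
    then have "W \<inter> set vs3 = {a, w}" using vs3 that(3) by auto
    then show "circuit_set (P \<union> P3)" using segment_circuit[OF that(1) arc3] disj a(1) by auto
    show "P \<union> P3 \<subseteq> U \<union> U'" using that(2) P3 by auto
    show "card ((P \<union> P3) \<inter> N) = card (P \<inter> N) + card (P3 \<inter> N)"
      unfolding Int_Un_distrib2 using that(1) finP disj by (intro card_Un_disjoint) (auto simp: segment_def)
  qed
  then have "circuit_set (P1 \<union> P3) \<and> P1 \<union> P3 \<subseteq> U \<union> U' \<and>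
      card ((P1 \<union> P3) \<inter> N) = card (P1 \<inter> N) + card (P3 \<inter> N)"
    "circuit_set (P2 \<union> P3) \<and> P2 \<union> P3 \<subseteq> U \<union> U' \<and>
      card ((P2 \<union> P3) \<inter> N) = card (P2 \<inter> N) + card (P3 \<inter> N)"
    using P1 P2 by blast+
  ultimately show thesis using that by metis
qed

lemma circuit_decomposition:
  assumes "finite D" "eulerian D"
  obtains \<C> where "finite \<C>" "\<And>U. U \<in> \<C> \<Longrightarrow> circuit_set U" "pairwise disjnt \<C>" "\<Union>\<C> = D"
proof -
  have "\<exists>\<C>. finite \<C> \<and> (\<forall>U\<in>\<C>. circuit_set U) \<and> pairwise disjnt \<C> \<and> \<Union>\<C> = D"
    using assms
  proof (induction D rule: finite_psubset_induct)
    case (psubset D)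
    show ?case
    proof (cases "D = {}")
      case True
      then show ?thesis by (intro exI[of _ "{}"]) simp
    next
      case False
      then obtain U where U: "U \<subseteq> D" "circuit_set U"
        using eulerian_circuit[OF psubset.hyps psubset.prems] by blast
      then have sub: "D - U \<subset> D" by (auto simp: circuit_set_def)
      have "eulerian (D - U)"
        using eulerian_Diff[OF psubset.hyps U(1) psubset.prems circuit_set_eulerian[OF U(2)]] .
      from psubset.IH[OF sub this] obtain \<C> where \<C>: "finite \<C>" "\<forall>U\<in>\<C>. circuit_set U"
        "pairwise disjnt \<C>" "\<Union>\<C> = D - U" by blast
      have "disjnt U U'" if "U' \<in> \<C>" for U' using that \<C>(4) by (auto simp: disjnt_def)
      then have "pairwise disjnt (insert U \<C>)"
        using \<C>(3) by (auto simp: pairwise_insert disjnt_sym)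
      moreover have "\<Union>(insert U \<C>) = D" using \<C>(4) U(1) by auto
      ultimately show ?thesis using \<C>(1,2) U(2) by (intro exI[of _ "insert U \<C>"]) auto
    qed
  qed
  then show thesis using that by blast
qed

text \<open>Balanced circuits are split off while there are any. In what remains no circuit is
  balanced, so by \<open>theta_balanced_circuit\<close> two circuits of any decomposition share at
  most one vertex, as needed for barbells.\<close>

lemma signed_decomposition:
  assumes "finite D" "eulerian D"
  obtains \<B> \<U> where "finite (\<B> \<union> \<U>)" "\<And>U. U \<in> \<B> \<union> \<U> \<Longrightarrow> circuit_set U"
    "\<And>U. U \<in> \<B> \<Longrightarrow> even (card (U \<inter> N))" "\<And>U. U \<in> \<U> \<Longrightarrow> odd (card (U \<inter> N))"
    "pairwise disjnt (\<B> \<union> \<U>)" "\<Union>(\<B> \<union> \<U>) = D"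
    "\<And>U U' u w. U \<in> \<U> \<Longrightarrow> U' \<in> \<U> \<Longrightarrow> U \<noteq> U' \<Longrightarrow> u \<in> vset U \<inter> vset U' \<Longrightarrow>
      w \<in> vset U \<inter> vset U' \<Longrightarrow> u = w"
proof -
  define good where "good = (\<lambda>D \<B> \<U>. finite (\<B> \<union> \<U>) \<and> (\<forall>U\<in>\<B> \<union> \<U>. circuit_set U) \<and>
    (\<forall>U\<in>\<B>. even (card (U \<inter> N))) \<and> (\<forall>U\<in>\<U>. odd (card (U \<inter> N))) \<and>
    pairwise disjnt (\<B> \<union> \<U>) \<and> \<Union>(\<B> \<union> \<U>) = D \<and>
    (\<forall>U\<in>\<U>. \<forall>U'\<in>\<U>. U \<noteq> U' \<longrightarrow> (\<forall>u\<in>vset U \<inter> vset U'. \<forall>w\<in>vset U \<inter> vset U'. u = w)))"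
  have "\<exists>\<B> \<U>. good D \<B> \<U>"
    using assms
  proof (induction D rule: finite_psubset_induct)
    case (psubset D)
    show ?case
    proof (cases "\<exists>Q\<subseteq>D. circuit_set Q \<and> even (card (Q \<inter> N))")
      case True
      then obtain Q where Q: "Q \<subseteq> D" "circuit_set Q" "even (card (Q \<inter> N))" by blast
      then have sub: "D - Q \<subset> D" by (auto simp: circuit_set_def)
      have "eulerian (D - Q)"
        using eulerian_Diff[OF psubset.hyps Q(1) psubset.prems circuit_set_eulerian[OF Q(2)]] .
      from psubset.IH[OF sub this] obtain \<B> \<U> where BU: "good (D - Q) \<B> \<U>" by blast
      then have disj: "\<And>U. U \<in> \<B> \<union> \<U> \<Longrightarrow> disjnt Q U" by (auto simp: good_def disjnt_def)
      then have "pairwise disjnt (insert Q (\<B> \<union> \<U>))"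
        using BU unfolding pairwise_insert good_def by (auto simp: disjnt_sym)
      then have "good D (insert Q \<B>) \<U>" using BU Q unfolding good_def by auto
      then show ?thesis by blast
    next
      case False
      obtain \<C> where \<C>: "finite \<C>" "\<And>U. U \<in> \<C> \<Longrightarrow> circuit_set U" "pairwise disjnt \<C>" "\<Union>\<C> = D"
        using circuit_decomposition[OF psubset.hyps psubset.prems] by blast
      have odd: "odd (card (U \<inter> N))" if "U \<in> \<C>" for U using False \<C>(2)[OF that] \<C>(4) that by blast
      have "u = w" if "U \<in> \<C>" "U' \<in> \<C>" "U \<noteq> U'" "u \<in> vset U \<inter> vset U'" "w \<in> vset U \<inter> vset U'"
        for U U' u w
      proof (rule ccontr)
        assume "u \<noteq> w"
        moreover have "U \<inter> U' = {}" using \<C>(3) that(1-3) by (auto simp: pairwise_def disjnt_def)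
        ultimately have "\<exists>Q\<subseteq>U \<union> U'. circuit_set Q \<and> even (card (Q \<inter> N))"
          using theta_balanced_circuit[OF \<C>(2)[OF that(1)] odd[OF that(1)] \<C>(2)[OF that(2)], of u w]
            that(4,5) by metis
        then obtain Q where "Q \<subseteq> U \<union> U'" "circuit_set Q" "even (card (Q \<inter> N))" by blast
        moreover have "U \<union> U' \<subseteq> D" using \<C>(4) that by blast
        ultimately show False using False by blast
      qed
      then have "good D {} \<C>" unfolding good_def using \<C> odd by simp
      then show ?thesis by blast
    qed
  qed
  then obtain \<B> \<U> where "good D \<B> \<U>" by blast
  note * = this[unfolded good_def]
  show thesis
  proof (rule that[of \<B> \<U>])
    show "u = w" if "U \<in> \<U>" "U' \<in> \<U>" "U \<noteq> U'" "u \<in> vset U \<inter> vset U'"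
      "w \<in> vset U \<inter> vset U'" for U U' u w
      using * that by metis
  qed (use * in simp_all)
qed

end

section \<open>Joins and barbells\<close>

lemma card_Collect_remove_pair:
  assumes "finite I" "i \<in> I" "j \<in> I" "i \<noteq> j"
  shows "card {l \<in> I. Q l} = card {l \<in> I - {i, j}. Q l} + of_bool (Q i) + of_bool (Q j)"
proof -
  have "{l \<in> I. Q l} = {l \<in> I - {i, j}. Q l} \<union> {l \<in> {i, j}. Q l}" using assms by auto
  moreover have "card ({l \<in> I - {i, j}. Q l} \<union> {l \<in> {i, j}. Q l}) =
      card {l \<in> I - {i, j}. Q l} + card {l \<in> {i, j}. Q l}"
    using assms by (intro card_Un_disjoint) auto
  moreover have "{l \<in> {i, j}. Q l} = (if Q i then {i} else {}) \<union> (if Q j then {j} else {})" by auto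
  ultimately show ?thesis using assms(4) by auto
qed

context ends
begin

text \<open>
  An edge of \<open>P\<close> lies in exactly half of the sums of \<open>J\<close> with a member of the cycle space of \<open>F\<close>.
\<close>

lemma half_average:
  assumes F: "finite F" and P: "\<And>e. e \<in> P \<Longrightarrow> \<exists>Z\<subseteq>F. eulerian Z \<and> e \<in> Z" and J: "finite J"
  obtains Z where "Z \<subseteq> F" "eulerian Z" "2 * card (sym_diff J Z \<inter> P) \<le> card P"
proof -
  define \<Z> where "\<Z> = {Z. Z \<subseteq> F \<and> eulerian Z}"
  have fin: "finite \<Z>" "\<And>Z. Z \<in> \<Z> \<Longrightarrow> finite Z"
    using F finite_subset by (auto simp: \<Z>_def)
  have "P \<subseteq> F" using P by blast
  then have finP: "finite P" using F finite_subset by blast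
  have half: "2 * card {Z \<in> \<Z>. e \<in> sym_diff J Z} = card \<Z>" if e: "e \<in> P" for e
  proof -
    obtain Y where Y: "Y \<in> \<Z>" "e \<in> Y" using P[OF e] by (auto simp: \<Z>_def)
    have closed: "sym_diff Z Y \<in> \<Z>" if "Z \<in> \<Z>" for Z
      using that Y(1) fin(2) eulerian_sym_diff[of Z Y] by (auto simp: \<Z>_def)
    have invol: "sym_diff (sym_diff Z Y) Y = Z" for Z :: "'e set" by blast
    \<comment> \<open>Adding a fixed member \<open>Y\<close> through \<open>e\<close> exchanges the
      sums that contain \<open>e\<close> with those that do not.\<close>
    have "bij_betw (\<lambda>Z. sym_diff Z Y) {Z \<in> \<Z>. e \<in> sym_diff J Z} {Z \<in> \<Z>. e \<notin> sym_diff J Z}"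
      by (rule bij_betw_byWitness[where f' = "\<lambda>Z. sym_diff Z Y"]) (use closed invol Y(2) in auto)
    then have "card {Z \<in> \<Z>. e \<in> sym_diff J Z} = card {Z \<in> \<Z>. e \<notin> sym_diff J Z}"
      by (rule bij_betw_same_card)
    moreover have "card \<Z> = card {Z \<in> \<Z>. e \<in> sym_diff J Z} + card {Z \<in> \<Z>. e \<notin> sym_diff J Z}"
      using fin(1) by (subst card_Un_disjoint[symmetric]) (auto intro: arg_cong[where f = card])
    ultimately show ?thesis by simp
  qed
  have "\<exists>Z\<in>\<Z>. 2 * card (sym_diff J Z \<inter> P) \<le> card P"
  proof (rule ccontr)
    assume "\<not> ?thesis"
    then have gt: "card P < 2 * card (sym_diff J Z \<inter> P)" if "Z \<in> \<Z>" for Z using that by auto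
    have "{} \<in> \<Z>" by (simp add: \<Z>_def)
    then have "(\<Sum>Z\<in>\<Z>. card P) < (\<Sum>Z\<in>\<Z>. 2 * card (sym_diff J Z \<inter> P))"
      using fin(1) gt by (intro sum_strict_mono) auto
    also have "\<dots> = (\<Sum>Z\<in>\<Z>. 2 * (\<Sum>e\<in>P. of_bool (e \<in> sym_diff J Z)))"
    proof (intro sum.cong refl arg_cong[where f = "\<lambda>n. 2 * n"])
      fix Z
      show "card (sym_diff J Z \<inter> P) = (\<Sum>e\<in>P. of_bool (e \<in> sym_diff J Z))"
        using card_eq_sum_of_bool[OF finP, of "sym_diff J Z \<inter> P"] by simp
    qed
    also have "\<dots> = (\<Sum>e\<in>P. 2 * (\<Sum>Z\<in>\<Z>. of_bool (e \<in> sym_diff J Z)))"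
      unfolding sum_distrib_left by (rule sum.swap)
    also have "\<dots> = (\<Sum>e\<in>P. card \<Z>)"
    proof (intro sum.cong refl)
      fix e assume "e \<in> P"
      have "(\<Sum>Z\<in>\<Z>. of_bool (e \<in> sym_diff J Z)) = card {Z \<in> \<Z>. e \<in> sym_diff J Z}"
        unfolding card_eq_sum_of_bool[OF fin(1) Collect_restrict] by (intro sum.cong) auto
      then show "2 * (\<Sum>Z\<in>\<Z>. of_bool (e \<in> sym_diff J Z)) = card \<Z>" using half[OF \<open>e \<in> P\<close>] by simp
    qed
    finally show False by (simp add: mult.commute)
  qed
  then show thesis using that by (auto simp: \<Z>_def)
qed

text \<open>A T-join with indexed terminals: base points of different circuits may coincide, and
  such terminals are counted separately.\<close>

definition tjoin :: "'e set \<Rightarrow> 'i set \<Rightarrow> ('i \<Rightarrow> 'v) \<Rightarrow> bool" where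
  "tjoin J I x \<longleftrightarrow> (\<forall>S. par J S \<longleftrightarrow> odd (card {i \<in> I. x i \<in> S}))"

lemma even_card_other:
  assumes "even (card {j \<in> I. Q j})" "i \<in> I" "Q i"
  shows "\<exists>j\<in>I. j \<noteq> i \<and> Q j"
proof -
  have "{j \<in> I. Q j} \<noteq> {i}" using assms(1) by auto
  then show ?thesis using assms(2,3) by blast
qed

lemma tjoin_exists:
  assumes F: "finite F" and I: "finite I"
    and "\<And>i. i \<in> I \<Longrightarrow> even (card {j \<in> I. x j \<in> component F (x i)})"
  shows "\<exists>J\<subseteq>F. tjoin J I x"
  using I assms(3)
proof (induction I rule: finite_psubset_induct)
  case (psubset I)
  show ?case
  proof (cases "I = {}")
    case True
    then show ?thesis by (intro exI[of _ "{}"]) (simp add: tjoin_def)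
  next
    case False
    then obtain i where i: "i \<in> I" by blast
    obtain j where j: "j \<in> I" "j \<noteq> i" "x j \<in> component F (x i)"
      using even_card_other[OF psubset.prems[OF i] i self_in_component] by blast
    then have con: "con F (x i) (x j)" by (simp add: component_def)
    obtain R where R: "R \<subseteq> F" "joins R (x i) (x j)" by (rule con_joins[OF con F]) (rule that)
    have card: "card {l \<in> I. Q l} = card {l \<in> I - {i, j}. Q l} + of_bool (Q i) + of_bool (Q j)" for Q
      using card_Collect_remove_pair[of I i j Q] psubset.hyps i j by auto
    define I' where "I' = I - {i, j}"
    have even: "even (card {l \<in> I'. x l \<in> component F (x k)})" if k: "k \<in> I'" for k
    proof -
      have "x i \<in> component F (x k) \<longleftrightarrow> x j \<in> component F (x k)"
        using con_trans[OF _ con] con_trans[OF _ con_sym[OF con]] by (auto simp: component_def)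
      moreover have "even (card {l \<in> I. x l \<in> component F (x k)})"
        using psubset.prems k by (simp add: I'_def)
      ultimately show ?thesis unfolding card I'_def by (cases "x i \<in> component F (x k)") simp_all
    qed
    have "I' \<subset> I" using i by (auto simp: I'_def)
    from psubset.IH[OF this even] obtain J where J: "J \<subseteq> F" "tjoin J I' x" by blast
    have fin: "finite J" "finite R" using J(1) R(1) F finite_subset by auto
    have "tjoin (sym_diff J R) I x"
      unfolding tjoin_def
    proof
      fix S
      show "par (sym_diff J R) S \<longleftrightarrow> odd (card {i \<in> I. x i \<in> S})"
        using J(2) R(2) unfolding card par_sym_diff[OF fin] tjoin_def joins_def I'_def by auto
    qed
    moreover have "sym_diff J R \<subseteq> F" using J(1) R(1) by blast
    ultimately show ?thesis by blast
  qed
qed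

text \<open>A perfect matching of the terminals along joins taken out of \<open>J\<close> one after
  the other, so that their sizes add up to at most that of \<open>J\<close>. An odd set of indices
  is no union of pairs, hence some pair is split by it; this is what later covers the
  bridges.\<close>

lemma tjoin_pairing:
  fixes c :: "'i \<Rightarrow> nat"
  assumes I: "finite I" and "finite J" "tjoin J I x"
  shows "\<exists>M. (\<forall>(i, j, R)\<in>set M. i \<in> I \<and> j \<in> I \<and> i \<noteq> j \<and> R \<subseteq> J \<and> joins R (x i) (x j)) \<and>
    (\<Sum>(i, j, R)\<leftarrow>M. c i + c j + card R) \<le> (\<Sum>i\<in>I. c i) + card J \<and>
    (\<forall>Q. odd (card {i \<in> I. Q i}) \<longrightarrow> (\<exists>(i, j, R)\<in>set M. Q i \<noteq> Q j)) \<and>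
    (\<forall>l\<in>I. \<exists>(i, j, R)\<in>set M. l = i \<or> l = j)"
  using I assms(2,3)
proof (induction I arbitrary: J rule: finite_psubset_induct)
  case (psubset I)
  show ?case
  proof (cases "I = {}")
    case True
    then show ?thesis by (intro exI[of _ "[]"]) simp
  next
    case False
    then obtain i where i: "i \<in> I" by blast
    \<comment> \<open>No edge of \<open>J\<close> crosses a component of \<open>J\<close>, so each
      contains evenly many terminals and \<open>i\<close> has a partner.\<close>
    have "\<not> par J (component J (x i))" by (simp add: par_def)
    then have "even (card {j \<in> I. x j \<in> component J (x i)})"
      using psubset.prems(2) by (simp add: tjoin_def)
    then obtain j where j: "j \<in> I" "j \<noteq> i" "x j \<in> component J (x i)"
      using even_card_other[of I "\<lambda>j. x j \<in> component J (x i)" i] i by auto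
    then have con: "con J (x i) (x j)" by (simp add: component_def)
    obtain R where R: "R \<subseteq> J" "joins R (x i) (x j)"
      by (rule con_joins[OF con psubset.prems(1)]) (rule that)
    have card: "card {l \<in> I. Q l} = card {l \<in> I - {i, j}. Q l} + of_bool (Q i) + of_bool (Q j)" for Q
      using card_Collect_remove_pair[of I i j Q] psubset.hyps i j by auto
    define I' where "I' = I - {i, j}"
    have tj: "tjoin (J - R) I' x"
      unfolding tjoin_def
    proof
      fix S
      have "card {l \<in> I. x l \<in> S} = card {l \<in> I'. x l \<in> S} + of_bool (x i \<in> S) + of_bool (x j \<in> S)"
        unfolding I'_def by (rule card)
      moreover have "par J S \<longleftrightarrow> odd (card {l \<in> I. x l \<in> S})"
        "par R S \<longleftrightarrow> (x i \<in> S) \<noteq> (x j \<in> S)"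
        using psubset.prems(2) R(2) by (simp_all add: tjoin_def joins_def)
      ultimately show "par (J - R) S \<longleftrightarrow> odd (card {l \<in> I'. x l \<in> S})"
        unfolding par_Diff[OF psubset.prems(1) R(1)] by auto
    qed
    have "I' \<subset> I" "finite (J - R)" using i psubset.prems(1) by (auto simp: I'_def)
    from psubset.IH[OF this tj] obtain M where
      M: "\<forall>(i, j, R')\<in>set M. i \<in> I' \<and> j \<in> I' \<and> i \<noteq> j \<and> R' \<subseteq> J - R \<and> joins R' (x i) (x j)"
      "(\<Sum>(i, j, R)\<leftarrow>M. c i + c j + card R) \<le> (\<Sum>i\<in>I'. c i) + card (J - R)"
      "\<forall>Q. odd (card {i \<in> I'. Q i}) \<longrightarrow> (\<exists>(i, j, R)\<in>set M. Q i \<noteq> Q j)"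
      "\<forall>l\<in>I'. \<exists>(i, j, R)\<in>set M. l = i \<or> l = j" by auto
    show ?thesis
    proof (intro exI[of _ "(i, j, R) # M"] conjI allI impI)
      show "\<forall>(i, j, R)\<in>set ((i, j, R) # M). i \<in> I \<and> j \<in> I \<and> i \<noteq> j \<and> R \<subseteq> J \<and> joins R (x i) (x j)"
        using M(1) R i j by (auto simp: I'_def)
      have "(\<Sum>i\<in>I. c i) = (\<Sum>i\<in>I'. c i) + c i + c j"
        using i j psubset.hyps by (simp add: I'_def sum.remove[of I i] sum.remove[of "I - {i}" j]
            Diff_insert[symmetric] insert_commute)
      moreover have "card J = card (J - R) + card R"
        using R(1) psubset.prems(1) finite_subset[OF R(1)]
        by (metis card_Diff_subset card_mono le_add_diff_inverse2)
      ultimately show "(\<Sum>(i, j, R)\<leftarrow>(i, j, R) # M. c i + c j + card R) \<le> (\<Sum>i\<in>I. c i) + card J"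
        using M(2) by simp
      show "\<exists>(i, j, R)\<in>set ((i, j, R) # M). Q i \<noteq> Q j" if "odd (card {i \<in> I. Q i})" for Q
      proof (cases "Q i = Q j")
        case True
        then have "odd (card {i \<in> I'. Q i})" using that unfolding card I'_def by (cases "Q j") simp_all
        then show ?thesis using M(3) by auto
      qed simp
      show "\<forall>l\<in>I. \<exists>(i, j, R)\<in>set ((i, j, R) # M). l = i \<or> l = j"
        using M(4) by (auto simp: I'_def)
    qed
  qed
qed

definition barbell :: "'e set \<Rightarrow> 'e set \<Rightarrow> bool" where
  "barbell N F \<longleftrightarrow> (\<exists>U U'. circuit_set U \<and> circuit_set U' \<and> odd (card (U \<inter> N)) \<and> odd (card (U' \<inter> N)) \<and>
     U \<inter> U' = {} \<and>
     ((\<exists>v. vset U \<inter> vset U' = {v}) \<and> F = U \<union> U' \<or>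
      vset U \<inter> vset U' = {} \<and> (\<exists>vs es. distinct vs \<and> distinct es \<and> length vs = Suc (length es) \<and>
        (\<forall>i<length es. {t (es ! i), h (es ! i)} = {vs ! i, vs ! Suc i}) \<and>
        set vs \<inter> vset U = {hd vs} \<and> set vs \<inter> vset U' = {last vs} \<and> F = U \<union> U' \<union> set es)))"

text \<open>If the circuits are disjoint, the join yields a path that meets each of them once.
  Connectedness of \<open>x\<close> and \<open>x'\<close> is recorded because it makes the barbell
  cross every cut that separates the two base points.\<close>

lemma barbell_exists:
  assumes U: "circuit_set U" "circuit_set U'" "odd (card (U \<inter> N))" "odd (card (U' \<inter> N))" "U \<inter> U' = {}"
    and share: "\<And>u w. u \<in> vset U \<inter> vset U' \<Longrightarrow> w \<in> vset U \<inter> vset U' \<Longrightarrow> u = w"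
    and R: "joins R x x'" and x: "x \<in> vset U" "x' \<in> vset U'"
  shows "\<exists>F. barbell N F \<and> U \<union> U' \<subseteq> F \<and> F \<subseteq> U \<union> U' \<union> R \<and> con F x x'"
proof (cases "vset U \<inter> vset U' = {}")
  case True
  obtain u vs0 es where u: "u \<in> vset U" "ray R (vset U) (vset U') (u # vs0) es"
    using ray_exists[OF joins_con[OF R subset_refl] x] by metis
  define vs where "vs = u # vs0"
  have ray: "ray R (vset U) (vset U') vs es" and u_vs: "u = hd vs" "u \<in> set vs"
    using u(2) by (simp_all add: vs_def)
  note path = ray_path[OF ray]
  define F where "F = U \<union> U' \<union> set es"
  have hdlast: "set vs \<inter> vset U = {hd vs}" "set vs \<inter> vset U' = {last vs}" using path u u_vs by auto
  have "con U x u" "con U' (last vs) x'"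
    using U(1,2) x u(1) hdlast(2) by (auto simp: circuit_set_def)
  moreover have "con (set es) u (last vs)"
    using segment_def ray_segment[OF ray] u_vs(1) by blast
  ultimately have "con F x u" "con F u (last vs)" "con F (last vs) x'"
    using con_mono[of _ _ _ F] by (auto simp: F_def)
  then have "con F x x'" using con_trans by metis
  moreover have "barbell N F"
    unfolding barbell_def F_def using U True path hdlast by blast
  moreover have "F \<subseteq> U \<union> U' \<union> R" "U \<union> U' \<subseteq> F" using path by (auto simp: F_def)
  ultimately show ?thesis by blast
next
  case False
  then obtain v where v: "v \<in> vset U" "v \<in> vset U'" by blast
  then have "vset U \<inter> vset U' = {v}" using share by blast
  then have "barbell N (U \<union> U')" unfolding barbell_def using U by blast
  moreover have "con U x v" "con U' v x'" using U(1,2) x v by (auto simp: circuit_set_def)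
  then have "con (U \<union> U') x x'"
    using con_trans[OF con_mono[of U x v "U \<union> U'"] con_mono[of U' v x' "U \<union> U'"]] by simp
  ultimately show ?thesis by blast
qed

section \<open>Covering an Eulerian set by balanced circuits and barbells\<close>

definition scircuit :: "'e set \<Rightarrow> 'e set \<Rightarrow> bool" where
  "scircuit N F \<longleftrightarrow> circuit_set F \<and> even (card (F \<inter> N)) \<or> barbell N F"

lemma circuit_inside:
  assumes "circuit_set U" "U \<inter> cut S = {}" "x \<in> vset U"
  shows "U \<subseteq> (if x \<in> S then inside S else - inside S)"
proof -
  have "v \<in> S \<longleftrightarrow> x \<in> S" if "v \<in> vset U" for v
  proof -
    have "con U x v" "con U v x" using assms that by (auto simp: circuit_set_def)
    then show ?thesis using assms(2) unfolding con_def by blast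
  qed
  then show ?thesis by (auto simp: vset_def inside_def)
qed

text \<open>As \<open>D\<close> does not cross \<open>S\<close>, each circuit is entirely inside or
  entirely outside. Modulo 2 a balanced one contributes nothing and an unbalanced one inside
  contributes 1.\<close>

lemma odd_unbalanced_inside:
  assumes fin: "finite (\<B> \<union> \<U>)" and circ: "\<And>U. U \<in> \<B> \<union> \<U> \<Longrightarrow> circuit_set U"
    and even: "\<And>U. U \<in> \<B> \<Longrightarrow> even (card (U \<inter> N))" and odd: "\<And>U. U \<in> \<U> \<Longrightarrow> odd (card (U \<inter> N))"
    and disj: "pairwise disjnt (\<B> \<union> \<U>)" and D: "\<Union>(\<B> \<union> \<U>) = D"
    and x: "\<And>U. U \<in> \<U> \<Longrightarrow> x U \<in> vset U" and S: "D \<inter> cut S = {}"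
  shows "odd (card (D \<inter> N \<inter> inside S)) \<longleftrightarrow> odd (card {U \<in> \<U>. x U \<in> S})"
proof -
  define f where "f = (\<lambda>U. card (U \<inter> N \<inter> inside S))"
  have "\<B> \<inter> \<U> = {}" using even odd by blast
  have "D \<inter> N \<inter> inside S = (\<Union>U\<in>\<B> \<union> \<U>. U \<inter> N \<inter> inside S)" using D by blast
  moreover have "card (\<Union>U\<in>\<B> \<union> \<U>. U \<inter> N \<inter> inside S) = (\<Sum>U\<in>\<B> \<union> \<U>. f U)"
    unfolding f_def
  proof (rule card_UN_disjoint[OF fin])
    show "\<forall>U\<in>\<B> \<union> \<U>. finite (U \<inter> N \<inter> inside S)" using circ by (auto simp: circuit_set_def)
    show "\<forall>U\<in>\<B> \<union> \<U>. \<forall>U'\<in>\<B> \<union> \<U>. U \<noteq> U' \<longrightarrow> U \<inter> N \<inter> inside S \<inter> (U' \<inter> N \<inter> inside S) = {}"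
      using disj unfolding pairwise_def disjnt_def by blast
  qed
  ultimately have "card (D \<inter> N \<inter> inside S) = (\<Sum>U\<in>\<B>. f U) + (\<Sum>U\<in>\<U>. f U)"
    using fin \<open>\<B> \<inter> \<U> = {}\<close> by (simp add: sum.union_disjoint)
  moreover have "even (\<Sum>U\<in>\<B>. f U)"
  proof (rule dvd_sum)
    fix U assume U: "U \<in> \<B>"
    have "U \<noteq> {}" using circ[of U] U by (auto simp: circuit_set_def)
    then obtain v where "v \<in> vset U" by (auto simp: vset_def)
    moreover have "U \<inter> cut S = {}" using S D U by blast
    ultimately have "U \<subseteq> inside S \<or> U \<inter> inside S = {}"
      using circuit_inside[of U S v] circ[of U] U by (auto split: if_splits)
    then have "U \<inter> N \<inter> inside S = U \<inter> N \<or> U \<inter> N \<inter> inside S = {}" by blast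
    then show "even (f U)" using even[OF U] by (auto simp: f_def)
  qed
  moreover have "even (f U) \<longleftrightarrow> x U \<notin> S" if U: "U \<in> \<U>" for U
  proof -
    have "U \<inter> cut S = {}" using S D U by blast
    then have "U \<subseteq> (if x U \<in> S then inside S else - inside S)"
      using circuit_inside[of U S "x U"] circ[of U] x[OF U] U by auto
    then have "U \<inter> N \<inter> inside S = (if x U \<in> S then U \<inter> N else {})" by (auto split: if_splits)
    then show ?thesis using odd[OF U] by (auto simp: f_def)
  qed
  then have "{U \<in> \<U>. odd (f U)} = {U \<in> \<U>. x U \<in> S}" by auto
  then have "even (\<Sum>U\<in>\<U>. f U) \<longleftrightarrow> even (card {U \<in> \<U>. x U \<in> S})"
    using even_sum_iff[of \<U> f] fin by simp
  ultimately show ?thesis by simp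
qed

text \<open>
  The unbalanced circuits of a decomposition of \<open>D\<close> are paired up along a join \<open>J\<close> of their base
  points, which uses at most half of the edges of \<open>P\<close>.
\<close>

lemma barbell_cover:
  assumes D: "finite D" "eulerian D" and F: "finite F" and P: "P \<subseteq> F"
    and nonbridge: "\<And>e. e \<in> P \<Longrightarrow> \<exists>Z\<subseteq>F. eulerian Z \<and> e \<in> Z"
    and closed: "\<And>v. D \<inter> cut (component F v) = {}"
    and balanced: "\<And>v. even (card (D \<inter> N \<inter> inside (component F v)))"
  obtains \<F> where "\<And>A. A \<in> set \<F> \<Longrightarrow> scircuit N A \<and> A \<subseteq> D \<union> F" "D \<subseteq> \<Union>(set \<F>)"
    "2 * (\<Sum>A\<leftarrow>\<F>. card A) \<le> 2 * card D + 2 * card (F - P) + card P"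
    "\<And>S b. (D \<union> F) \<inter> cut S = {b} \<Longrightarrow> odd (card (D \<inter> N \<inter> inside S)) \<Longrightarrow> b \<in> \<Union>(set \<F>)"
proof -
  obtain \<B> \<U> where fin: "finite (\<B> \<union> \<U>)" and circ: "\<And>U. U \<in> \<B> \<union> \<U> \<Longrightarrow> circuit_set U"
    and even: "\<And>U. U \<in> \<B> \<Longrightarrow> even (card (U \<inter> N))" and odd: "\<And>U. U \<in> \<U> \<Longrightarrow> odd (card (U \<inter> N))"
    and disj: "pairwise disjnt (\<B> \<union> \<U>)" and UD: "\<Union>(\<B> \<union> \<U>) = D"
    and share: "\<And>U U' u w. U \<in> \<U> \<Longrightarrow> U' \<in> \<U> \<Longrightarrow> U \<noteq> U' \<Longrightarrow> u \<in> vset U \<inter> vset U' \<Longrightarrow>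
      w \<in> vset U \<inter> vset U' \<Longrightarrow> u = w"
    by (rule signed_decomposition[OF D, of N]) (rule that)
  define x where "x = (\<lambda>U. SOME v. v \<in> vset U)"
  have x: "x U \<in> vset U" if "U \<in> \<U>" for U
  proof -
    have "U \<noteq> {}" using circ[of U] that by (auto simp: circuit_set_def)
    then obtain v where "v \<in> vset U" by (auto simp: vset_def)
    then show ?thesis unfolding x_def by (rule someI)
  qed
  have count: "odd (card (D \<inter> N \<inter> inside S)) \<longleftrightarrow> odd (card {U \<in> \<U>. x U \<in> S})"
    if "D \<inter> cut S = {}" for S
    by (rule odd_unbalanced_inside[OF fin circ even odd disj UD x that])
  have finU: "finite \<U>" using fin by simp
  have "even (card {U' \<in> \<U>. x U' \<in> component F (x U)})" for U
    using count[OF closed, of "x U"] balanced by blast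
  then obtain J0 where J0: "J0 \<subseteq> F" "tjoin J0 \<U> x"
    using tjoin_exists[OF F finU] by blast
  have finJ0: "finite J0" using J0(1) F finite_subset by blast
  obtain Z where Z: "Z \<subseteq> F" "eulerian Z" "2 * card (sym_diff J0 Z \<inter> P) \<le> card P"
    by (rule half_average[of F P J0, OF F nonbridge finJ0]) (assumption, rule that)
  define J where "J = sym_diff J0 Z"
  have finZ: "finite Z" using Z(1) F finite_subset by blast
  have J: "J \<subseteq> F" "finite J" using J0(1) Z(1) finJ0 finZ by (auto simp: J_def)
  have tj: "tjoin J \<U> x"
    using J0(2) Z(2) par_sym_diff[OF finJ0 finZ] by (simp add: tjoin_def J_def eulerian_def)
  have "card J = card (J - P) + card (J \<inter> P)"
    using card_Int_Diff[OF J(2), of P] by simp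
  moreover have "card (J - P) \<le> card (F - P)" using J(1) F by (intro card_mono) auto
  ultimately have cJ: "2 * card J \<le> 2 * card (F - P) + card P" using Z(3) by (simp add: J_def)
  obtain M where M: "\<forall>(U, U', R)\<in>set M. U \<in> \<U> \<and> U' \<in> \<U> \<and> U \<noteq> U' \<and> R \<subseteq> J \<and> joins R (x U) (x U')"
    "(\<Sum>(U, U', R)\<leftarrow>M. card U + card U' + card R) \<le> (\<Sum>U\<in>\<U>. card U) + card J"
    "\<forall>Q. odd (card {U \<in> \<U>. Q U}) \<longrightarrow> (\<exists>(U, U', R)\<in>set M. Q U \<noteq> Q U')"
    "\<forall>U\<in>\<U>. \<exists>(U1, U2, R)\<in>set M. U = U1 \<or> U = U2"
    using tjoin_pairing[OF finU J(2) tj, of card] by (elim exE conjE) (rule that)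
  define bb where "bb = (\<lambda>(U, U', R) A. barbell N A \<and> U \<union> U' \<subseteq> A \<and> A \<subseteq> U \<union> U' \<union> R \<and> con A (x U) (x U'))"
  have "\<exists>A. bb p A" if p: "p \<in> set M" for p
  proof -
    obtain U U' R where "p = (U, U', R)" by (metis prod.exhaust)
    with p M(1) have pUR: "p = (U, U', R)" "U \<in> \<U>" "U' \<in> \<U>" "U \<noteq> U'" "joins R (x U) (x U')"
      by auto
    have "U \<inter> U' = {}" using disj pUR by (auto simp: pairwise_def disjnt_def)
    then show ?thesis
      unfolding pUR(1) bb_def prod.case
      using barbell_exists[of U U' N R "x U" "x U'"] circ odd share[OF pUR(2,3,4)] pUR x by blast
  qed
  then obtain g where g: "\<And>p. p \<in> set M \<Longrightarrow> bb p (g p)" by metis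
  obtain Bs where Bs: "set Bs = \<B>" "distinct Bs" using finite_distinct_list[of \<B>] fin by auto
  define \<F> where "\<F> = Bs @ map g M"
  have finUs: "finite U" if "U \<in> \<B> \<union> \<U>" for U using circ[OF that] by (simp add: circuit_set_def)
  have pair: "barbell N (g p)" "U \<union> U' \<subseteq> g p" "g p \<subseteq> U \<union> U' \<union> R" "con (g p) (x U) (x U')"
      "U \<in> \<U>" "U' \<in> \<U>" "R \<subseteq> J" if "p \<in> set M" "p = (U, U', R)" for p U U' R
    using g[OF that(1)] M(1) that by (auto simp: bb_def)
  have sub: "A \<subseteq> D \<union> F" if "A \<in> set \<F>" for A
  proof -
    consider "A \<in> \<B>" | p where "p \<in> set M" "A = g p" using \<open>A \<in> set \<F>\<close> Bs by (auto simp: \<F>_def)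
    then show ?thesis
    proof cases
      case 1
      then show ?thesis using UD by blast
    next
      case (2 p)
      obtain U U' R where p: "p = (U, U', R)" by (metis prod.exhaust)
      have "U \<subseteq> D" "U' \<subseteq> D" "R \<subseteq> F" using pair(5-7)[OF 2(1) p] UD J(1) by blast+
      then show ?thesis using pair(3)[OF 2(1) p] 2(2) by blast
    qed
  qed
  show thesis
  proof (rule that[of \<F>])
    show "scircuit N A \<and> A \<subseteq> D \<union> F" if A: "A \<in> set \<F>" for A
    proof
      consider "A \<in> \<B>" | p where "p \<in> set M" "A = g p" using \<open>A \<in> set \<F>\<close> Bs by (auto simp: \<F>_def)
      then show "scircuit N A"
      proof cases
        case 1
        then show ?thesis using circ even by (simp add: scircuit_def)
      next
        case (2 p)
        obtain U U' R where p: "p = (U, U', R)" by (metis prod.exhaust)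
        show ?thesis using pair(1)[OF 2(1) p] 2(2) by (simp add: scircuit_def)
      qed
    qed (rule sub[OF A])
    show "D \<subseteq> \<Union>(set \<F>)"
    proof
      fix e assume "e \<in> D"
      then consider U where "U \<in> \<B>" "e \<in> U" | U where "U \<in> \<U>" "e \<in> U" using UD by blast
      then show "e \<in> \<Union>(set \<F>)"
      proof cases
        case (1 U)
        then show ?thesis using Bs by (auto simp: \<F>_def)
      next
        case (2 U)
        obtain p where p: "p \<in> set M" "case p of (U1, U2, R) \<Rightarrow> U = U1 \<or> U = U2"
          using M(4) 2(1) by blast
        obtain U1 U2 R where p': "p = (U1, U2, R)" by (metis prod.exhaust)
        have "e \<in> g p" using pair(2)[OF p(1) p'] p(2) p' 2(2) by auto
        then show ?thesis using p(1) by (auto simp: \<F>_def)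
      qed
    qed
    show "b \<in> \<Union>(set \<F>)" if b: "(D \<union> F) \<inter> cut S = {b}" "odd (card (D \<inter> N \<inter> inside S))" for S b
    proof -
      \<comment> \<open>An Eulerian set does not cross a cut in a single edge, so \<open>D\<close>
        does not cross \<open>S\<close>. Oddly many base points then lie in \<open>S\<close>, some
        pair is separated, and its barbell can only cross through \<open>b\<close>.\<close>
      have "D \<inter> cut S \<subseteq> {b}" using b(1) by blast
      then have "D \<inter> cut S = {} \<or> D \<inter> cut S = {b}" by blast
      then have "D \<inter> cut S = {}" using eulerian_even_cut[OF D(2), of S] by auto
      then have "odd (card {U \<in> \<U>. x U \<in> S})" using count b(2) by blast
      then have "\<exists>(U, U', R)\<in>set M. (x U \<in> S) \<noteq> (x U' \<in> S)"
        using spec[OF M(3), of "\<lambda>U. x U \<in> S"] by blast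
      then obtain p where p: "p \<in> set M" "case p of (U, U', R) \<Rightarrow> (x U \<in> S) \<noteq> (x U' \<in> S)" by blast
      obtain U U' R where p': "p = (U, U', R)" by (metis prod.exhaust)
      have "con (g p) (x U) (x U')" "con (g p) (x U') (x U)"
        using pair(4)[OF p(1) p'] con_sym by auto
      moreover have "(x U \<in> S) \<noteq> (x U' \<in> S)" using p(2) p' by simp
      ultimately have "g p \<inter> cut S \<noteq> {}" unfolding con_def by blast
      moreover have "g p \<subseteq> D \<union> F" using sub[of "g p"] p(1) by (auto simp: \<F>_def)
      then have "g p \<inter> cut S \<subseteq> (D \<union> F) \<inter> cut S" by blast
      ultimately have "b \<in> g p" unfolding b(1) by blast
      then show ?thesis using p(1) by (auto simp: \<F>_def)
    qed
    have "(\<Sum>A\<leftarrow>map g M. card A) \<le> (\<Sum>(U, U', R)\<leftarrow>M. card U + card U' + card R)"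
      unfolding map_map comp_def
    proof (rule sum_list_mono)
      fix p assume p: "p \<in> set M"
      obtain U U' R where p': "p = (U, U', R)" by (metis prod.exhaust)
      have "finite R" using pair(7)[OF p p'] J(2) finite_subset by blast
      then have "card (g p) \<le> card (U \<union> U' \<union> R)"
        using pair(3,5,6)[OF p p'] finUs by (intro card_mono) auto
      also have "\<dots> \<le> card U + card U' + card R"
        by (meson add_mono card_Un_le le_refl order_trans)
      finally show "card (g p) \<le> (case p of (U, U', R) \<Rightarrow> card U + card U' + card R)"
        by (simp add: p')
    qed
    moreover have "(\<Sum>A\<leftarrow>Bs. card A) = (\<Sum>U\<in>\<B>. card U)"
      using Bs by (metis sum_list_distinct_conv_sum_set)
    moreover have "card D = (\<Sum>U\<in>\<B>. card U) + (\<Sum>U\<in>\<U>. card U)"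
    proof -
      have "card D = (\<Sum>U\<in>\<B> \<union> \<U>. card U)"
        unfolding UD[symmetric] using disj finUs by (intro card_Union_disjoint) auto
      moreover have "\<B> \<inter> \<U> = {}" using even odd by blast
      ultimately show ?thesis using fin by (simp add: sum.union_disjoint)
    qed
    ultimately show "2 * (\<Sum>A\<leftarrow>\<F>. card A) \<le> 2 * card D + 2 * card (F - P) + card P"
      using M(2) cJ by (simp add: \<F>_def)
  qed
qed

end

text \<open>
  Nonzero elements \<open>(p e, q e)\<close> of \<open>\<int>\<^sub>2 \<times> \<int>\<^sub>2\<close> are assigned to the points of \<open>N\<close>. Two points that
  are separated only by singletons of the family are merged; a nonzero element is the sum of the
  other two.
\<close>

lemma laminar_assignment:
  assumes "finite N" "card N \<noteq> 1"
    and "\<And>A. A \<in> \<A> \<Longrightarrow> A \<noteq> {} \<and> A \<subset> N"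
    and "\<And>A B. A \<in> \<A> \<Longrightarrow> B \<in> \<A> \<Longrightarrow> A \<inter> B = {} \<or> A \<subseteq> B \<or> B \<subseteq> A"
  shows "\<exists>(p :: 'e \<Rightarrow> nat) (q :: 'e \<Rightarrow> nat). (\<forall>e\<in>N. odd (p e) \<or> odd (q e)) \<and> even (sum p N) \<and> even (sum q N) \<and>
    (\<forall>A\<in>\<A>. odd (sum p A) \<or> odd (sum q A))"
  using assms
proof (induction "card N" arbitrary: N \<A> rule: less_induct)
  case less
  note N = less.prems(1)
  consider "N = {}" | e e' where "N = {e, e'}" "e \<noteq> e'" | "3 \<le> card N"
  proof -
    have "card N = 0 \<or> card N = 2 \<or> 3 \<le> card N" using less.prems(2) by linarith
    then show thesis using that N by (auto simp: card_2_iff)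
  qed
  then show ?case
  proof cases
    case 1
    then have "\<A> = {}" using less.prems(3) by auto
    then show ?thesis using 1 by auto
  next
    case (2 e e')
    have "A = {e} \<or> A = {e'}" if "A \<in> \<A>" for A using less.prems(3)[OF that] 2 by auto
    then have "card A = 1" if "A \<in> \<A>" for A using that by (metis is_singletonI is_singleton_altdef)
    moreover have "card N = 2" using 2 by simp
    ultimately show ?thesis by (intro exI[of _ "\<lambda>_. 1"] exI[of _ "\<lambda>_. 0"]) simp
  next
    case 3
    \<comment> \<open>Adding \<open>N\<close> guarantees a member with at least two points. Any two
      points of a smallest such \<open>M\<close> will do: a member with two or more points that
      separates them would, by laminarity, be a proper subset of \<open>M\<close>.\<close>
    define big where "big = (\<lambda>M. M \<in> insert N \<A> \<and> 2 \<le> card M)"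
    have "big N" using 3 by (simp add: big_def)
    then obtain M where M: "big M" and Mmin: "\<And>M'. big M' \<Longrightarrow> card M \<le> card M'"
      using ex_has_least_nat[of big N card] by blast
    have MN: "M \<subseteq> N" using M less.prems(3) by (auto simp: big_def)
    have "\<not> card M \<le> Suc 0" using M by (simp add: big_def)
    then obtain e e' where e: "e \<in> M" "e' \<in> M" "e \<noteq> e'"
      using card_le_Suc0_iff_eq[OF finite_subset[OF MN N]] by blast
    have eN: "e \<in> N" "e' \<in> N" using e MN by auto
    have twins: "A = {e} \<or> A = {e'} \<or> (e \<in> A \<longleftrightarrow> e' \<in> A)" if A: "A \<in> \<A>" for A
    proof (rule ccontr)
      assume neg: "\<not> ?thesis"
      have finA: "finite A" using less.prems(3)[OF A] N finite_subset by blast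
      have "2 \<le> card A"
      proof (rule ccontr)
        assume "\<not> 2 \<le> card A"
        then have "card A \<le> Suc 0" by simp
        then show False using neg card_le_Suc0_iff_eq[OF finA] by auto
      qed
      then have "card M \<le> card A" using Mmin A by (simp add: big_def)
      moreover have "A \<inter> M = {} \<or> A \<subseteq> M \<or> M \<subseteq> A"
        using M A less.prems(3)[OF A] less.prems(4)[OF A] by (auto simp: big_def)
      then have "A \<subset> M" using neg e by blast
      then have "card A < card M" using finite_subset[OF MN N] by (rule psubset_card_mono[rotated])
      ultimately show False by simp
    qed
    \<comment> \<open>The merged point keeps the name \<open>e\<close>. The member
      \<open>{e'}\<close> is left out because it would become empty; a nonzero value at
      \<open>e'\<close> takes care of it.\<close>
    define \<A>' where "\<A>' = (\<lambda>A. A - {e'}) ` (\<A> - {{e'}})"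
    have lt: "card (N - {e'}) < card N" using N eN(2) by (rule card_Diff1_less)
    have c1: "card (N - {e'}) \<noteq> 1" using 3 N eN by simp
    have c2: "A' \<noteq> {} \<and> A' \<subset> N - {e'}" if A': "A' \<in> \<A>'" for A'
    proof -
      obtain A where A: "A \<in> \<A>" "A \<noteq> {e'}" "A' = A - {e'}" using A' by (auto simp: \<A>'_def)
      have AN: "A \<noteq> {}" "A \<subset> N" using less.prems(3)[OF A(1)] by auto
      have "A' \<noteq> {}" using AN(1) A(2,3) by blast
      moreover have "A' \<noteq> N - {e'}"
      proof
        assume eq: "A' = N - {e'}"
        then have "e \<in> A" "e' \<notin> A" using A(3) eN e(3) AN(2) by auto
        then have "A = {e}" using twins[OF A(1)] e(3) by auto
        then have "N \<subseteq> {e, e'}" using eq A(3) by auto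
        then have "card N \<le> card {e, e'}" by (intro card_mono) auto
        then show False using 3 e(3) by simp
      qed
      ultimately show ?thesis using AN A(3) by auto
    qed
    have c3: "A' \<inter> B' = {} \<or> A' \<subseteq> B' \<or> B' \<subseteq> A'" if "A' \<in> \<A>'" "B' \<in> \<A>'" for A' B'
    proof -
      obtain A B where "A \<in> \<A>" "A' = A - {e'}" "B \<in> \<A>" "B' = B - {e'}"
        using \<open>A' \<in> \<A>'\<close> \<open>B' \<in> \<A>'\<close> by (auto simp: \<A>'_def)
      then show ?thesis using less.prems(4)[of A B] by auto
    qed
    have "\<exists>(p :: 'e \<Rightarrow> nat) (q :: 'e \<Rightarrow> nat). (\<forall>e\<in>N - {e'}. odd (p e) \<or> odd (q e)) \<and>
        even (sum p (N - {e'})) \<and> even (sum q (N - {e'})) \<and>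
        (\<forall>A\<in>\<A>'. odd (sum p A) \<or> odd (sum q A))"
      using less.hyps[OF lt finite_Diff[OF N] c1, of \<A>'] c2 c3 by blast
    then obtain p :: "'e \<Rightarrow> nat" and q :: "'e \<Rightarrow> nat" where
      pq: "\<forall>e\<in>N - {e'}. odd (p e) \<or> odd (q e)" "even (sum p (N - {e'}))" "even (sum q (N - {e'}))"
        "\<forall>A\<in>\<A>'. odd (sum p A) \<or> odd (sum q A)"
      by (elim exE conjE) (rule that)
    have "odd (p e) \<or> odd (q e)" using pq(1) eN e(3) by auto
    then have "\<exists>(a :: nat) (b :: nat) (a' :: nat) (b' :: nat). (odd a \<or> odd b) \<and> (odd a' \<or> odd b') \<and>
        (even (a + a') \<longleftrightarrow> even (p e)) \<and> (even (b + b') \<longleftrightarrow> even (q e))"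
    proof -
      consider "odd (p e)" "even (q e)" | "even (p e)" "odd (q e)" | "odd (p e)" "odd (q e)"
        using \<open>odd (p e) \<or> odd (q e)\<close> by blast
      then show ?thesis
      proof cases
        case 1
        then show ?thesis
          by (intro exI[of _ 0] exI[of _ 1] exI[of _ 1]) (auto intro!: exI[of _ 1])
      next
        case 2
        then show ?thesis
          by (intro exI[of _ 1] exI[of _ 0] exI[of _ 1]) (auto intro!: exI[of _ 1])
      next
        case 3
        then show ?thesis
          by (intro exI[of _ 1] exI[of _ 0] exI[of _ 0]) (auto intro!: exI[of _ 1])
      qed
    qed
    then obtain a :: nat and b :: nat and a' :: nat and b' :: nat where ab: "odd a \<or> odd b" "odd a' \<or> odd b'"
      "even (a + a') \<longleftrightarrow> even (p e)" "even (b + b') \<longleftrightarrow> even (q e)" by blast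
    define p' where "p' = p(e := a, e' := a')"
    define q' where "q' = q(e := b, e' := b')"
    have split: "(even (sum p' A) \<longleftrightarrow> even (sum p (A - {e'}))) \<and> (even (sum q' A) \<longleftrightarrow> even (sum q (A - {e'})))"
      if A: "A \<subseteq> N" "e \<in> A \<longleftrightarrow> e' \<in> A" for A
    proof (cases "e \<in> A")
      case True
      define A0 where "A0 = A - {e, e'}"
      have A0: "A = insert e (insert e' A0)" "A - {e'} = insert e A0" "e \<notin> A0" "e' \<notin> A0" "finite A0"
        using True A e(3) finite_subset[OF A(1) N] by (auto simp: A0_def)
      have "p' e = a" "p' e' = a'" "q' e = b" "q' e' = b'" "sum p' A0 = sum p A0" "sum q' A0 = sum q A0"
        using A0(3,4) e(3) by (auto simp: p'_def q'_def intro!: sum.cong)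
      moreover have "sum f A = f e + (f e' + sum f A0)" for f :: "'e \<Rightarrow> nat"
        unfolding A0(1) using A0(3-5) e(3) by simp
      moreover have "sum f (A - {e'}) = f e + sum f A0" for f :: "'e \<Rightarrow> nat"
        unfolding A0(2) using A0(3,5) by simp
      ultimately have "sum p' A = a + a' + sum p A0" "sum q' A = b + b' + sum q A0"
        "sum p (A - {e'}) = p e + sum p A0" "sum q (A - {e'}) = q e + sum q A0" by simp_all
      then show ?thesis using ab(3,4) by simp
    next
      case False
      then have "e' \<notin> A" "A - {e'} = A" using A(2) by auto
      moreover have "sum p' A = sum p A" "sum q' A = sum q A"
        using False \<open>e' \<notin> A\<close> by (auto simp: p'_def q'_def intro!: sum.cong)
      ultimately show ?thesis by simp
    qed
    have "odd (sum p' A) \<or> odd (sum q' A)" if A: "A \<in> \<A>" for A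
    proof -
      consider "A = {e}" | "A = {e'}" | "A \<noteq> {e'}" "e \<in> A \<longleftrightarrow> e' \<in> A" using twins[OF A] by blast
      then show ?thesis
      proof cases
        case 3
        then have "A - {e'} \<in> \<A>'" using A by (auto simp: \<A>'_def)
        moreover have "A \<subseteq> N" using less.prems(3)[OF A] by auto
        ultimately show ?thesis using pq(4) split[OF _ 3(2)] by blast
      qed (use ab e(3) in \<open>auto simp: p'_def q'_def\<close>)
    qed
    moreover have "odd (p' x) \<or> odd (q' x)" if "x \<in> N" for x
      using pq(1) that ab e(3) by (auto simp: p'_def q'_def)
    moreover have "even (sum p' N)" "even (sum q' N)"
      using split[of N] pq(2,3) eN by auto
    ultimately show ?thesis by (intro exI[of _ p'] exI[of _ q']) blast
  qed
qed

section \<open>The negative edges of a minimum signature\<close>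

context ends
begin

text \<open>The sum, over \<open>N'\<close>, of fundamental Eulerian sets: an edge of
  \<open>N'\<close> closed up by a join of its ends in \<open>F\<close>.\<close>

lemma eulerian_with_negative:
  assumes F: "finite F" and N': "finite N'" "N' \<inter> F = {}" and con: "\<And>e. e \<in> N' \<Longrightarrow> con F (t e) (h e)"
  shows "\<exists>D. D \<subseteq> N' \<union> F \<and> eulerian D \<and> D - F = N'"
  using N' con
proof (induction N' rule: finite_induct)
  case empty
  then show ?case by (intro exI[of _ "{}"]) simp
next
  case (insert e N')
  then obtain D where D: "D \<subseteq> N' \<union> F" "eulerian D" "D - F = N'" by auto
  obtain R where R: "R \<subseteq> F" "joins R (t e) (h e)"
    by (rule con_joins[OF insert.prems(2)[OF insertI1] F]) (rule that)
  have fin: "finite D" "finite R"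
    using finite_subset[OF D(1)] finite_subset[OF R(1) F] insert.hyps(1) F by auto
  have "e \<notin> R" using insert.prems(1) R(1) by auto
  then have "eulerian (insert e R)" by (rule eulerian_join_insert[OF fin(2) R(2)])
  then have "eulerian (sym_diff D (insert e R))" using eulerian_sym_diff fin D(2) by simp
  moreover have "sym_diff D (insert e R) - F = insert e N'"
    using D(3) R(1) insert.hyps(2) insert.prems(1) by auto
  moreover have "sym_diff D (insert e R) \<subseteq> insert e N' \<union> F" using D(1) R(1) by auto
  ultimately show ?case by blast
qed

end

text \<open>\<open>E\<close> is the edge set of a graph in which \<open>N\<close> is the negative set of a minimum signature.\<close>

locale signed_ends = ends t h for t h :: "'e \<Rightarrow> 'v" +
  fixes E N :: "'e set"
  assumes finE: "finite E" and NE: "N \<subseteq> E"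
    and minimal: "2 * card (N \<inter> cut S) \<le> card (E \<inter> cut S)"
begin

definition Pos :: "'e set" where "Pos = E - N"

text \<open>The edges of \<open>Pos\<close> that are not bridges of \<open>Pos\<close>. The bridges,
  collected in \<open>Br\<close>, need not be bridges of \<open>E\<close>.\<close>

definition Cyc :: "'e set" where "Cyc = {e \<in> Pos. \<exists>Z\<subseteq>Pos. eulerian Z \<and> e \<in> Z}"

definition Br :: "'e set" where "Br = Pos - Cyc"

abbreviation comp :: "'v \<Rightarrow> 'v set" where "comp \<equiv> component Pos"

lemma fin: "finite N" "finite Pos" "finite Cyc" "finite Br"
  using finE NE finite_subset by (auto simp: Pos_def Cyc_def Br_def)

lemma E_split: "card E = card Cyc + card Br + card N"
proof -
  have "card E = card Pos + card N"
    unfolding Pos_def using finE NE fin(1) by (simp add: card_Diff_subset card_mono)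
  moreover have "card Pos = card Cyc + card Br"
    unfolding Br_def using fin by (subst card_Diff_subset) (auto simp: Cyc_def card_mono)
  ultimately show ?thesis by simp
qed

lemma E_cut: "card (E \<inter> cut S) = card (Pos \<inter> cut S) + card (N \<inter> cut S)"
proof -
  have "E \<inter> cut S = (Pos \<inter> cut S) \<union> (N \<inter> cut S)" using NE by (auto simp: Pos_def)
  moreover have "card ((Pos \<inter> cut S) \<union> (N \<inter> cut S)) = card (Pos \<inter> cut S) + card (N \<inter> cut S)"
    using fin by (intro card_Un_disjoint) (auto simp: Pos_def)
  ultimately show ?thesis by simp
qed

text \<open>No positive edge leaves a component of \<open>Pos\<close>, so minimality allows no
  negative one either: \<open>E\<close> and \<open>Pos\<close> have the same components.\<close>

lemma E_cut_comp: "E \<inter> cut (comp v) = {}"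
proof -
  have "card (E \<inter> cut (comp v)) = 0" using E_cut[of "comp v"] minimal[of "comp v"] by simp
  then show ?thesis using finE by simp
qed

lemma con_ends: "e \<in> E \<Longrightarrow> con Pos (t e) (h e)"
  using E_cut_comp[of "t e"] by (auto simp: cut_def component_def)

lemma Cyc_bridgeless: "card (Cyc \<inter> cut S) \<noteq> 1"
proof
  assume "card (Cyc \<inter> cut S) = 1"
  then obtain e where e: "Cyc \<inter> cut S = {e}" by (auto simp: card_1_singleton_iff)
  then obtain Z where Z: "Z \<subseteq> Pos" "eulerian Z" "e \<in> Z" by (auto simp: Cyc_def)
  then obtain e' where e': "e' \<in> Z" "e' \<in> cut S" "e' \<noteq> e"
    using eulerian_cut_other[of Z e S] e by blast
  then have "e' \<in> Cyc" using Z by (auto simp: Cyc_def)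
  then show False using e e' by blast
qed

text \<open>A bridge of \<open>Pos\<close> is the only positive edge of some cut, and minimality
  admits at most one negative edge beside it.\<close>

lemma Br_cut:
  assumes b: "b \<in> Br"
  obtains S where "E \<inter> cut S = {b}" | S e where "E \<inter> cut S = {b, e}" "e \<in> N"
proof -
  have bP: "b \<in> Pos" using b by (simp add: Br_def)
  have "\<not> con (Pos - {b}) (t b) (h b)"
  proof
    assume "con (Pos - {b}) (t b) (h b)"
    then obtain Z where "Z \<subseteq> Pos" "eulerian Z" "b \<in> Z"
      by (rule not_bridge_eulerian[OF _ bP fin(2)])
    then show False using b by (auto simp: Br_def Cyc_def)
  qed
  then obtain S where S: "t b \<in> S" "h b \<notin> S" "(Pos - {b}) \<inter> cut S = {}"
    unfolding con_def by blast
  have "b \<in> cut S" using S by (auto simp: cut_def)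
  then have posS: "Pos \<inter> cut S = {b}" using S(3) bP by auto
  then have "card (N \<inter> cut S) \<le> 1" using E_cut[of S] minimal[of S] by simp
  then have "card (N \<inter> cut S) = 0 \<or> card (N \<inter> cut S) = 1" by linarith
  then consider "N \<inter> cut S = {}" | e where "N \<inter> cut S = {e}"
    using fin(1) by (auto simp: card_1_singleton_iff)
  then show thesis
  proof cases
    case 1
    then have "E \<inter> cut S = {b}" using posS by (auto simp: Pos_def)
    then show thesis by (rule that(1))
  next
    case (2 e)
    then have "E \<inter> cut S = {b, e}" "e \<in> N" using posS NE by (auto simp: Pos_def)
    then show thesis by (rule that(2))
  qed
qed

lemma bridge_not_negative:
  assumes "E \<inter> cut S = {b}"
  shows "b \<in> Pos"
proof (rule ccontr)
  have b: "b \<in> E" "b \<in> cut S" using assms by auto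
  moreover assume "b \<notin> Pos"
  ultimately have "N \<inter> cut S = {b}" using assms NE by (auto simp: Pos_def)
  then show False using minimal[of S] assms by simp
qed

text \<open>Half of \<open>Cyc\<close> is paid for in \<open>D\<close> and half in the join that
  pairs up the unbalanced circuits. That join may also use all of \<open>Br\<close>.\<close>

lemma part_cover:
  assumes N': "N' \<subseteq> N" and even: "\<And>v. even (card (N' \<inter> inside (comp v)))"
  shows "\<exists>D \<F>. D \<subseteq> E \<and> eulerian D \<and> D \<inter> N = N' \<and> (\<forall>A\<in>set \<F>. scircuit N A \<and> A \<subseteq> E) \<and>
    D \<subseteq> \<Union>(set \<F>) \<and>
    (\<Sum>A\<leftarrow>\<F>. card A) \<le> card N' + card (D \<inter> Br) + card Cyc + card Br \<and>
    (\<forall>S b. E \<inter> cut S = {b} \<longrightarrow> odd (card (N' \<inter> inside S)) \<longrightarrow> b \<in> \<Union>(set \<F>))"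
proof -
  have finN': "finite N'" using N' fin(1) finite_subset by blast
  have nonbridge: "\<exists>Z\<subseteq>Pos. eulerian Z \<and> e \<in> Z" if "e \<in> Cyc" for e using that by (simp add: Cyc_def)
  have "N' \<inter> Pos = {}" using N' by (auto simp: Pos_def)
  moreover have "con Pos (t e) (h e)" if "e \<in> N'" for e using that N' NE by (intro con_ends) auto
  ultimately obtain D0 where D0: "D0 \<subseteq> N' \<union> Pos" "eulerian D0" "D0 - Pos = N'"
    using eulerian_with_negative[OF fin(2) finN'] by blast
  have finD0: "finite D0" using finite_subset[OF D0(1)] finN' fin(2) by simp
  obtain Z where Z: "Z \<subseteq> Pos" "eulerian Z" "2 * card (sym_diff D0 Z \<inter> Cyc) \<le> card Cyc"
    by (rule half_average[of Pos Cyc D0, OF fin(2) nonbridge finD0]) (assumption, rule that)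
  define D where "D = sym_diff D0 Z"
  have DE: "D \<subseteq> E" using D0(1) Z(1) N' NE by (auto simp: D_def Pos_def)
  have D: "finite D" "eulerian D" "D \<inter> N = N'"
    using finite_subset[OF DE finE] eulerian_sym_diff[OF finD0 finite_subset[OF Z(1) fin(2)] D0(2) Z(2)]
      D0(1,3) Z(1) N' by (auto simp: D_def Pos_def)
  have "N' \<union> (D \<inter> Br) \<union> (D \<inter> Cyc) = D"
    using DE D(3) by (auto simp: Br_def Pos_def)
  then have "card D \<le> card N' + card (D \<inter> Br) + card (D \<inter> Cyc)"
    using card_Un_le[of "N' \<union> (D \<inter> Br)" "D \<inter> Cyc"] card_Un_le[of N' "D \<inter> Br"] by simp
  moreover have "2 * card (D \<inter> Cyc) \<le> card Cyc" using Z(3) by (simp add: D_def)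
  ultimately have cD: "2 * card D \<le> 2 * card N' + 2 * card (D \<inter> Br) + card Cyc" by linarith
  have DPos: "D \<union> Pos \<subseteq> E" using DE by (auto simp: Pos_def)
  have closed: "D \<inter> cut (comp v) = {}" for v using E_cut_comp DE by blast
  have even': "even (card (D \<inter> N \<inter> inside (comp v)))" for v using even by (simp add: D(3))
  have CycP: "Cyc \<subseteq> Pos" by (auto simp: Cyc_def)
  obtain \<F> where \<F>: "\<And>A. A \<in> set \<F> \<Longrightarrow> scircuit N A \<and> A \<subseteq> D \<union> Pos" "D \<subseteq> \<Union>(set \<F>)"
    "2 * (\<Sum>A\<leftarrow>\<F>. card A) \<le> 2 * card D + 2 * card (Pos - Cyc) + card Cyc"
    "\<And>S b. (D \<union> Pos) \<inter> cut S = {b} \<Longrightarrow> odd (card (D \<inter> N \<inter> inside S)) \<Longrightarrow> b \<in> \<Union>(set \<F>)"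
    by (rule barbell_cover[of D Pos Cyc N, OF D(1,2) fin(2) CycP nonbridge closed even'])
      (assumption, rule that)
  show ?thesis
  proof (intro exI[of _ D] exI[of _ \<F>] conjI allI impI ballI)
    show "scircuit N A" "A \<subseteq> E" if "A \<in> set \<F>" for A using \<F>(1)[OF that] DPos by auto
    show "(\<Sum>A\<leftarrow>\<F>. card A) \<le> card N' + card (D \<inter> Br) + card Cyc + card Br"
      using \<F>(3) cD by (simp add: Br_def)
    show "b \<in> \<Union>(set \<F>)" if b: "E \<inter> cut S = {b}" "odd (card (N' \<inter> inside S))" for S b
    proof -
      have "b \<in> Pos" by (rule bridge_not_negative[OF b(1)])
      then have "(D \<union> Pos) \<inter> cut S = {b}" using b(1) DPos by blast
      then show ?thesis using \<F>(4) b(2) D(3) by blast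
    qed
  qed (use DE D \<F>(2) in auto)
qed

text \<open>The partner \<open>e\<close> comes from a cut that depends on \<open>b\<close> alone, so
  it is the same for all \<open>D i\<close>. This permits counting over several sets at
  once.\<close>

lemma part_Br:
  assumes "b \<in> Br" and D: "\<And>i. eulerian (D i)" "\<And>i. D i \<subseteq> E"
  shows "(\<forall>i. b \<notin> D i) \<or> (\<exists>e\<in>N. \<forall>i. b \<in> D i \<longleftrightarrow> e \<in> D i)"
  using assms(1)
proof (cases rule: Br_cut)
  case (1 S)
  have "b \<notin> D i" for i
  proof
    assume "b \<in> D i"
    then have "D i \<inter> cut S = {b}" using 1 D(2)[of i] by blast
    then show False using eulerian_even_cut[OF D(1), of i S] by simp
  qed
  then show ?thesis by blast
next
  case (2 S e)
  have "b \<in> cut S" "e \<in> cut S" using 2(1) by auto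
  have "b \<noteq> e" using assms(1) 2(2) by (auto simp: Br_def Pos_def)
  have "b \<in> D i \<longleftrightarrow> e \<in> D i" for i
  proof -
    have "D i \<inter> cut S = D i \<inter> {b, e}" using 2(1) D(2)[of i] by blast
    then have "even (card (D i \<inter> {b, e}))" using eulerian_even_cut[OF D(1), of i S] by simp
    then show ?thesis using \<open>b \<noteq> e\<close> by (cases "b \<in> D i"; cases "e \<in> D i") auto
  qed
  then show ?thesis using 2(2) by blast
qed

end

lemma (in ends) circuit_list:
  assumes "finite A" "eulerian A" "A \<inter> N = {}"
  shows "\<exists>L. (\<forall>U\<in>set L. scircuit N U \<and> U \<subseteq> A) \<and> A \<subseteq> \<Union>(set L) \<and> (\<Sum>U\<leftarrow>L. card U) = card A"
proof -
  obtain \<C> where C: "finite \<C>" "\<And>U. U \<in> \<C> \<Longrightarrow> circuit_set U" "pairwise disjnt \<C>" "\<Union>\<C> = A"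
    by (rule circuit_decomposition[OF assms(1,2)]) (rule that)
  obtain L where L: "set L = \<C>" "distinct L" using finite_distinct_list[OF C(1)] by blast
  have "(\<Sum>U\<leftarrow>L. card U) = (\<Sum>U\<in>\<C>. card U)"
    using L by (metis sum_list_distinct_conv_sum_set)
  also have "\<dots> = card A"
    unfolding C(4)[symmetric] using C(2,3)
    by (intro card_Union_disjoint[symmetric]) (auto simp: circuit_set_def)
  moreover have "scircuit N U \<and> U \<subseteq> A" if "U \<in> \<C>" for U
  proof -
    have UA: "U \<subseteq> A" using C(4) that by blast
    then have "U \<inter> N = {}" using assms(3) by blast
    then show ?thesis using C(2)[OF that] UA by (simp add: scircuit_def)
  qed
  ultimately show ?thesis using L(1) C(4) by (intro exI[of _ L]) auto
qed

text \<open>What is needed of flow-admissibility. Applied to both sides of a bridge of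
  \<open>E\<close>, \<open>side\<close> puts negative edges on each of them;
  \<open>not_single\<close> lets every component have a nowhere-zero assignment with sum
  zero.\<close>

locale flow_ends = signed_ends t h E N for t h :: "'e \<Rightarrow> 'v" and E N :: "'e set" +
  assumes side: "E \<inter> cut S = {b} \<Longrightarrow> N \<inter> inside S \<noteq> {}"
    and not_single: "E \<inter> cut S = {} \<Longrightarrow> card (N \<inter> inside S) \<noteq> 1"
begin

lemma cut_within_comp:
  assumes "X \<subseteq> comp v" "X \<noteq> {}" "X \<noteq> comp v"
  shows "E \<inter> cut X \<noteq> {}"
proof -
  obtain x y where "x \<in> X" "y \<in> comp v" "y \<notin> X" using assms by blast
  then have "con Pos x y" using con_component[of x Pos v y] assms(1) by auto
  then have "Pos \<inter> cut X \<noteq> {}" using \<open>x \<in> X\<close> \<open>y \<notin> X\<close> unfolding con_def by blast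
  then show ?thesis by (auto simp: Pos_def)
qed

text \<open>Crossing sides would divide the component into four nonempty parts, the last one
  containing \<open>r\<close>. Connectedness requires \<open>b\<close> or \<open>b'\<close> to leave
  each part. But distinct \<open>b\<close> and \<open>b'\<close> cross only \<open>S\<close> and
  only \<open>S'\<close>, respectively, so together they touch at most three parts; if equal, they
  touch two.\<close>

lemma bridge_sides_laminar:
  assumes r: "r \<in> comp v" and S: "S \<subseteq> comp v" "r \<notin> S" "E \<inter> cut S = {b}"
    and S': "S' \<subseteq> comp v" "r \<notin> S'" "E \<inter> cut S' = {b'}"
  shows "S \<inter> S' = {} \<or> S \<subseteq> S' \<or> S' \<subseteq> S"
proof (rule ccontr)
  assume neg: "\<not> ?thesis"
  define K where "K = comp v"
  have cutK: "E \<inter> cut K = {}" using E_cut_comp by (simp add: K_def)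
  have bE: "b \<in> E" "b' \<in> E" "b \<in> cut S" "b' \<in> cut S'" using S(3) S'(3) by auto
  have K: "b \<notin> cut K" "b' \<notin> cut K" using cutK bE by auto
  have hit: "b \<in> cut X \<or> b' \<in> cut X"
    if X: "X \<in> {S \<inter> S', S - S', S' - S, K - S - S'}" for X
  proof -
    have "X \<subseteq> K" "X \<noteq> {}" "X \<noteq> K" using X neg S S' r by (auto simp: K_def)
    then obtain e where e: "e \<in> E" "e \<in> cut X" using cut_within_comp[of X v] by (auto simp: K_def)
    have "e \<notin> cut K" using e(1) cutK by blast
    then have "e \<in> cut S \<or> e \<in> cut S'" using e(2) X by (auto simp: cut_def)
    then have "e = b \<or> e = b'" using e(1) S(3) S'(3) by blast
    then show ?thesis using e(2) by blast
  qed
  have uniq: "x = b" if "x \<in> E" "x \<in> cut S" for x using S(3) that by auto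
  have uniq': "x = b'" if "x \<in> E" "x \<in> cut S'" for x using S'(3) that by auto
  have sub: "x \<in> S \<longrightarrow> x \<in> K" "x \<in> S' \<longrightarrow> x \<in> K" for x using S(1) S'(1) by (auto simp: K_def)
  have hits: "b \<in> cut (S \<inter> S') \<or> b' \<in> cut (S \<inter> S')" "b \<in> cut (S - S') \<or> b' \<in> cut (S - S')"
    "b \<in> cut (S' - S) \<or> b' \<in> cut (S' - S)" "b \<in> cut (K - S - S') \<or> b' \<in> cut (K - S - S')"
    by (rule hit; simp)+
  show False
  proof (cases "b = b'")
    case True
    then show ?thesis
      using hits bE(3,4) K sub[of "t b"] sub[of "h b"]
      unfolding cut_def mem_Collect_eq Int_iff Diff_iff by (simp; smt (verit))
  next
    case False
    then have "b \<notin> cut S'" "b' \<notin> cut S" using uniq uniq' bE by blast+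
    then show ?thesis
      using hits bE(3,4) K sub[of "t b"] sub[of "h b"] sub[of "t b'"] sub[of "h b'"]
      unfolding cut_def mem_Collect_eq Int_iff Diff_iff by (smt (verit))
  qed
qed

text \<open>The root \<open>r\<close> selects one side of each bridge, and the selected sides are
  laminar.\<close>

lemma component_assignment:
  assumes r: "r \<in> comp v"
  shows "\<exists>(p :: 'e \<Rightarrow> nat) (q :: 'e \<Rightarrow> nat). (\<forall>e\<in>N \<inter> inside (comp v). odd (p e) \<or> odd (q e)) \<and>
    even (sum p (N \<inter> inside (comp v))) \<and> even (sum q (N \<inter> inside (comp v))) \<and>
    (\<forall>S b. S \<subseteq> comp v \<longrightarrow> r \<notin> S \<longrightarrow> E \<inter> cut S = {b} \<longrightarrow>
      odd (sum p (N \<inter> inside S)) \<or> odd (sum q (N \<inter> inside S)))"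
proof -
  define \<A> where "\<A> = {N \<inter> inside S | S. S \<subseteq> comp v \<and> r \<notin> S \<and> (\<exists>b. E \<inter> cut S = {b})}"
  have "A \<noteq> {} \<and> A \<subset> N \<inter> inside (comp v)" if "A \<in> \<A>" for A
  proof -
    obtain S b where S: "A = N \<inter> inside S" "S \<subseteq> comp v" "E \<inter> cut S = {b}"
      using \<open>A \<in> \<A>\<close> by (auto simp: \<A>_def)
    \<comment> \<open>The opposite side contains a negative edge as well, so the member is a proper
      subset.\<close>
    have "E \<inter> cut (comp v - S) = E \<inter> cut S"
      using S(2) E_cut_comp[of v] by (auto simp: cut_def)
    then have "N \<inter> inside (comp v - S) \<noteq> {}" using side[of "comp v - S" b] S(3) by simp
    then obtain e where "e \<in> N" "e \<in> inside (comp v - S)" by blast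
    then have "e \<in> N \<inter> inside (comp v)" "e \<notin> A" by (auto simp: S(1) inside_def)
    moreover have "A \<subseteq> N \<inter> inside (comp v)" using S(1,2) by (auto simp: inside_def)
    moreover have "A \<noteq> {}" using side[OF S(3)] S(1) by simp
    ultimately show ?thesis by blast
  qed
  moreover have "A \<inter> B = {} \<or> A \<subseteq> B \<or> B \<subseteq> A" if "A \<in> \<A>" "B \<in> \<A>" for A B
  proof -
    obtain S b where S: "A = N \<inter> inside S" "S \<subseteq> comp v" "r \<notin> S" "E \<inter> cut S = {b}"
      using \<open>A \<in> \<A>\<close> by (auto simp: \<A>_def)
    obtain S' b' where S': "B = N \<inter> inside S'" "S' \<subseteq> comp v" "r \<notin> S'" "E \<inter> cut S' = {b'}"
      using \<open>B \<in> \<A>\<close> by (auto simp: \<A>_def)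
    show ?thesis
      using bridge_sides_laminar[OF r S(2-4) S'(2-4)] by (auto simp: S(1) S'(1) inside_def)
  qed
  moreover have "finite (N \<inter> inside (comp v))" using fin(1) by simp
  moreover have "card (N \<inter> inside (comp v)) \<noteq> 1" using not_single E_cut_comp by blast
  ultimately have "\<exists>(p :: 'e \<Rightarrow> nat) (q :: 'e \<Rightarrow> nat).
    (\<forall>e\<in>N \<inter> inside (comp v). odd (p e) \<or> odd (q e)) \<and>
    even (sum p (N \<inter> inside (comp v))) \<and> even (sum q (N \<inter> inside (comp v))) \<and>
    (\<forall>A\<in>\<A>. odd (sum p A) \<or> odd (sum q A))"
    using laminar_assignment[of "N \<inter> inside (comp v)" \<A>] by blast
  then obtain p :: "'e \<Rightarrow> nat" and q :: "'e \<Rightarrow> nat" where pq: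
    "\<forall>e\<in>N \<inter> inside (comp v). odd (p e) \<or> odd (q e)"
    "even (sum p (N \<inter> inside (comp v)))" "even (sum q (N \<inter> inside (comp v)))"
    "\<forall>A\<in>\<A>. odd (sum p A) \<or> odd (sum q A)"
    by (elim exE conjE) (rule that)
  have "odd (sum p (N \<inter> inside S)) \<or> odd (sum q (N \<inter> inside S))"
    if "S \<subseteq> comp v" "r \<notin> S" "E \<inter> cut S = {b}" for S b
  proof -
    have "N \<inter> inside S \<in> \<A>" unfolding \<A>_def using that by blast
    then show ?thesis using pq(4) by blast
  qed
  then show ?thesis using pq(1-3) by (intro exI[of _ p] exI[of _ q]) simp
qed

text \<open>\<open>N1\<close> and \<open>N2\<close> are the supports of the two bits. A bridge is
  given some side \<open>S'\<close>, because the assignment controls only the side inside the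
  component that avoids the root.\<close>

lemma negative_parts:
  obtains N1 N2 where "N1 \<union> N2 = N" "\<And>v. even (card (N1 \<inter> inside (comp v)))"
    "\<And>v. even (card (N2 \<inter> inside (comp v)))"
    "\<And>S b. E \<inter> cut S = {b} \<Longrightarrow>
      \<exists>S'. E \<inter> cut S' = {b} \<and> (odd (card (N1 \<inter> inside S')) \<or> odd (card (N2 \<inter> inside S')))"
proof -
  \<comment> \<open>Roots and assignments belong to components as sets, so they do not depend on the
    vertex that names a component.\<close>
  define r where "r = (\<lambda>K. SOME v :: 'v. v \<in> K)"
  define good where "good = (\<lambda>K (p :: 'e \<Rightarrow> nat) (q :: 'e \<Rightarrow> nat).
    (\<forall>e\<in>N \<inter> inside K. odd (p e) \<or> odd (q e)) \<and>
    even (sum p (N \<inter> inside K)) \<and> even (sum q (N \<inter> inside K)) \<and>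
    (\<forall>S b. S \<subseteq> K \<longrightarrow> r K \<notin> S \<longrightarrow> E \<inter> cut S = {b} \<longrightarrow>
      odd (sum p (N \<inter> inside S)) \<or> odd (sum q (N \<inter> inside S))))"
  have r: "r (comp v) \<in> comp v" for v
    unfolding r_def by (rule someI[of _ v]) simp
  have "\<exists>p q. good (comp v) p q" for v
    unfolding good_def by (rule component_assignment[OF r])
  then have "\<forall>K\<in>range comp. \<exists>p q. good K p q" by blast
  then obtain p q where pq: "\<And>v. good (comp v) (p (comp v)) (q (comp v))" by (metis rangeI)
  define N1 where "N1 = {e \<in> N. odd (p (comp (t e)) e)}"
  define N2 where "N2 = {e \<in> N. odd (q (comp (t e)) e)}"
  have count: "odd (card ({e \<in> N. odd (f (comp (t e)) e)} \<inter> inside S)) \<longleftrightarrow> odd (sum (f (comp v)) (N \<inter> inside S))"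
    if "S \<subseteq> comp v" for S v and f :: "'v set \<Rightarrow> 'e \<Rightarrow> nat"
  proof -
    have "comp (t e) = comp v" if "e \<in> inside S" for e
      using that \<open>S \<subseteq> comp v\<close> component_eq[of Pos v "t e"] by (auto simp: inside_def component_def)
    then have "{e \<in> N. odd (f (comp (t e)) e)} \<inter> inside S = {e \<in> N \<inter> inside S. odd (f (comp v) e)}"
      by auto
    then show ?thesis using even_sum_iff[of "N \<inter> inside S" "f (comp v)"] fin(1) by simp
  qed
  show thesis
  proof (rule that[of N1 N2])
    have "odd (p (comp (t e)) e) \<or> odd (q (comp (t e)) e)" if "e \<in> N" for e
    proof -
      have "h e \<in> comp (t e)" using con_ends[of e] NE that by (auto simp: component_def)
      then have "e \<in> N \<inter> inside (comp (t e))" using that by (simp add: inside_def)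
      then show ?thesis using pq[of "t e"] unfolding good_def by blast
    qed
    then show "N1 \<union> N2 = N" by (auto simp: N1_def N2_def)
    show "even (card (N1 \<inter> inside (comp v)))" "even (card (N2 \<inter> inside (comp v)))" for v
      using count[of "comp v" v p] count[of "comp v" v q] pq[of v]
      by (simp_all add: N1_def N2_def good_def)
    show "\<exists>S'. E \<inter> cut S' = {b} \<and> (odd (card (N1 \<inter> inside S')) \<or> odd (card (N2 \<inter> inside S')))"
      if S: "E \<inter> cut S = {b}" for S b
    proof -
      define K where "K = comp (t b)"
      \<comment> \<open>\<open>S\<close> is restricted to the component of \<open>b\<close> and, if
        it contains the root, complemented there.\<close>
      define S' where "S' = (if r K \<in> S then K - S else S \<inter> K)"
      have b: "b \<in> E" "b \<in> cut S" using S by auto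
      have cutK: "E \<inter> cut K = {}" using E_cut_comp by (simp add: K_def)
      have "t b \<in> K" by (simp add: K_def)
      moreover have "h b \<in> K" using con_ends[OF b(1)] by (simp add: K_def component_def)
      ultimately have "b \<in> cut S'" using b(2) by (auto simp: S'_def cut_def)
      moreover have "E \<inter> cut S' \<subseteq> E \<inter> cut S" using cutK by (auto simp: S'_def cut_def split: if_splits)
      ultimately have S'cut: "E \<inter> cut S' = {b}" using S b(1) by blast
      have "S' \<subseteq> K" "r K \<notin> S'" by (auto simp: S'_def)
      then have "odd (sum (p K) (N \<inter> inside S')) \<or> odd (sum (q K) (N \<inter> inside S'))"
        using pq[of "t b"] S'cut unfolding good_def K_def by blast
      then show ?thesis
        using count[of S' "t b" p] count[of S' "t b" q] \<open>S' \<subseteq> K\<close> S'cut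
        by (intro exI[of _ S']) (simp add: N1_def N2_def K_def)
    qed
  qed
qed

theorem signed_cover:
  "\<exists>\<F>. (\<forall>A\<in>set \<F>. scircuit N A \<and> A \<subseteq> E) \<and> E \<subseteq> \<Union>(set \<F>) \<and>
    3 * (\<Sum>A\<leftarrow>\<F>. card A) + 5 * card N \<le> 11 * card E"
proof -
  obtain N1 N2 where N12: "N1 \<union> N2 = N" "\<And>v. even (card (N1 \<inter> inside (comp v)))"
    "\<And>v. even (card (N2 \<inter> inside (comp v)))"
    "\<And>S b. E \<inter> cut S = {b} \<Longrightarrow>
      \<exists>S'. E \<inter> cut S' = {b} \<and> (odd (card (N1 \<inter> inside S')) \<or> odd (card (N2 \<inter> inside S')))"
    by (rule negative_parts) (rule that)
  have fin12: "finite N1" "finite N2" using N12(1) fin(1) by auto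
  \<comment> \<open>The supports of the three nonzero functionals p, q and p + q; each negative edge
    lies in exactly two of them.\<close>
  define Nf where "Nf = (\<lambda>i :: nat. if i = 0 then N1 else if i = 1 then N2 else sym_diff N1 N2)"
  have Nf: "Nf 0 = N1" "Nf 1 = N2" "Nf (Suc 0) = N2" "Nf 2 = sym_diff N1 N2" by (simp_all add: Nf_def)
  have odd_sd: "odd (card (sym_diff N1 N2 \<inter> X)) \<longleftrightarrow> odd (card (N1 \<inter> X)) \<noteq> odd (card (N2 \<inter> X))" for X
  proof -
    have "sym_diff N1 N2 \<inter> X = sym_diff (N1 \<inter> X) (N2 \<inter> X)" by blast
    then show ?thesis using odd_card_sym_diff[of "N1 \<inter> X" "N2 \<inter> X"] fin12 by simp
  qed
  have "Nf i \<subseteq> N" for i using N12(1) by (auto simp: Nf_def)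
  moreover have "even (card (Nf i \<inter> inside (comp v)))" for i v
    using odd_sd[of "inside (comp v)"] N12(2,3) by (simp add: Nf_def)
  ultimately have "\<exists>D \<F>. D \<subseteq> E \<and> eulerian D \<and> D \<inter> N = Nf i \<and> (\<forall>A\<in>set \<F>. scircuit N A \<and> A \<subseteq> E) \<and>
    D \<subseteq> \<Union>(set \<F>) \<and>
    (\<Sum>A\<leftarrow>\<F>. card A) \<le> card (Nf i) + card (D \<inter> Br) + card Cyc + card Br \<and>
    (\<forall>S b. E \<inter> cut S = {b} \<longrightarrow> odd (card (Nf i \<inter> inside S)) \<longrightarrow> b \<in> \<Union>(set \<F>))" for i
    by (rule part_cover)
  then obtain D \<F> where D: "\<And>i. D i \<subseteq> E" "\<And>i. eulerian (D i)" "\<And>i. D i \<inter> N = Nf i"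
    and \<F>: "\<And>i A. A \<in> set (\<F> i) \<Longrightarrow> scircuit N A \<and> A \<subseteq> E" "\<And>i. D i \<subseteq> \<Union>(set (\<F> i))"
      "\<And>i. (\<Sum>A\<leftarrow>\<F> i. card A) \<le> card (Nf i) + card (D i \<inter> Br) + card Cyc + card Br"
      "\<And>i S b. E \<inter> cut S = {b} \<Longrightarrow> odd (card (Nf i \<inter> inside S)) \<Longrightarrow> b \<in> \<Union>(set (\<F> i))"
    by metis
  have mem: "e \<in> D i \<longleftrightarrow> e \<in> Nf i" if "e \<in> N" for e i using D(3)[of i] that by blast
  have "card (D 0 \<inter> Br) + card (D 1 \<inter> Br) + card (D 2 \<inter> Br)
      = (\<Sum>b\<in>Br. of_bool (b \<in> D 0) + of_bool (b \<in> D 1) + of_bool (b \<in> D 2))"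
    unfolding sum.distrib using fin(4) by (simp add: Int_commute)
  \<comment> \<open>A positive bridge that lies in some \<open>D i\<close> does so in step with a
    negative edge, hence for two of the three indices.\<close>
  also have "\<dots> \<le> (\<Sum>b\<in>Br. 2)"
  proof (rule sum_mono)
    fix b assume "b \<in> Br"
    then have "(\<forall>i. b \<notin> D i) \<or> (\<exists>e\<in>N. \<forall>i. b \<in> D i \<longleftrightarrow> e \<in> D i)" using part_Br D(1,2) by blast
    then show "of_bool (b \<in> D 0) + of_bool (b \<in> D 1) + of_bool (b \<in> D 2) \<le> (2 :: nat)"
    proof
      assume "\<exists>e\<in>N. \<forall>i. b \<in> D i \<longleftrightarrow> e \<in> D i"
      then obtain e where "e \<in> N" "\<And>i. b \<in> D i \<longleftrightarrow> e \<in> D i" by blast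
      then show ?thesis using mem[of e] by (auto simp: Nf)
    qed simp
  qed
  finally have "card (D 0 \<inter> Br) + card (D 1 \<inter> Br) + card (D 2 \<inter> Br) \<le> 2 * card Br" by simp
  moreover have "3 * (x + y) \<le> 4 * n \<or> 3 * (x + z) \<le> 4 * n \<or> 3 * (y + z) \<le> 4 * n"
    if "x + y + z \<le> 2 * n" for x y z n :: nat
    using that by presburger
  ultimately have "3 * (card (D 0 \<inter> Br) + card (D 1 \<inter> Br)) \<le> 4 * card Br \<or>
    3 * (card (D 0 \<inter> Br) + card (D 2 \<inter> Br)) \<le> 4 * card Br \<or>
    3 * (card (D 1 \<inter> Br) + card (D 2 \<inter> Br)) \<le> 4 * card Br" by blast
  then obtain i j where ij: "(i, j) \<in> {(0, 1), (0, 2), (1, 2)}"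
    "3 * (card (D i \<inter> Br) + card (D j \<inter> Br)) \<le> 4 * card Br" by blast
  \<comment> \<open>Missing from one support means lying in the other two, so any two of them cover
    \<open>N\<close>; likewise an odd side is odd for any two up to one failure.\<close>
  have Nij: "N \<subseteq> Nf i \<union> Nf j" using ij(1) N12(1) by (auto simp: Nf)
  have odd_ij: "odd (card (Nf i \<inter> X)) \<or> odd (card (Nf j \<inter> X))"
    if "odd (card (N1 \<inter> X)) \<or> odd (card (N2 \<inter> X))" for X
    using ij(1) that odd_sd[of X] by (auto simp: Nf)
  obtain A1 A2 A3 where A: "eulerian A1" "eulerian A2" "eulerian A3" "A1 \<union> A2 \<union> A3 = Cyc"
    "3 * (card A1 + card A2 + card A3) \<le> 5 * card Cyc"
    by (rule bridgeless_cover[OF fin(3) Cyc_bridgeless]) (rule that)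
  have CycN: "Cyc \<inter> N = {}" "Cyc \<subseteq> E" by (auto simp: Cyc_def Pos_def)
  have finA: "finite A1" "finite A2" "finite A3" using A(4) fin(3) by (metis finite_Un)+
  have AN: "A1 \<inter> N = {}" "A2 \<inter> N = {}" "A3 \<inter> N = {}" using A(4) CycN by auto
  obtain L1 L2 L3 where L1: "\<forall>U\<in>set L1. scircuit N U \<and> U \<subseteq> A1" "A1 \<subseteq> \<Union>(set L1)" "(\<Sum>U\<leftarrow>L1. card U) = card A1"
    and L2: "\<forall>U\<in>set L2. scircuit N U \<and> U \<subseteq> A2" "A2 \<subseteq> \<Union>(set L2)" "(\<Sum>U\<leftarrow>L2. card U) = card A2"
    and L3: "\<forall>U\<in>set L3. scircuit N U \<and> U \<subseteq> A3" "A3 \<subseteq> \<Union>(set L3)" "(\<Sum>U\<leftarrow>L3. card U) = card A3"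
    using circuit_list[OF finA(1) A(1) AN(1)] circuit_list[OF finA(2) A(2) AN(2)]
      circuit_list[OF finA(3) A(3) AN(3)] by metis
  define L where "L = L1 @ L2 @ L3 @ \<F> i @ \<F> j"
  have Aj: "A1 \<subseteq> E" "A2 \<subseteq> E" "A3 \<subseteq> E" using A(4) CycN(2) by auto
  have "scircuit N U \<and> U \<subseteq> E" if "U \<in> set L" for U
  proof -
    have "U \<in> set L1 \<union> set L2 \<union> set L3 \<or> U \<in> set (\<F> i) \<or> U \<in> set (\<F> j)"
      using that by (auto simp: L_def)
    moreover have "scircuit N U \<and> U \<subseteq> A1 \<union> A2 \<union> A3" if "U \<in> set L1 \<union> set L2 \<union> set L3"
      using that L1(1) L2(1) L3(1) by auto
    ultimately show ?thesis using Aj \<F>(1)[of U] by blast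
  qed
  moreover have "E \<subseteq> \<Union>(set L)"
  proof
    fix e assume "e \<in> E"
    then consider "e \<in> Cyc" | "e \<in> N" | "e \<in> Br" by (auto simp: Br_def Pos_def)
    then show "e \<in> \<Union>(set L)"
    proof cases
      case 1
      then have "e \<in> \<Union>(set L1) \<union> \<Union>(set L2) \<union> \<Union>(set L3)" using A(4) L1(2) L2(2) L3(2) by blast
      then show ?thesis by (auto simp: L_def)
    next
      case 2
      then have "e \<in> D i \<union> D j" using mem Nij by blast
      then have "e \<in> \<Union>(set (\<F> i)) \<union> \<Union>(set (\<F> j))" using \<F>(2) by blast
      then show ?thesis by (auto simp: L_def)
    next
      case 3
      then have "e \<in> \<Union>(set (\<F> i)) \<union> \<Union>(set (\<F> j))"
      proof (cases rule: Br_cut)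
        case (1 S)
        then obtain S' where "E \<inter> cut S' = {e}" "odd (card (N1 \<inter> inside S')) \<or> odd (card (N2 \<inter> inside S'))"
          using N12(4) by blast
        then show ?thesis using odd_ij \<F>(4) by blast
      next
        case (2 S e')
        have "e' \<in> D i \<or> e' \<in> D j" using mem Nij 2(2) by blast
        then obtain k where k: "k \<in> {i, j}" "e' \<in> D k" by blast
        have "e' \<in> cut S" using 2(1) by blast
        then obtain x where x: "x \<in> D k" "x \<in> cut S" "x \<noteq> e'"
          using eulerian_cut_other[OF D(2) k(2)] by blast
        then have "x \<in> {e, e'}" using 2(1) D(1) by blast
        then have "e \<in> D k" using x by blast
        then show ?thesis using \<F>(2) k(1) by blast
      qed
      then show ?thesis by (auto simp: L_def)
    qed
  qed
  moreover have "3 * (\<Sum>U\<leftarrow>L. card U) + 5 * card N \<le> 11 * card E"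
  proof -
    have "card (Nf k) \<le> card N" for k using \<open>\<And>i. Nf i \<subseteq> N\<close> fin(1) by (intro card_mono)
    then have "(\<Sum>A\<leftarrow>\<F> k. card A) \<le> card N + card (D k \<inter> Br) + card Cyc + card Br" for k
      using \<F>(3)[of k] by (meson add_le_mono1 order_trans)
    from this[of i] this[of j]
    have "3 * (\<Sum>U\<leftarrow>L. card U) \<le> 3 * (card A1 + card A2 + card A3) + 6 * card N + 6 * card Cyc + 6 * card Br
        + 3 * (card (D i \<inter> Br) + card (D j \<inter> Br))"
      using L1(3) L2(3) L3(3) by (simp add: L_def)
    also have "\<dots> \<le> 5 * card Cyc + 6 * card N + 6 * card Cyc + 6 * card Br + 4 * card Br"
      using A(5) ij(2) by (intro add_mono) auto
    finally show ?thesis unfolding E_split by simp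
  qed
  ultimately show ?thesis by (intro exI[of _ L]) blast
qed

end

section \<open>Signed graphs\<close>

lemma sum_set_le_sum_list: "sum f (set xs) \<le> (\<Sum>x\<leftarrow>xs. f x :: nat)"
proof (induction xs)
  case (Cons x xs)
  then show ?case by (cases "x \<in> set xs") (simp_all add: insert_absorb)
qed simp

context ends
begin

text \<open>This turns equivalence of signatures into switching: the edges where they differ form a
  cut. If a new edge \<open>e\<close> is misplaced by \<open>W\<close>, then a circuit through
  \<open>e\<close> would meet the sum of \<open>F\<close> and \<open>cut W\<close> in
  \<open>e\<close> alone, against parity. So \<open>e\<close> joins two components, and switching
  one of them corrects \<open>e\<close> and nothing else.\<close>

lemma even_on_circuits_cut:
  assumes "finite E" and circuits: "\<And>U. circuit_set U \<Longrightarrow> U \<subseteq> E \<Longrightarrow> even (card (U \<inter> F))"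
  obtains W where "\<And>e. e \<in> E \<Longrightarrow> e \<in> F \<longleftrightarrow> e \<in> cut W"
proof -
  have "\<exists>W. \<forall>e\<in>E. e \<in> F \<longleftrightarrow> e \<in> cut W"
    using assms
  proof (induction E rule: finite_induct)
    case (insert e E)
    then obtain W where W: "\<forall>e\<in>E. e \<in> F \<longleftrightarrow> e \<in> cut W" by auto
    show ?case
    proof (cases "e \<in> F \<longleftrightarrow> e \<in> cut W")
      case True
      then show ?thesis using W by blast
    next
      case neq: False
      have "\<not> con E (t e) (h e)"
      proof
        assume "con E (t e) (h e)"
        moreover have "insert e E - {e} = E" using insert.hyps(2) by simp
        ultimately have "con (insert e E - {e}) (t e) (h e)" by simp
        then obtain Z where Z: "Z \<subseteq> insert e E" "eulerian Z" "e \<in> Z"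
          by (rule not_bridge_eulerian) (use insert.hyps(1) in auto)
        have finZ: "finite Z" using finite_subset[OF Z(1)] insert.hyps(1) by simp
        obtain U where U: "U \<subseteq> Z" "circuit_set U" "e \<in> U"
          by (rule eulerian_circuit[OF finZ Z(2,3)]) (rule that)
        have finU: "finite U" using U(1) finZ finite_subset by blast
        have "even (card (U \<inter> F))" using insert.prems U Z(1) by blast
        moreover have "even (card (U \<inter> cut W))"
          using circuit_set_eulerian[OF U(2)] by (rule eulerian_even_cut)
        ultimately have "even (card (sym_diff (U \<inter> F) (U \<inter> cut W)))"
          using odd_card_sym_diff[of "U \<inter> F" "U \<inter> cut W"] finU by simp
        moreover have "sym_diff (U \<inter> F) (U \<inter> cut W) = {e}"
          using W U Z(1) neq by auto
        ultimately show False by simp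
      qed
      then have "h e \<notin> component E (t e)" by (simp add: component_def)
      then have cut_e: "e \<in> cut (component E (t e))" by (simp add: cut_def)
      define W' where "W' = sym_diff W (component E (t e))"
      have cutW': "cut W' = sym_diff (cut W) (cut (component E (t e)))"
        by (auto simp: W'_def cut_def)
      have "x \<in> F \<longleftrightarrow> x \<in> cut W'" if "x \<in> E" for x
      proof -
        have "x \<notin> cut (component E (t e))" using cut_component[of E "t e"] that by blast
        then show ?thesis using W that unfolding cutW' by blast
      qed
      moreover have "e \<in> F \<longleftrightarrow> e \<in> cut W'" using neq cut_e unfolding cutW' by blast
      ultimately show ?thesis by blast
    qed
  qed auto
  then show thesis using that by blast
qed

section \<open>Edge sets as subgraphs\<close>

definition sub :: "'e set \<Rightarrow> ('v, 'e) pre_digraph" where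
  "sub U = \<lparr>verts = vset U, arcs = U, tail = t, head = h\<rparr>"

lemma sub_simps [simp]: "verts (sub U) = vset U" "arcs (sub U) = U" "tail (sub U) = t" "head (sub U) = h"
  by (simp_all add: sub_def)

lemma wf_sub: "wf_digraph (sub U)"
  by unfold_locales (auto simp: vset_def)

lemma circuit_sub:
  assumes U: "circuit_set U"
  shows "circuit (sub U)"
  unfolding circuit_def
proof (intro conjI ballI)
  have finU: "finite U" using U by (simp add: circuit_set_def)
  interpret wf_digraph "sub U" by (rule wf_sub)
  show "fin_digraph (sub U)" using finU by unfold_locales (simp_all add: finite_vset)
  \<comment> \<open>\<open>connected\<close> means strong connectivity of the symmetric closure; the
    set reachable there from \<open>u\<close> is not crossed by \<open>U\<close>.\<close>
  let ?M = "with_proj (mk_symmetric (sub U))"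
  have verts: "verts ?M = vset U" and arcs: "arcs_ends ?M = (\<Union>e\<in>U. {(t e, h e), (h e, t e)})"
    by (simp_all add: mk_symmetric_def)
  have "u \<rightarrow>\<^sup>*\<^bsub>?M\<^esub> w" if uw: "u \<in> vset U" "w \<in> vset U" for u w
  proof -
    define S where "S = {v. u \<rightarrow>\<^sup>*\<^bsub>?M\<^esub> v}"
    have "u \<in> S" using uw(1) by (simp add: S_def reachable_def verts)
    have closed: "y \<in> S" if "x \<in> S" "(x, y) \<in> arcs_ends ?M" for x y
    proof -
      have "(x, y) \<in> (\<Union>e\<in>U. {(t e, h e), (h e, t e)})" using that(2) unfolding arcs .
      then have "y \<in> vset U" by (auto simp: vset_def)
      then show ?thesis
        using that rtrancl_on_into_rtrancl_on[of u x "vset U" "arcs_ends ?M" y]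
        by (simp add: S_def reachable_def verts)
    qed
    have "U \<inter> cut S = {}"
    proof (rule equals0I)
      fix e assume "e \<in> U \<inter> cut S"
      then have "(t e, h e) \<in> arcs_ends ?M" "(h e, t e) \<in> arcs_ends ?M" "(t e \<in> S) \<noteq> (h e \<in> S)"
        unfolding arcs by (auto simp: cut_def)
      then show False using closed by blast
    qed
    moreover have "con U u w" using U uw by (simp add: circuit_set_def)
    ultimately have "w \<in> S" using \<open>u \<in> S\<close> unfolding con_def by blast
    then show ?thesis by (simp add: S_def)
  qed
  moreover have "vset U \<noteq> {}" using U by (auto simp: circuit_set_def vset_def)
  ultimately show "Digraph_Component.connected (sub U)"
    unfolding connected_def strongly_connected_def verts by blast
  show "in_degree (sub U) v + out_degree (sub U) v = 2" if "v \<in> verts (sub U)" for v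
  proof -
    have "in_degree (sub U) v + out_degree (sub U) v = dg U v"
      by (simp add: in_degree_def out_degree_def in_arcs_def out_arcs_def dg_def)
    moreover have "dg U v \<noteq> 0" using dg_eq_0_iff[OF finU] that by simp
    ultimately show ?thesis using U unfolding circuit_set_def by metis
  qed
qed

lemma negative_edges_sub: "U \<subseteq> arcs G \<Longrightarrow> negative_edges (sub U) \<tau> = U \<inter> negative_edges G \<tau>"
  by (auto simp: negative_edges_def)

end

section \<open>Minimum signatures and flows in terms of cuts\<close>

lemma subgraph_ends:
  assumes "subgraph C G"
  shows "tail C = tail G" "head C = head G" "arcs C \<subseteq> arcs G" "wf_digraph C"
  using assms by (auto simp: subgraph_def compatible_def)

lemma subgraph_sub:
  assumes "wf_digraph G" "U \<subseteq> arcs G"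
  shows "subgraph (ends.sub (tail G) (head G) U) G"
proof -
  interpret ends "tail G" "head G" .
  interpret wf_digraph G by (rule assms(1))
  have "vset U \<subseteq> verts G" using assms(2) by (auto simp: vset_def)
  then show ?thesis using assms wf_sub by (simp add: subgraph_def compatible_def)
qed

lemma circuit_eulerian:
  assumes "circuit C" "subgraph C G"
  shows "ends.eulerian (tail G) (head G) (arcs C)"
proof -
  interpret ends "tail G" "head G" .
  note ends_eq = subgraph_ends[OF assms(2)]
  interpret C: fin_digraph C using assms(1) by (simp add: circuit_def)
  have "even (dg (arcs C) v)" for v
  proof (cases "v \<in> verts C")
    case True
    have "dg (arcs C) v = in_degree C v + out_degree C v"
      by (simp add: in_degree_def out_degree_def in_arcs_def out_arcs_def dg_def ends_eq(1,2))
    then show ?thesis using assms(1) True by (simp add: circuit_def)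
  next
    case False
    moreover have "tail G e \<in> verts C" "head G e \<in> verts C" if "e \<in> arcs C" for e
      using C.wellformed[OF that] by (simp_all add: ends_eq(1,2))
    ultimately have "v \<notin> vset (arcs C)" by (auto simp: vset_def)
    then show ?thesis using dg_eq_0_iff[OF C.finite_arcs, of v] by simp
  qed
  then show ?thesis using eulerian_if_even_dg[OF C.finite_arcs] by blast
qed

text \<open>Negating the signature on a cut changes each circuit in evenly many edges, hence gives
  an equivalent signature, in which the positive and negative edges of the cut are
  exchanged.\<close>

lemma minimum_signature_cut:
  assumes G: "fin_digraph G" and min: "minimum_signature G \<sigma> \<tau>"
  defines "N \<equiv> negative_edges G \<tau>"
  shows "2 * card (N \<inter> ends.cut (tail G) (head G) S) \<le> card (arcs G \<inter> ends.cut (tail G) (head G) S)"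
proof -
  interpret fin_digraph G by (rule G)
  interpret ends "tail G" "head G" .
  have eq: "equivalent_signatures G \<sigma> \<tau>" using min by (simp add: minimum_signature_def)
  then have sig: "signature G \<sigma>" "signature G \<tau>"
    and bal: "\<And>C. subgraph C G \<Longrightarrow> balanced_circuit \<sigma> C \<longleftrightarrow> balanced_circuit \<tau> C"
    by (auto simp: equivalent_signatures_def set_eq_iff)
  define \<tau>' where "\<tau>' = (\<lambda>e. if e \<in> cut S then - \<tau> e else \<tau> e)"
  have sig': "signature G \<tau>'" using sig(2) by (auto simp: signature_def \<tau>'_def)
  have neg: "negative_edges C \<tau>' = sym_diff (negative_edges C \<tau>) (arcs C \<inter> cut S)"
    if "arcs C \<subseteq> arcs G" for C :: "('a, 'b) pre_digraph"
  proof -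
    have "\<tau> e = 1 \<or> \<tau> e = -1" if "e \<in> arcs C" for e
      using sig(2) that \<open>arcs C \<subseteq> arcs G\<close> by (auto simp: signature_def)
    then show ?thesis by (auto simp: negative_edges_def \<tau>'_def)
  qed
  have "balanced_circuit \<tau> C \<longleftrightarrow> balanced_circuit \<tau>' C" if C: "subgraph C G" for C
  proof (cases "circuit C")
    case True
    then have "finite (arcs C)" by (auto simp: circuit_def dest: fin_digraph.finite_arcs)
    moreover have "even (card (arcs C \<inter> cut S))"
      using circuit_eulerian[OF True C] by (rule eulerian_even_cut)
    moreover have "finite (negative_edges C \<tau>)"
      using \<open>finite (arcs C)\<close> by (simp add: negative_edges_def)
    ultimately have "even (card (negative_edges C \<tau>')) \<longleftrightarrow> even (card (negative_edges C \<tau>))"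
      unfolding neg[OF subgraph_ends(3)[OF C]]
      using odd_card_sym_diff[of "negative_edges C \<tau>" "arcs C \<inter> cut S"] by simp
    then show ?thesis by (simp add: balanced_circuit_def)
  qed (simp add: balanced_circuit_def)
  then have "equivalent_signatures G \<sigma> \<tau>'"
    using sig sig' bal by (auto simp: equivalent_signatures_def)
  then have "card N \<le> card (negative_edges G \<tau>')"
    using min by (simp add: minimum_signature_def N_def)
  moreover have N: "N \<subseteq> arcs G" by (auto simp: N_def negative_edges_def)
  have finN: "finite N" using N finite_arcs finite_subset by blast
  have "negative_edges G \<tau>' = (N - cut S) \<union> (arcs G \<inter> cut S - N)"
    using N by (auto simp: neg N_def[symmetric])
  moreover have "card ((N - cut S) \<union> (arcs G \<inter> cut S - N)) = card (N - cut S) + card (arcs G \<inter> cut S - N)"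
    using finN by (intro card_Un_disjoint) auto
  moreover have "card N = card (N \<inter> cut S) + card (N - cut S)"
    using card_Int_Diff[OF finN] .
  moreover have "card (arcs G \<inter> cut S) = card (N \<inter> cut S) + card (arcs G \<inter> cut S - N)"
  proof -
    have "arcs G \<inter> cut S \<inter> N = N \<inter> cut S" using N by blast
    then show ?thesis using card_Int_Diff[of "arcs G \<inter> cut S" N] by simp
  qed
  ultimately show ?thesis by simp
qed

text \<open>
  A nowhere-zero flow of \<open>(G, \<sigma>)\<close>, switched to the signature \<open>\<tau>\<close>: the values at the two ends of
  an edge \<open>e\<close> are \<open>a e\<close> and \<open>- \<tau> e * a e\<close>.
\<close>

lemma switched_flow:
  fixes G :: "('v, 'e) pre_digraph"
  assumes G: "fin_digraph G" and \<sigma>: "flow_admissible G \<sigma>" and eq: "equivalent_signatures G \<sigma> \<tau>"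
  obtains a :: "'e \<Rightarrow> int" where "\<And>e. e \<in> arcs G \<Longrightarrow> a e \<noteq> 0"
    "\<And>S. (\<Sum>e\<in>arcs G. a e * (of_bool (tail G e \<in> S) - \<tau> e * of_bool (head G e \<in> S))) = 0"
proof -
  interpret fin_digraph G by (rule G)
  interpret ends "tail G" "head G" .
  define E where "E = arcs G"
  have finE: "finite E" by (simp add: E_def)
  have sig: "\<And>e. e \<in> E \<Longrightarrow> \<sigma> e \<in> {1, -1}" "\<And>e. e \<in> E \<Longrightarrow> \<tau> e \<in> {1, -1}"
    and bal: "\<And>C. subgraph C G \<Longrightarrow> balanced_circuit \<sigma> C \<longleftrightarrow> balanced_circuit \<tau> C"
    using eq by (auto simp: equivalent_signatures_def signature_def set_eq_iff E_def)
  define F where "F = {e \<in> E. \<sigma> e \<noteq> \<tau> e}"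
  have "even (card (U \<inter> F))" if U: "circuit_set U" "U \<subseteq> E" for U
  proof -
    have neg: "negative_edges (sub U) \<rho> = U \<inter> {e. \<rho> e = -1}" for \<rho> :: "'e \<Rightarrow> int"
      by (auto simp: negative_edges_def)
    have "balanced_circuit \<sigma> (sub U) \<longleftrightarrow> balanced_circuit \<tau> (sub U)"
      using U(2) by (intro bal subgraph_sub wf_digraph) (simp add: E_def)
    then have "even (card (U \<inter> {e. \<sigma> e = -1})) \<longleftrightarrow> even (card (U \<inter> {e. \<tau> e = -1}))"
      using circuit_sub[OF U(1)] by (simp add: balanced_circuit_def neg)
    moreover have "U \<inter> F = sym_diff (U \<inter> {e. \<sigma> e = -1}) (U \<inter> {e. \<tau> e = -1})"
    proof -
      have "e \<in> F \<longleftrightarrow> (\<sigma> e = -1) \<noteq> (\<tau> e = -1)" if "e \<in> U" for e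
        using sig[of e] that U(2) by (auto simp: F_def)
      then show ?thesis by auto
    qed
    moreover have "finite U" using U(1) by (simp add: circuit_set_def)
    ultimately show ?thesis
      using odd_card_sym_diff[of "U \<inter> {e. \<sigma> e = -1}" "U \<inter> {e. \<tau> e = -1}"] by simp
  qed
  then obtain W where W: "\<And>e. e \<in> E \<Longrightarrow> e \<in> F \<longleftrightarrow> e \<in> cut W"
    by (rule even_on_circuits_cut[OF finE]) (assumption, assumption, rule that)
  \<comment> \<open>The signatures differ exactly on the cut of \<open>W\<close>, so changing the
    sign of the half-edges at the vertices of \<open>W\<close> makes a flow for
    \<open>\<sigma>\<close> one for \<open>\<tau>\<close>.\<close>
  define s :: "'v \<Rightarrow> int" where "s = (\<lambda>v. if v \<in> W then -1 else 1)"
  have \<tau>: "\<tau> e * s (tail G e) = \<sigma> e * s (head G e)" if "e \<in> E" for e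
    using W[OF that] sig[OF that] that by (auto simp: F_def cut_def s_def)
  obtain ot oh f where ot: "orientation G \<sigma> ot oh" and f: "nowhere_zero_flow G ot oh f"
    using \<sigma> by (auto simp: flow_admissible_def)
  define a where "a = (\<lambda>e. s (tail G e) * ot e * f e)"
  have oh: "s (head G e) * oh e * f e = - \<tau> e * a e" if "e \<in> E" for e
  proof -
    have o: "ot e \<in> {1, -1}" "ot e * oh e = - \<sigma> e" using ot that by (auto simp: orientation_def E_def)
    then have "oh e = - \<sigma> e * ot e" by auto
    then have "s (head G e) * oh e * f e = - (\<sigma> e * s (head G e)) * ot e * f e" by simp
    then show ?thesis by (simp add: \<tau>[OF that, symmetric] a_def)
  qed
  show thesis
  proof (rule that[of a])
    show "a e \<noteq> 0" if "e \<in> arcs G" for e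
      using ot f that by (auto simp: orientation_def nowhere_zero_flow_def a_def s_def)
    fix S
    define V where "V = S \<inter> verts G"
    have finV: "finite V" by (simp add: V_def)
    have pick: "(\<Sum>v\<in>V. of_bool (v = x) * c) = of_bool (x \<in> S) * c" if "x \<in> verts G" for x and c :: int
    proof -
      have "(\<Sum>v\<in>V. of_bool (v = x) * c) = (\<Sum>v\<in>V. if v = x then c else 0)"
        by (intro sum.cong) auto
      then show ?thesis using finV that by (simp add: V_def)
    qed
    have "0 = (\<Sum>v\<in>V. s v * ((\<Sum>e\<in>out_arcs G v. ot e * f e) + (\<Sum>e\<in>in_arcs G v. oh e * f e)))"
      using f by (intro sum.neutral[symmetric]) (auto simp: nowhere_zero_flow_def V_def)
    also have "\<dots> = (\<Sum>v\<in>V. \<Sum>e\<in>E. of_bool (v = tail G e) * a e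
        + of_bool (v = head G e) * (s (head G e) * oh e * f e))"
    proof (intro sum.cong refl)
      fix v
      have "(\<Sum>e\<in>out_arcs G v. ot e * f e) = (\<Sum>e\<in>E. of_bool (v = tail G e) * (ot e * f e))"
        using finE by (intro sum.mono_neutral_cong_left) (auto simp: out_arcs_def E_def)
      moreover have "(\<Sum>e\<in>in_arcs G v. oh e * f e) = (\<Sum>e\<in>E. of_bool (v = head G e) * (oh e * f e))"
        using finE by (intro sum.mono_neutral_cong_left) (auto simp: in_arcs_def E_def)
      ultimately have "s v * ((\<Sum>e\<in>out_arcs G v. ot e * f e) + (\<Sum>e\<in>in_arcs G v. oh e * f e)) =
        s v * ((\<Sum>e\<in>E. of_bool (v = tail G e) * (ot e * f e)) +
          (\<Sum>e\<in>E. of_bool (v = head G e) * (oh e * f e)))" by simp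
      also have "\<dots> = (\<Sum>e\<in>E. s v * (of_bool (v = tail G e) * (ot e * f e) +
          of_bool (v = head G e) * (oh e * f e)))"
        unfolding sum.distrib[symmetric] sum_distrib_left ..
      also have "\<dots> = (\<Sum>e\<in>E. of_bool (v = tail G e) * a e +
          of_bool (v = head G e) * (s (head G e) * oh e * f e))"
        by (intro sum.cong) (auto simp: a_def distrib_left)
      finally show "s v * ((\<Sum>e\<in>out_arcs G v. ot e * f e) + (\<Sum>e\<in>in_arcs G v. oh e * f e)) =
        (\<Sum>e\<in>E. of_bool (v = tail G e) * a e + of_bool (v = head G e) * (s (head G e) * oh e * f e))" .
    qed
    also have "\<dots> = (\<Sum>e\<in>E. \<Sum>v\<in>V. of_bool (v = tail G e) * a e
        + of_bool (v = head G e) * (s (head G e) * oh e * f e))" by (rule sum.swap)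
    also have "\<dots> = (\<Sum>e\<in>E. a e * (of_bool (tail G e \<in> S) - \<tau> e * of_bool (head G e \<in> S)))"
    proof (intro sum.cong refl)
      fix e assume e: "e \<in> E"
      then have "tail G e \<in> verts G" "head G e \<in> verts G" by (simp_all add: E_def)
      then show "(\<Sum>v\<in>V. of_bool (v = tail G e) * a e + of_bool (v = head G e) * (s (head G e) * oh e * f e)) =
        a e * (of_bool (tail G e \<in> S) - \<tau> e * of_bool (head G e \<in> S))"
        by (simp only: sum.distrib pick oh[OF e]) (simp add: algebra_simps)
    qed
    finally show "(\<Sum>e\<in>arcs G. a e * (of_bool (tail G e \<in> S) - \<tau> e * of_bool (head G e \<in> S))) = 0"
      by (simp add: E_def)
  qed
qed

text \<open>In the sum of the switched flow over \<open>S\<close>, a positive edge inside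
  \<open>S\<close> cancels and a negative one counts twice. If one of the two properties failed, a
  single edge would contribute and the sum could not be zero.\<close>

lemma flow_admissible_ends:
  assumes G: "fin_digraph G" and \<sigma>: "flow_admissible G \<sigma>" and min: "minimum_signature G \<sigma> \<tau>"
  shows "flow_ends (tail G) (head G) (arcs G) (negative_edges G \<tau>)"
proof -
  interpret fin_digraph G by (rule G)
  interpret ends "tail G" "head G" .
  define N where "N = negative_edges G \<tau>"
  have eq: "equivalent_signatures G \<sigma> \<tau>" using min by (simp add: minimum_signature_def)
  have \<tau>: "\<tau> e = (if e \<in> N then -1 else 1)" if "e \<in> arcs G" for e
    using eq that by (auto simp: equivalent_signatures_def signature_def N_def negative_edges_def)
  obtain a :: "'b \<Rightarrow> int" where a: "\<And>e. e \<in> arcs G \<Longrightarrow> a e \<noteq> 0"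
    "\<And>S. (\<Sum>e\<in>arcs G. a e * (of_bool (tail G e \<in> S) - \<tau> e * of_bool (head G e \<in> S))) = 0"
    by (rule switched_flow[OF G \<sigma> eq]) (rule that)
  have one_edge: False
    if b: "b \<in> arcs G" "of_bool (tail G b \<in> S) - \<tau> b * of_bool (head G b \<in> S) \<noteq> 0"
      and rest: "\<And>e. e \<in> arcs G - {b} \<Longrightarrow> of_bool (tail G e \<in> S) - \<tau> e * of_bool (head G e \<in> S) = 0"
    for b S
  proof -
    have "(\<Sum>e\<in>arcs G. a e * (of_bool (tail G e \<in> S) - \<tau> e * of_bool (head G e \<in> S)))
      = (\<Sum>e\<in>{b}. a e * (of_bool (tail G e \<in> S) - \<tau> e * of_bool (head G e \<in> S)))"
      using b(1) rest by (intro sum.mono_neutral_right) auto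
    then show False using a(1)[OF b(1)] a(2)[of S] b(2) by simp
  qed
  have N: "N \<subseteq> arcs G" by (auto simp: N_def negative_edges_def)
  show ?thesis
    unfolding N_def[symmetric]
  proof unfold_locales
    show "2 * card (N \<inter> cut S) \<le> card (arcs G \<inter> cut S)" for S
      using minimum_signature_cut[OF G min, of S] by (simp add: N_def)
    show "N \<inter> inside S \<noteq> {}" if b: "arcs G \<inter> cut S = {b}" for S b
    proof
      assume empty: "N \<inter> inside S = {}"
      have bE: "b \<in> arcs G" "b \<in> cut S" using b by auto
      show False
      proof (rule one_edge[of b S])
        fix e assume "e \<in> arcs G - {b}"
        then have e: "e \<in> arcs G" "e \<notin> cut S" using b by auto
        then have "e \<in> inside S \<Longrightarrow> \<tau> e = 1" using empty \<tau> by auto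
        then show "of_bool (tail G e \<in> S) - \<tau> e * of_bool (head G e \<in> S) = 0"
          using e(2) by (auto simp: cut_def inside_def)
      qed (use bE \<tau>[OF bE(1)] in \<open>auto simp: cut_def\<close>)
    qed
    show "card (N \<inter> inside S) \<noteq> 1" if closed: "arcs G \<inter> cut S = {}" for S
    proof
      assume "card (N \<inter> inside S) = 1"
      then obtain b where b: "N \<inter> inside S = {b}" by (auto simp: card_1_singleton_iff)
      then have bN: "b \<in> N" "b \<in> inside S" "b \<in> arcs G" using N by auto
      show False
      proof (rule one_edge[of b S])
        fix e assume "e \<in> arcs G - {b}"
        then have e: "e \<in> arcs G" "e \<notin> cut S" "e \<noteq> b" using closed by auto
        then have "e \<in> inside S \<Longrightarrow> \<tau> e = 1" using b \<tau> by auto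
        then show "of_bool (tail G e \<in> S) - \<tau> e * of_bool (head G e \<in> S) = 0"
          using e(2) by (auto simp: cut_def inside_def)
      qed (use bN \<tau>[OF bN(3)] in \<open>auto simp: inside_def\<close>)
    qed
  qed (use N in auto)
qed

lemma scircuit_signed_circuit:
  fixes G :: "('v, 'e) pre_digraph"
  assumes G: "wf_digraph G" and eq: "equivalent_signatures G \<sigma> \<tau>"
    and A: "ends.scircuit (tail G) (head G) (negative_edges G \<tau>) A" "A \<subseteq> arcs G"
  shows "\<exists>F. subgraph F G \<and> signed_circuit \<sigma> F \<and> arcs F = A"
proof -
  interpret ends "tail G" "head G" .
  interpret wf_digraph G by (rule G)
  define N where "N = negative_edges G \<tau>"
  have bal: "\<And>C. subgraph C G \<Longrightarrow> balanced_circuit \<sigma> C \<longleftrightarrow> balanced_circuit \<tau> C"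
    using eq by (auto simp: equivalent_signatures_def set_eq_iff)
  have balanced: "balanced_circuit \<sigma> (sub U) \<longleftrightarrow> even (card (U \<inter> N))" if "circuit_set U" "U \<subseteq> arcs G" for U
    using bal[OF subgraph_sub[OF G that(2)]] circuit_sub[OF that(1)]
    by (simp add: balanced_circuit_def negative_edges_sub[OF that(2)] N_def)
  have unbalanced: "unbalanced_circuit \<sigma> (sub U)" if "circuit_set U" "U \<subseteq> arcs G" "odd (card (U \<inter> N))" for U
    using balanced[OF that(1,2)] that(3) circuit_sub[OF that(1)]
    by (simp add: balanced_circuit_def unbalanced_circuit_def)
  have subI: "subgraph (sub U) B"
    if "vset U \<subseteq> verts B" "U \<subseteq> arcs B" "wf_digraph B" "tail B = tail G" "head B = head G"
    for U and B :: "('v, 'e) pre_digraph"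
    using that wf_sub by (simp add: subgraph_def compatible_def)
  consider "circuit_set A" "even (card (A \<inter> N))" | "barbell N A"
    using A(1) by (auto simp: scircuit_def N_def)
  then show ?thesis
  proof cases
    case 1
    then show ?thesis
      using balanced[OF 1(1) A(2)] subgraph_sub[OF G A(2)]
      by (intro exI[of _ "sub A"]) (simp add: signed_circuit_def)
  next
    case 2
    then obtain U U' where U: "circuit_set U" "circuit_set U'" "odd (card (U \<inter> N))" "odd (card (U' \<inter> N))"
      "U \<inter> U' = {}" and cases: "((\<exists>v. vset U \<inter> vset U' = {v}) \<and> A = U \<union> U' \<or>
      vset U \<inter> vset U' = {} \<and> (\<exists>vs es. distinct vs \<and> distinct es \<and> length vs = Suc (length es) \<and>
        (\<forall>i<length es. {tail G (es ! i), head G (es ! i)} = {vs ! i, vs ! Suc i}) \<and>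
        set vs \<inter> vset U = {hd vs} \<and> set vs \<inter> vset U' = {last vs} \<and> A = U \<union> U' \<union> set es))"
      unfolding barbell_def by blast
    have UA: "U \<subseteq> arcs G" "U' \<subseteq> arcs G" using cases A(2) by auto
    have V: "vset U \<subseteq> verts G" "vset U' \<subseteq> verts G" using UA by (auto simp: vset_def)
    note unb = unbalanced[OF U(1) UA(1) U(3)] unbalanced[OF U(2) UA(2) U(4)]
    from cases show ?thesis
    proof (elim disjE conjE exE)
      fix v assume v: "vset U \<inter> vset U' = {v}" and A_eq: "A = U \<union> U'"
      define B where "B = union (sub U) (sub U')"
      have B: "verts B = vset U \<union> vset U'" "arcs B = U \<union> U'" "tail B = tail G" "head B = head G"
        by (simp_all add: B_def union_def)
      have wf: "wf_digraph B" by unfold_locales (auto simp: B vset_def)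
      have "subgraph (sub U) B" "subgraph (sub U') B" using wf by (auto intro!: subI simp: B)
      then have "short_barbell \<sigma> B"
        unfolding short_barbell_def using unb v U(5) B_def
        by (intro exI[of _ "sub U"] exI[of _ "sub U'"] exI[of _ v]) simp
      moreover have "subgraph B G" using wf G V UA by (simp add: subgraph_def compatible_def B)
      ultimately show ?thesis using A_eq B(2) by (intro exI[of _ B]) (simp add: signed_circuit_def)
    next
      fix vs es
      assume disj: "vset U \<inter> vset U' = {}" and A_eq: "A = U \<union> U' \<union> set es"
        and path: "distinct vs" "distinct es" "length vs = Suc (length es)"
          "\<forall>i<length es. {tail G (es ! i), head G (es ! i)} = {vs ! i, vs ! Suc i}"
        and ends: "set vs \<inter> vset U = {hd vs}" "set vs \<inter> vset U' = {last vs}"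
      define P :: "('v, 'e) pre_digraph" where
        "P = \<lparr>verts = set vs, arcs = set es, tail = tail G, head = head G\<rparr>"
      define B where "B = union (union (sub U) (sub U')) P"
      have P: "verts P = set vs" "arcs P = set es" "tail P = tail G" "head P = head G"
        by (simp_all add: P_def)
      have B: "verts B = vset U \<union> vset U' \<union> set vs" "arcs B = U \<union> U' \<union> set es"
        "tail B = tail G" "head B = head G"
        by (simp_all add: B_def union_def P)
      have es_vs: "tail G e \<in> set vs \<and> head G e \<in> set vs" if "e \<in> set es" for e
      proof -
        from that obtain i where i: "i < length es" "e = es ! i" by (auto simp: in_set_conv_nth)
        have "vs ! i \<in> set vs" "vs ! Suc i \<in> set vs" using i path(3) by auto
        moreover have "{tail G e, head G e} = {vs ! i, vs ! Suc i}" using path(4) i by simp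
        ultimately show ?thesis by (auto simp: doubleton_eq_iff)
      qed
      have vs_G: "set vs \<subseteq> verts G"
      proof
        fix x assume "x \<in> set vs"
        then obtain i where i: "i < length vs" "x = vs ! i" by (auto simp: in_set_conv_nth)
        show "x \<in> verts G"
        proof (cases i)
          case 0
          have "hd vs \<in> vset U" using ends(1) by blast
          moreover have "x = hd vs" using i 0 by (cases vs) auto
          ultimately show ?thesis using V(1) by blast
        next
          case (Suc j)
          then have j: "j < length es" using i(1) path(3) by simp
          then have "{tail G (es ! j), head G (es ! j)} = {vs ! j, x}" using path(4) i(2) Suc by simp
          moreover have "es ! j \<in> arcs G" using j A_eq A(2) by auto
          ultimately show ?thesis
            using tail_in_verts[of "es ! j"] head_in_verts[of "es ! j"] by (auto simp: doubleton_eq_iff)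
        qed
      qed
      have wf: "wf_digraph B" by unfold_locales (use es_vs in \<open>auto simp: B vset_def\<close>)
      have wfP: "wf_digraph P" by unfold_locales (use es_vs in \<open>auto simp: P\<close>)
      have "subgraph (sub U) B" "subgraph (sub U') B" using wf by (auto intro!: subI simp: B)
      moreover have "subgraph P B" using wf wfP by (auto simp: subgraph_def compatible_def B P)
      moreover have "path_between P (hd vs) (last vs)"
        unfolding path_between_def using path by (intro exI[of _ vs] exI[of _ es]) (simp add: P)
      ultimately have "long_barbell \<sigma> B"
        unfolding long_barbell_def using unb disj ends B_def P(1)
        by (intro exI[of _ "sub U"] exI[of _ "sub U'"] exI[of _ P] exI[of _ "hd vs"] exI[of _ "last vs"]) simp
      moreover have "subgraph B G"
        using wf G V vs_G A(2) A_eq by (simp add: subgraph_def compatible_def B)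
      ultimately show ?thesis using A_eq B(2) by (intro exI[of _ B]) (simp add: signed_circuit_def)
    qed
  qed
qed

theorem theorem1p3:
  fixes G :: "('v, 'e) pre_digraph" and \<sigma> \<sigma>\<^sub>m\<^sub>i\<^sub>n :: "'e \<Rightarrow> int" and m \<epsilon>\<^sub>N :: nat
  assumes "fin_digraph G"
    and "signature G \<sigma>"
    and "flow_admissible G \<sigma>"
    and "m = card (arcs G)"
    and "minimum_signature G \<sigma> \<sigma>\<^sub>m\<^sub>i\<^sub>n"
    and "\<epsilon>\<^sub>N = card (negative_edges G \<sigma>\<^sub>m\<^sub>i\<^sub>n)"
  shows "\<exists>\<C>. signed_circuit_cover G \<sigma> \<C> \<and>
           real (cover_length \<C>) \<le> 11 / 3 * real m - 5 / 3 * real \<epsilon>\<^sub>N"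
proof -
  interpret fin_digraph G by (rule assms(1))
  interpret flow_ends "tail G" "head G" "arcs G" "negative_edges G \<sigma>\<^sub>m\<^sub>i\<^sub>n"
    using assms(1,3,5) by (rule flow_admissible_ends)
  have eq: "equivalent_signatures G \<sigma> \<sigma>\<^sub>m\<^sub>i\<^sub>n" using assms(5) by (simp add: minimum_signature_def)
  obtain \<F> where \<F>: "\<And>A. A \<in> set \<F> \<Longrightarrow> scircuit (negative_edges G \<sigma>\<^sub>m\<^sub>i\<^sub>n) A \<and> A \<subseteq> arcs G"
    "arcs G \<subseteq> \<Union>(set \<F>)" "3 * (\<Sum>A\<leftarrow>\<F>. card A) + 5 * \<epsilon>\<^sub>N \<le> 11 * m"
    using signed_cover unfolding assms(4,6) by blast
  have "\<exists>F. subgraph F G \<and> signed_circuit \<sigma> F \<and> arcs F = A" if "A \<in> set \<F>" for A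
    using scircuit_signed_circuit[OF wf_digraph eq] \<F>(1)[OF that] by blast
  then obtain g where g: "\<And>A. A \<in> set \<F> \<Longrightarrow> subgraph (g A) G \<and> signed_circuit \<sigma> (g A) \<and> arcs (g A) = A"
    by metis
  define \<C> where "\<C> = g ` set \<F>"
  have "signed_circuit_cover G \<sigma> \<C>"
    unfolding signed_circuit_cover_def
  proof (intro conjI ballI)
    show "finite \<C>" by (simp add: \<C>_def)
    show "subgraph F G" "signed_circuit \<sigma> F" if "F \<in> \<C>" for F
      using that g by (auto simp: \<C>_def)
    show "\<exists>F\<in>\<C>. e \<in> arcs F" if "e \<in> arcs G" for e
    proof -
      obtain A where "A \<in> set \<F>" "e \<in> A" using \<F>(2) \<open>e \<in> arcs G\<close> by blast
      then show ?thesis using g by (auto simp: \<C>_def)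
    qed
  qed
  moreover have "real (cover_length \<C>) \<le> 11 / 3 * real m - 5 / 3 * real \<epsilon>\<^sub>N"
  proof -
    \<comment> \<open>Repetitions in the list disappear in the set, which can only shorten the
      cover.\<close>
    have "cover_length \<C> \<le> (\<Sum>A\<in>set \<F>. card (arcs (g A)))"
      using sum_image_le[of "set \<F>" "\<lambda>F. card (arcs F)" g] by (simp add: cover_length_def \<C>_def)
    also have "\<dots> = (\<Sum>A\<in>set \<F>. card A)" using g by (intro sum.cong) auto
    also have "\<dots> \<le> (\<Sum>A\<leftarrow>\<F>. card A)" by (rule sum_set_le_sum_list)
    finally have "3 * cover_length \<C> + 5 * \<epsilon>\<^sub>N \<le> 11 * m" using \<F>(3) by linarith
    then have "3 * real (cover_length \<C>) + 5 * real \<epsilon>\<^sub>N \<le> 11 * real m"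
      by (metis (mono_tags) of_nat_add of_nat_le_iff of_nat_mult of_nat_numeral)
    then show ?thesis by simp
  qed
  ultimately show ?thesis by blast
qed

end
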